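(* (NSVW formula for the graviton MHV amplitude.) Let $N\ge1$, $I=N+1$, $J=N+2$, and let $\mathcal M_{\rm MHV}$ be the stripped tree-level amplitude for $N$ positive helicity gravitons $1,\dots,N$ and two negative helicity gravitons $I,J$, computed from the MHV generating function as follows: the coefficient of $\epsilon_1\epsilon_2\cdots\epsilon_{N+2}$ in the 4-form $\Sigma_0^{AB}\wedge(\gamma^I)_{AC}\wedge(\gamma^J)^C{}_B$ is $\mathrm i\,\mathcal M_{\rm MHV}\,e^{\mathrm i\sum_{i=1}^{N+2}p_i\cdot X}\,\mathrm{dvol}$ with $\mathcal M_{\rm MHV}$ constant, so that $\mathcal A_{\rm MHV}=\mathrm i(2\pi)^4\delta^{(4)}(\sum_ip_i)\,\mathcal M_{\rm MHV}$. Then, on the support of momentum conservation $\sum_{i=1}^{N+2}p_i=0$, $$\mathcal M_{\rm MHV}=\langle IJ\rangle^6\sum_{\mathbf t\in\mathcal T_N^{\max}}\Big(\prod_{\{i,j\}\in\text{edges}(\mathbf t)}\frac{[ij]}{\langle ij\rangle}\Big)\Big(\prod_{a=1}^N\big(\langle aI\rangle\langle aJ\rangle\big)^{\deg(a)-2}\Big),$$ where $\mathcal T_N^{\max}$ is the set of all trees with vertex set exactly $\{1,\dots,N\}$ and $\deg(a)$ is the number of edges at $a$ in $\mathbf t$.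
   Context: Coordinates $u,\bar u,w,\bar w$ are independent. $\{f,g\}=\partial_uf\,\partial_wg-\partial_wf\,\partial_ug$. For $i=1,\dots,N+2$ fix complex $\omega_i\ne0$, $z_i$, $\bar z_i$ ($z_i$ pairwise distinct; $\bar z_i$ may be treated as independent of $z_i$), $z_{ij}=z_i-z_j$, and $p_i\cdot X=\omega_i(u+z_i\bar z_i\bar u-\bar z_iw-z_i\bar w)$. Momentum conservation $\sum_ip_i=0$ means $\sum\omega_i=\sum\omega_iz_i=\sum\omega_i\bar z_i=\sum\omega_iz_i\bar z_i=0$. Commuting parameters $\epsilon_i$ satisfy $\epsilon_i^2=0$. Seeds: $\phi_i=\epsilon_ie^{\mathrm ip_i\cdot X}$. Spinors: $\kappa^i_A=(-z_i,1)$, $\tilde\kappa^i_{\dot A}=\omega_i(-\bar z_i,1)$. $\varepsilon^{12}=-\varepsilon_{12}=\varepsilon^{\dot1\dot2}=-\varepsilon_{\dot1\dot2}=1$, indices raised/lowered from the left ($\lambda_A=\varepsilon_{AB}\lambda^B$, $\lambda^A=\varepsilon^{AB}\lambda_B$). Brackets: $\langle ij\rangle=z_{ij}$, $[ij]=-\omega_i\omega_j(\bar z_i-\bar z_j)$; for dotted spinors $[\xi\chi]=\xi_{\dot1}\chi_{\dot2}-\xi_{\dot2}\chi_{\dot1}$, and $[\xi i]$ means $[\xi\tilde\kappa^i]$. Self-dual background: $\mathcal T_N$ is the set of trees whose vertex set is a nonempty subset of $\{1,\dots,N\}$; for $\mathbf t\in\mathcal T_N$, $\phi_{\mathbf t}=\prod_{\{i,j\}\in\text{edges}}\frac{[ij]}{\langle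 ij\rangle}\prod_{k\in\text{nodes}}\phi_k$; $\phi=\sum_{\mathbf t\in\mathcal T_N}\phi_{\mathbf t}$ (this solves Plebański's second heavenly equation and describes $N$ positive helicity gravitons). Tetrad: $\theta^{1\dot1}=2d\bar u$, $\theta^{1\dot2}=2d\bar w$, $\theta^{2\dot1}=2(dw-(\partial_u\partial_w\phi)d\bar u-(\partial_u^2\phi)d\bar w)$, $\theta^{2\dot2}=2(du+(\partial_w^2\phi)d\bar u+(\partial_u\partial_w\phi)d\bar w)$. $\Sigma_0^{AB}=\theta^{A\dot A}\wedge\theta^B{}_{\dot A}$, and $\mathrm{dvol}=4\mathrm i\,du\wedge d\bar u\wedge dw\wedge d\bar w$. Negative helicity gravitons: for a dotted spinor $\xi$ and for $L\in\{I,J\}$ define $F_L^{\dot A}$ by $$\xi_{\dot A}F_L^{\dot A}=\xi_{\dot1}(w-z_L\bar u)+\xi_{\dot2}(u-z_L\bar w)-\mathrm i\sum_{(\mathbf t,k)}\frac{[\xi k]}{\langle Lk\rangle}\phi_{\mathbf t},$$ the sum over all $\mathbf t\in\mathcal T_N$ and all nodes $k$ of $\mathbf t$; put $F_L=\tilde\kappa^L_{\dot A}F_L^{\dot A}$ and $(H_L)_{\dot 1}{}^{\dot B}=\partial_wF_L^{\dot B}$, $(H_L)_{\dot2}{}^{\dot B}=\partial_uF_L^{\dot B}$. The linearized anti-self-dual spin connections are $$(\gamma^I)_{AB}=-\mathrm i\,\epsilon_I\,\kappa^I_A\kappa^I_B\,\frac{\kappa^I_C\,\xi_{\dot C}(H_I)_{\dot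 A}{}^{\dot C}\theta^{C\dot A}}{2[\xi I]}\,e^{\mathrm iF_I},$$ and $(\gamma^J)_{AB}$ is given by the same formula with $I\to J$ and $\xi\to\chi$, where $\xi,\chi$ are arbitrary constant reference spinors with $[\xi I]\neq0$, $[\chi J]\ne0$. The MHV amplitude is, by evaluation of the on-shell gravitational action (chiral Plebański action plus boundary term), $$\mathcal A_{\rm MHV}=\frac{\partial^{N+2}}{\partial\epsilon_1\cdots\partial\epsilon_{N+2}}\int\Sigma_0^{AB}\wedge(\gamma^I)_{AC}\wedge(\gamma^J)^C{}_B\Big|_{\epsilon=0},$$ with $\int e^{\mathrm iP\cdot X}\mathrm{dvol}=(2\pi)^4\delta^{(4)}(P)$. *)

theory Defs
  imports "HOL-Analysis.Analysis"
begin

section \<open>Commuting parameters that square to zero\<close>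

text \<open>
  An element is a formal series in commuting parameters \<open>\<epsilon>\<^sub>1, \<epsilon>\<^sub>2, \<dots>\<close> with \<open>\<epsilon>\<^sub>i\<^sup>2 = 0\<close>;
  it is given by its coefficients \<open>f S\<close> of the monomials \<open>\<Prod>i\<in>S. \<epsilon>\<^sub>i\<close> for finite \<open>S\<close>.
  The restriction to finite \<open>S\<close> makes the finite sums over \<open>Pow S\<close> below meaningful.
\<close>

typedef eps_alg = "{f :: nat set \<Rightarrow> complex. \<forall>S. infinite S \<longrightarrow> f S = 0}"
  morphisms ecoeff Abs_eps
  by (rule exI[of _ "\<lambda>_. 0"]) simp

lemma ecoeff_infinite: "infinite S \<Longrightarrow> ecoeff x S = 0"
  using ecoeff[of x] by simp

lemma ecoeff_Abs: "(\<And>S. infinite S \<Longrightarrow> f S = 0) \<Longrightarrow> ecoeff (Abs_eps f) S = f S"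
  by (subst Abs_eps_inverse) auto

lemma eps_eqI: "(\<And>S. finite S \<Longrightarrow> ecoeff x S = ecoeff y S) \<Longrightarrow> x = y"
  by (metis ecoeff_infinite ecoeff_inject ext)

instantiation eps_alg :: "{zero, one, plus, minus, uminus, times}"
begin

definition "0 = Abs_eps (\<lambda>S. 0)"
definition "1 = Abs_eps (\<lambda>S. if S = {} then 1 else 0)"
definition "x + y = Abs_eps (\<lambda>S. ecoeff x S + ecoeff y S)"
definition "x - y = Abs_eps (\<lambda>S. ecoeff x S - ecoeff y S)"
definition "- x = Abs_eps (\<lambda>S. - ecoeff x S)"
definition "x * y = Abs_eps (\<lambda>S. \<Sum>T\<in>Pow S. ecoeff x T * ecoeff y (S - T))"

instance ..

end

lemma ecoeff_zero [simp]: "ecoeff 0 S = 0"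
  by (simp add: zero_eps_alg_def ecoeff_Abs)

lemma ecoeff_one: "ecoeff 1 S = (if S = {} then 1 else 0)"
  unfolding one_eps_alg_def by (subst ecoeff_Abs) auto

lemma ecoeff_add [simp]: "ecoeff (x + y) S = ecoeff x S + ecoeff y S"
  unfolding plus_eps_alg_def by (subst ecoeff_Abs) (auto simp: ecoeff_infinite)

lemma ecoeff_diff [simp]: "ecoeff (x - y) S = ecoeff x S - ecoeff y S"
  unfolding minus_eps_alg_def by (subst ecoeff_Abs) (auto simp: ecoeff_infinite)

lemma ecoeff_uminus [simp]: "ecoeff (- x) S = - ecoeff x S"
  unfolding uminus_eps_alg_def by (subst ecoeff_Abs) (auto simp: ecoeff_infinite)

lemma ecoeff_mult: "ecoeff (x * y) S = (\<Sum>T\<in>Pow S. ecoeff x T * ecoeff y (S - T))"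
  unfolding times_eps_alg_def by (subst ecoeff_Abs) auto

instance eps_alg :: comm_ring_1
proof
  fix a b c :: eps_alg
  show "a + b + c = a + (b + c)" "a + b = b + a" "0 + a = a" "- a + a = 0" "a - b = a + - b"
    by (rule eps_eqI; simp)+
  show "(0::eps_alg) \<noteq> 1"
  proof
    assume "(0::eps_alg) = 1"
    then have "ecoeff 0 {} = ecoeff 1 {}" by simp
    then show False by (simp add: ecoeff_one)
  qed
  show "(a + b) * c = a * c + b * c"
    by (rule eps_eqI) (simp add: ecoeff_mult distrib_right sum.distrib)
  show "a * b = b * a"
  proof (rule eps_eqI)
    fix S :: "nat set"
    show "ecoeff (a * b) S = ecoeff (b * a) S"
      unfolding ecoeff_mult
      by (rule sum.reindex_bij_witness[where i = "\<lambda>T. S - T" and j = "\<lambda>T. S - T"])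
        (auto simp: double_diff mult.commute)
  qed
  show "1 * a = a"
  proof (rule eps_eqI)
    fix S :: "nat set" assume "finite S"
    have "ecoeff (1 * a) S = (\<Sum>T\<in>Pow S. if T = {} then ecoeff a S else 0)"
      unfolding ecoeff_mult by (rule sum.cong) (auto simp: ecoeff_one)
    also have "\<dots> = ecoeff a S"
      using \<open>finite S\<close> by (simp add: sum.delta)
    finally show "ecoeff (1 * a) S = ecoeff a S" .
  qed
  show "a * b * c = a * (b * c)"
  proof (rule eps_eqI)
    fix S :: "nat set" assume S: "finite S"
    have fin: "finite T" if "T \<subseteq> S" for T using S that finite_subset by blast
    have "ecoeff (a * b * c) S =
        (\<Sum>T\<in>Pow S. \<Sum>R\<in>Pow T. ecoeff a R * ecoeff b (T - R) * ecoeff c (S - T))"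
      by (simp add: ecoeff_mult sum_distrib_right)
    also have "\<dots> = (\<Sum>(T, R)\<in>Sigma (Pow S) Pow.
        ecoeff a R * ecoeff b (T - R) * ecoeff c (S - T))"
      by (rule sum.Sigma) (use S fin in auto)
    also have "\<dots> = (\<Sum>(R, Q)\<in>Sigma (Pow S) (\<lambda>R. Pow (S - R)).
        ecoeff a R * ecoeff b Q * ecoeff c (S - R - Q))"
    proof (rule sum.reindex_bij_witness[where i = "\<lambda>(R, Q). (R \<union> Q, R)"
          and j = "\<lambda>(T, R). (R, T - R)"], goal_cases)
      case (5 p)
      then obtain T R where p: "p = (T, R)" and TR: "T \<subseteq> S" "R \<subseteq> T" by auto
      have "S - R - (T - R) = S - T" using TR by auto
      then show ?case using p by simp
    qed auto
    also have "\<dots> = (\<Sum>R\<in>Pow S. \<Sum>Q\<in>Pow (S - R).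
        ecoeff a R * ecoeff b Q * ecoeff c (S - R - Q))"
      by (rule sum.Sigma[symmetric]) (use S in auto)
    also have "\<dots> = ecoeff (a * (b * c)) S"
      by (simp add: ecoeff_mult sum_distrib_left mult.assoc)
    finally show "ecoeff (a * b * c) S = ecoeff (a * (b * c)) S" .
  qed
qed

lemma ecoeff_sum: "ecoeff (sum f A) S = (\<Sum>a\<in>A. ecoeff (f a) S)"
  by (induction A rule: infinite_finite_induct) auto

definition cst :: "complex \<Rightarrow> eps_alg" where
  "cst a = Abs_eps (\<lambda>S. if S = {} then a else 0)"

definition eps :: "nat \<Rightarrow> eps_alg" where
  "eps i = Abs_eps (\<lambda>S. if S = {i} then 1 else 0)"

lemma ecoeff_cst: "ecoeff (cst a) S = (if S = {} then a else 0)"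
  unfolding cst_def by (subst ecoeff_Abs) auto

lemma ecoeff_eps: "ecoeff (eps i) S = (if S = {i} then 1 else 0)"
  unfolding eps_def by (subst ecoeff_Abs) auto

lemma eps_nilpotent: "eps i * eps i = 0"
proof (rule eps_eqI)
  fix S :: "nat set"
  have "ecoeff (eps i * eps i) S = (\<Sum>T\<in>Pow S. 0)"
    unfolding ecoeff_mult by (rule sum.cong) (auto simp: ecoeff_eps)
  then show "ecoeff (eps i * eps i) S = ecoeff 0 S" by simp
qed

lemma ecoeff_cst_mult: "ecoeff (cst a * x) S = a * ecoeff x S"
proof (cases "finite S")
  case True
  have "ecoeff (cst a * x) S = (\<Sum>T\<in>Pow S. if T = {} then a * ecoeff x S else 0)"
    unfolding ecoeff_mult by (rule sum.cong) (auto simp: ecoeff_cst)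
  also have "\<dots> = a * ecoeff x S" using True by (simp add: sum.delta)
  finally show ?thesis .
qed (simp add: ecoeff_infinite)

text \<open>The exponential series, taken coefficient by coefficient.\<close>

definition eexp :: "eps_alg \<Rightarrow> eps_alg" where
  "eexp x = Abs_eps (\<lambda>S. \<Sum>n. ecoeff (x ^ n) S / fact n)"

lemma ecoeff_eexp: "ecoeff (eexp x) S = (\<Sum>n. ecoeff (x ^ n) S / fact n)"
  unfolding eexp_def by (subst ecoeff_Abs) (auto simp: ecoeff_infinite)

lemma eexp_summable: "summable (\<lambda>n. ecoeff (x ^ n) S / fact n)"
proof (cases "finite S")
  case True
  define C where "C = (\<Sum>T\<in>Pow S. norm (ecoeff x T))"
  have C0: "C \<ge> 0" unfolding C_def by (rule sum_nonneg) simp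
  have bound: "norm (ecoeff (x ^ n) R) \<le> C ^ n" if "R \<subseteq> S" for n R
    using that
  proof (induction n arbitrary: R)
    case 0
    then show ?case by (simp add: ecoeff_one)
  next
    case (Suc n)
    have "norm (ecoeff (x ^ Suc n) R)
        \<le> (\<Sum>T\<in>Pow R. norm (ecoeff x T * ecoeff (x ^ n) (R - T)))"
      by (simp add: ecoeff_mult norm_sum)
    also have "\<dots> \<le> (\<Sum>T\<in>Pow R. norm (ecoeff x T) * C ^ n)"
    proof (intro sum_mono)
      fix T
      assume "T \<in> Pow R"
      have "norm (ecoeff (x ^ n) (R - T)) \<le> C ^ n"
        using Suc.IH[of "R - T"] Suc.prems by blast
      then show "norm (ecoeff x T * ecoeff (x ^ n) (R - T)) \<le> norm (ecoeff x T) * C ^ n"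
        by (simp add: norm_mult mult_left_mono)
    qed
    also have "\<dots> = (\<Sum>T\<in>Pow R. norm (ecoeff x T)) * C ^ n"
      by (simp add: sum_distrib_right)
    also have "\<dots> \<le> C * C ^ n"
      unfolding C_def using True Suc.prems
      by (intro mult_right_mono sum_mono2) (auto intro!: zero_le_power sum_nonneg)
    finally show ?case by simp
  qed
  have "summable (\<lambda>n. C ^ n / fact n)"
    using summable_exp[of C] by (simp add: field_simps)
  then show ?thesis
    by (rule summable_comparison_test'[where N = 0])
      (use bound in \<open>auto simp: norm_divide intro!: divide_right_mono\<close>)
qed (simp add: ecoeff_infinite)


section \<open>Coordinates, partial derivatives and exterior algebra\<close>

datatype coord = U | Ubar | W | Wbar

lemma UNIV_coord: "UNIV = {U, Ubar, W, Wbar}"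
  by (auto intro: coord.exhaust)

instance coord :: finite
  by standard (simp add: UNIV_coord)

type_synonym point = "coord \<Rightarrow> complex"

text \<open>The partial derivative of a holomorphic function with values in \<open>eps_alg\<close>.\<close>

definition pd :: "coord \<Rightarrow> (point \<Rightarrow> eps_alg) \<Rightarrow> point \<Rightarrow> eps_alg" where
  "pd c f X = Abs_eps (\<lambda>S. deriv (\<lambda>t. ecoeff (f (X(c := t))) S) (X c))"

lemma ecoeff_pd: "ecoeff (pd c f X) S = deriv (\<lambda>t. ecoeff (f (X(c := t))) S) (X c)"
  unfolding pd_def by (subst ecoeff_Abs) (auto simp: ecoeff_infinite)

text \<open>
  A differential form at a point is a function \<open>\<alpha>\<close> on sets of coordinates: \<open>\<alpha> S\<close> is the
  coefficient of the wedge product of the \<open>dc\<close>, \<open>c \<in> S\<close>, taken in the order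
  \<open>U, Ubar, W, Wbar\<close>. The sign in the product counts the transpositions needed to restore
  that order.
\<close>

type_synonym 'a form = "coord set \<Rightarrow> 'a"

primrec coord_index :: "coord \<Rightarrow> nat" where
  "coord_index U = 0"
| "coord_index Ubar = 1"
| "coord_index W = 2"
| "coord_index Wbar = 3"

definition dx :: "coord \<Rightarrow> 'a::comm_ring_1 form" where
  "dx c S = (if S = {c} then 1 else 0)"

definition wedge :: "'a::comm_ring_1 form \<Rightarrow> 'a form \<Rightarrow> 'a form" (infixl "\<and>\<^sub>w" 70) where
  "(\<alpha> \<and>\<^sub>w \<beta>) S = (\<Sum>T\<in>Pow S.
     (-1) ^ card {(c, d). c \<in> T \<and> d \<in> S - T \<and> coord_index d < coord_index c}
       * \<alpha> T * \<beta> (S - T))"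

definition dvol :: "complex form" where
  "dvol S = 4 * \<i> * (dx U \<and>\<^sub>w dx Ubar \<and>\<^sub>w dx W \<and>\<^sub>w dx Wbar) S"


section \<open>Spinors and momenta\<close>

text \<open>
  Spinor indices range over the two-element type \<open>2\<close>, whose elements are \<open>1\<close> and \<open>2\<close>
  (with \<open>2 = 0\<close>).
\<close>

type_synonym spinor = "2 \<Rightarrow> complex"

definition eps_up :: "2 \<Rightarrow> 2 \<Rightarrow> 'a::comm_ring_1" where
  "eps_up A B = (if A = 1 \<and> B = 2 then 1 else if A = 2 \<and> B = 1 then -1 else 0)"

definition eps_down :: "2 \<Rightarrow> 2 \<Rightarrow> 'a::comm_ring_1" where
  "eps_down A B = (if A = 1 \<and> B = 2 then -1 else if A = 2 \<and> B = 1 then 1 else 0)"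

definition kap :: "(nat \<Rightarrow> complex) \<Rightarrow> nat \<Rightarrow> spinor" where
  "kap z i A = (if A = 1 then - z i else 1)"

definition kapt :: "(nat \<Rightarrow> complex) \<Rightarrow> (nat \<Rightarrow> complex) \<Rightarrow> nat \<Rightarrow> spinor" where
  "kapt \<omega> zb i A = \<omega> i * (if A = 1 then - zb i else 1)"

definition ang :: "(nat \<Rightarrow> complex) \<Rightarrow> nat \<Rightarrow> nat \<Rightarrow> complex" where
  "ang z i j = z i - z j"

definition sqs :: "spinor \<Rightarrow> spinor \<Rightarrow> complex" where
  "sqs \<xi> \<eta> = \<xi> 1 * \<eta> 2 - \<xi> 2 * \<eta> 1"

definition sq :: "(nat \<Rightarrow> complex) \<Rightarrow> (nat \<Rightarrow> complex) \<Rightarrow> nat \<Rightarrow> nat \<Rightarrow> complex" where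
  "sq \<omega> zb i j = - \<omega> i * \<omega> j * (zb i - zb j)"

lemma sq_kapt: "sq \<omega> zb i j = sqs (kapt \<omega> zb i) (kapt \<omega> zb j)"
  by (simp add: sq_def sqs_def kapt_def algebra_simps)

definition pairing :: "(coord \<Rightarrow> complex) \<Rightarrow> point \<Rightarrow> complex" where
  "pairing P X = (\<Sum>c\<in>UNIV. P c * X c)"

primrec mom :: "(nat \<Rightarrow> complex) \<Rightarrow> (nat \<Rightarrow> complex) \<Rightarrow> (nat \<Rightarrow> complex) \<Rightarrow> nat \<Rightarrow> coord \<Rightarrow> complex"
where
  "mom \<omega> z zb i U = \<omega> i"
| "mom \<omega> z zb i Ubar = \<omega> i * z i * zb i"
| "mom \<omega> z zb i W = - (\<omega> i * zb i)"
| "mom \<omega> z zb i Wbar = - (\<omega> i * z i)"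

lemma pairing_mom:
  "pairing (mom \<omega> z zb i) X = \<omega> i * (X U + z i * zb i * X Ubar - zb i * X W - z i * X Wbar)"
  by (simp add: pairing_def UNIV_coord algebra_simps)

definition total_mom ::
  "nat \<Rightarrow> (nat \<Rightarrow> complex) \<Rightarrow> (nat \<Rightarrow> complex) \<Rightarrow> (nat \<Rightarrow> complex) \<Rightarrow> coord \<Rightarrow> complex" where
  "total_mom n \<omega> z zb c = (\<Sum>i=1..n. mom \<omega> z zb i c)"

lemma total_mom_eq_0_iff:
  "(\<forall>c. total_mom n \<omega> z zb c = 0) \<longleftrightarrow>
     (\<Sum>i=1..n. \<omega> i) = 0 \<and> (\<Sum>i=1..n. \<omega> i * z i) = 0 \<and>
     (\<Sum>i=1..n. \<omega> i * zb i) = 0 \<and> (\<Sum>i=1..n. \<omega> i * z i * zb i) = 0"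
proof -
  have "(\<forall>c. P c) \<longleftrightarrow> P U \<and> P Ubar \<and> P W \<and> P Wbar" for P :: "coord \<Rightarrow> bool"
    by (metis coord.exhaust)
  then show ?thesis by (auto simp: total_mom_def sum_negf)
qed


section \<open>Trees\<close>

definition simple_graph :: "nat set \<Rightarrow> nat set set \<Rightarrow> bool" where
  "simple_graph V E \<longleftrightarrow> (\<forall>e\<in>E. e \<subseteq> V \<and> card e = 2)"

definition connected_graph :: "nat set \<Rightarrow> nat set set \<Rightarrow> bool" where
  "connected_graph V E \<longleftrightarrow> (\<forall>x\<in>V. \<forall>y\<in>V. (x, y) \<in> {(a, b). {a, b} \<in> E}\<^sup>*)"

definition graph_cycle :: "nat set set \<Rightarrow> nat list \<Rightarrow> bool" where
  "graph_cycle E c \<longleftrightarrow> length c \<ge> 3 \<and> distinct c \<and>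
     (\<forall>i<length c. {c ! i, c ! (Suc i mod length c)} \<in> E)"

definition is_tree :: "nat set \<Rightarrow> nat set set \<Rightarrow> bool" where
  "is_tree V E \<longleftrightarrow> V \<noteq> {} \<and> simple_graph V E \<and> connected_graph V E \<and> (\<nexists>c. graph_cycle E c)"

definition trees :: "nat \<Rightarrow> (nat set \<times> nat set set) set" where
  "trees N = {(V, E). V \<subseteq> {1..N} \<and> is_tree V E}"

definition max_trees :: "nat \<Rightarrow> nat set set set" where
  "max_trees N = {E. is_tree {1..N} E}"

definition deg :: "nat set set \<Rightarrow> nat \<Rightarrow> nat" where
  "deg E a = card {e\<in>E. a \<in> e}"

text \<open>
  The factor \<open>[ij]/\<langle>ij\<rangle>\<close> of an edge \<open>{i, j}\<close> is symmetric in \<open>i\<close> and \<open>j\<close>; the orientation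
  chosen here is immaterial.
\<close>

definition edge_weight ::
  "(nat \<Rightarrow> complex) \<Rightarrow> (nat \<Rightarrow> complex) \<Rightarrow> (nat \<Rightarrow> complex) \<Rightarrow> nat set \<Rightarrow> complex" where
  "edge_weight \<omega> z zb e = sq \<omega> zb (Min e) (Max e) / ang z (Min e) (Max e)"

lemma edge_weight_pair: "edge_weight \<omega> z zb {i, j} = sq \<omega> zb i j / ang z i j"
proof -
  have *: "sq \<omega> zb j i / ang z j i = sq \<omega> zb i j / ang z i j"
  proof -
    have "sq \<omega> zb j i = - sq \<omega> zb i j" "ang z j i = - ang z i j"
      by (simp_all add: sq_def ang_def algebra_simps)
    then show ?thesis by simp
  qed
  then show ?thesis
    by (cases "i \<le> j") (auto simp: edge_weight_def min_def max_def)
qed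


section \<open>The self-dual background\<close>

definition seed ::
  "(nat \<Rightarrow> complex) \<Rightarrow> (nat \<Rightarrow> complex) \<Rightarrow> (nat \<Rightarrow> complex) \<Rightarrow> nat \<Rightarrow> point \<Rightarrow> eps_alg" where
  "seed \<omega> z zb k X = eps k * cst (exp (\<i> * pairing (mom \<omega> z zb k) X))"

definition phi_tree ::
  "(nat \<Rightarrow> complex) \<Rightarrow> (nat \<Rightarrow> complex) \<Rightarrow> (nat \<Rightarrow> complex) \<Rightarrow>
    nat set \<times> nat set set \<Rightarrow> point \<Rightarrow> eps_alg" where
  "phi_tree \<omega> z zb t X =
     (\<Prod>e\<in>snd t. cst (edge_weight \<omega> z zb e)) * (\<Prod>k\<in>fst t. seed \<omega> z zb k X)"

definition phi ::
  "nat \<Rightarrow> (nat \<Rightarrow> complex) \<Rightarrow> (nat \<Rightarrow> complex) \<Rightarrow> (nat \<Rightarrow> complex) \<Rightarrow> point \<Rightarrow> eps_alg" where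
  "phi N \<omega> z zb X = (\<Sum>t\<in>trees N. phi_tree \<omega> z zb t X)"

text \<open>The tetrad \<open>\<theta>\<^bsup>AA'\<^esup>\<close> of the potential \<open>f\<close>; the second index is the dotted one.\<close>

definition tetrad :: "(point \<Rightarrow> eps_alg) \<Rightarrow> 2 \<Rightarrow> 2 \<Rightarrow> point \<Rightarrow> eps_alg form" where
  "tetrad f A A' X S =
    (if A = 1 then
       (if A' = 1 then 2 * dx Ubar S else 2 * dx Wbar S)
     else
       (if A' = 1
        then 2 * (dx W S - pd U (pd W f) X * dx Ubar S - pd U (pd U f) X * dx Wbar S)
        else 2 * (dx U S + pd W (pd W f) X * dx Ubar S + pd U (pd W f) X * dx Wbar S)))"

definition Sigma0 :: "(point \<Rightarrow> eps_alg) \<Rightarrow> 2 \<Rightarrow> 2 \<Rightarrow> point \<Rightarrow> eps_alg form" where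
  "Sigma0 f A B X S =
     (\<Sum>A'\<in>UNIV.
        (tetrad f A A' X \<and>\<^sub>w (\<lambda>R. \<Sum>B'\<in>UNIV. eps_down A' B' * tetrad f B B' X R)) S)"


section \<open>Negative helicity gravitons\<close>

text \<open>The contraction \<open>\<xi>\<^bsub>A'\<^esub> F\<^bsub>L\<^esub>\<^bsup>A'\<^esup>\<close>, as a function of \<open>\<xi>\<close>.\<close>

definition F_contr ::
  "nat \<Rightarrow> (nat \<Rightarrow> complex) \<Rightarrow> (nat \<Rightarrow> complex) \<Rightarrow> (nat \<Rightarrow> complex) \<Rightarrow>
    nat \<Rightarrow> spinor \<Rightarrow> point \<Rightarrow> eps_alg" where
  "F_contr N \<omega> z zb L \<xi> X =
     cst (\<xi> 1 * (X W - z L * X Ubar) + \<xi> 2 * (X U - z L * X Wbar))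
     - cst \<i> * (\<Sum>(t, k)\<in>Sigma (trees N) fst.
         cst (sqs \<xi> (kapt \<omega> zb k) / ang z L k) * phi_tree \<omega> z zb t X)"

text \<open>
  The contraction is linear in \<open>\<xi>\<close> (lemma \<open>F_contr_eq\<close>), so the components \<open>F\<^bsub>L\<^esub>\<^bsup>A'\<^esup>\<close> are its
  values on basis spinors.
\<close>

definition F_comp ::
  "nat \<Rightarrow> (nat \<Rightarrow> complex) \<Rightarrow> (nat \<Rightarrow> complex) \<Rightarrow> (nat \<Rightarrow> complex) \<Rightarrow>
    nat \<Rightarrow> 2 \<Rightarrow> point \<Rightarrow> eps_alg" where
  "F_comp N \<omega> z zb L A' = F_contr N \<omega> z zb L (\<lambda>B'. if B' = A' then 1 else 0)"

lemma ecoeff_F_contr: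
  "ecoeff (F_contr N \<omega> z zb L \<xi> X) S =
     (if S = {} then \<xi> 1 * (X W - z L * X Ubar) + \<xi> 2 * (X U - z L * X Wbar) else 0)
     - \<i> * (\<Sum>p\<in>Sigma (trees N) fst.
         sqs \<xi> (kapt \<omega> zb (snd p)) / ang z L (snd p) * ecoeff (phi_tree \<omega> z zb (fst p) X) S)"
  by (simp only: F_contr_def ecoeff_diff ecoeff_cst ecoeff_cst_mult ecoeff_sum case_prod_unfold)

lemma F_contr_eq:
  "F_contr N \<omega> z zb L \<xi> X = (\<Sum>A'\<in>UNIV. cst (\<xi> A') * F_comp N \<omega> z zb L A' X)"
proof (rule eps_eqI)
  fix S :: "nat set"
  let ?s = "\<lambda>\<zeta>. (\<Sum>p\<in>Sigma (trees N) fst.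
      sqs \<zeta> (kapt \<omega> zb (snd p)) / ang z L (snd p) * ecoeff (phi_tree \<omega> z zb (fst p) X) S)"
  have "?s \<xi> = \<xi> 1 * ?s (\<lambda>B'. if B' = 1 then 1 else 0) + \<xi> 2 * ?s (\<lambda>B'. if B' = 2 then 1 else 0)"
    unfolding sum_distrib_left sum.distrib[symmetric]
    by (rule sum.cong) (simp_all add: sqs_def diff_divide_distrib algebra_simps)
  then show "ecoeff (F_contr N \<omega> z zb L \<xi> X) S =
      ecoeff (\<Sum>A'\<in>UNIV. cst (\<xi> A') * F_comp N \<omega> z zb L A' X) S"
    unfolding F_comp_def sum_2 ecoeff_add ecoeff_cst_mult ecoeff_F_contr
    by (simp add: algebra_simps)
qed

definition F_neg ::
  "nat \<Rightarrow> (nat \<Rightarrow> complex) \<Rightarrow> (nat \<Rightarrow> complex) \<Rightarrow> (nat \<Rightarrow> complex) \<Rightarrow> nat \<Rightarrow> point \<Rightarrow> eps_alg" where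
  "F_neg N \<omega> z zb L X = (\<Sum>A'\<in>UNIV. cst (kapt \<omega> zb L A') * F_comp N \<omega> z zb L A' X)"

definition H_neg ::
  "nat \<Rightarrow> (nat \<Rightarrow> complex) \<Rightarrow> (nat \<Rightarrow> complex) \<Rightarrow> (nat \<Rightarrow> complex) \<Rightarrow>
    nat \<Rightarrow> 2 \<Rightarrow> 2 \<Rightarrow> point \<Rightarrow> eps_alg" where
  "H_neg N \<omega> z zb L A' B' = pd (if A' = 1 then W else U) (F_comp N \<omega> z zb L B')"

definition gam ::
  "nat \<Rightarrow> (nat \<Rightarrow> complex) \<Rightarrow> (nat \<Rightarrow> complex) \<Rightarrow> (nat \<Rightarrow> complex) \<Rightarrow>
    nat \<Rightarrow> spinor \<Rightarrow> 2 \<Rightarrow> 2 \<Rightarrow> point \<Rightarrow> eps_alg form" where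
  "gam N \<omega> z zb L \<xi> A B X S =
     cst (- \<i>) * eps L * cst (kap z L A * kap z L B)
     * (\<Sum>C\<in>UNIV. \<Sum>A'\<in>UNIV. \<Sum>C'\<in>UNIV.
          cst (kap z L C * \<xi> C') * H_neg N \<omega> z zb L A' C' X * tetrad (phi N \<omega> z zb) C A' X S)
     * cst (1 / (2 * sqs \<xi> (kapt \<omega> zb L)))
     * eexp (cst \<i> * F_neg N \<omega> z zb L X)"


section \<open>The MHV generating function and the amplitude\<close>

definition MHV_form ::
  "nat \<Rightarrow> (nat \<Rightarrow> complex) \<Rightarrow> (nat \<Rightarrow> complex) \<Rightarrow> (nat \<Rightarrow> complex) \<Rightarrow>
    spinor \<Rightarrow> spinor \<Rightarrow> point \<Rightarrow> eps_alg form" where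
  "MHV_form N \<omega> z zb \<xi> \<eta> X S =
     (\<Sum>A\<in>UNIV. \<Sum>B\<in>UNIV. \<Sum>C\<in>UNIV.
        (Sigma0 (phi N \<omega> z zb) A B X
         \<and>\<^sub>w gam N \<omega> z zb (N + 1) \<xi> A C X
         \<and>\<^sub>w (\<lambda>R. \<Sum>D\<in>UNIV. eps_up C D * gam N \<omega> z zb (N + 2) \<eta> D B X R)) S)"

text \<open>
  \<open>\<partial>\<^bsup>n\<^esup>/\<partial>\<epsilon>\<^sub>1\<cdots>\<partial>\<epsilon>\<^sub>n\<close> at \<open>\<epsilon> = 0\<close> is the coefficient of \<open>\<epsilon>\<^sub>1\<cdots>\<epsilon>\<^sub>n\<close>.
\<close>

definition top_coeff :: "nat \<Rightarrow> eps_alg \<Rightarrow> complex" where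
  "top_coeff n x = ecoeff x {1..n}"

definition stripped_MHV ::
  "nat \<Rightarrow> (nat \<Rightarrow> complex) \<Rightarrow> (nat \<Rightarrow> complex) \<Rightarrow> (nat \<Rightarrow> complex) \<Rightarrow>
    spinor \<Rightarrow> spinor \<Rightarrow> complex" where
  "stripped_MHV N \<omega> z zb \<xi> \<eta> = (THE M. \<forall>X S.
     top_coeff (N + 2) (MHV_form N \<omega> z zb \<xi> \<eta> X S)
       = \<i> * M * exp (\<i> * pairing (total_mom (N + 2) \<omega> z zb) X) * dvol S)"

text \<open>
  The amplitude uses the integral only formally: \<open>intg\<close> is a functional on complex form fields
  known on plane waves alone, \<open>plane_wave_rule intg \<delta>\<close>, and applied coefficientwise in the
  \<open>\<epsilon>\<^sub>i\<close>. The symbol \<open>\<delta>\<close> stands for the four-dimensional delta function, of which no other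
  property is used.
\<close>

definition plane_wave_rule ::
  "((point \<Rightarrow> complex form) \<Rightarrow> complex) \<Rightarrow> ((coord \<Rightarrow> complex) \<Rightarrow> complex) \<Rightarrow> bool" where
  "plane_wave_rule intg \<delta> \<longleftrightarrow> (\<forall>a P.
     intg (\<lambda>X S. a * exp (\<i> * pairing P X) * dvol S) = a * ((2 * of_real pi) ^ 4 * \<delta> P))"

definition eps_integral ::
  "((point \<Rightarrow> complex form) \<Rightarrow> complex) \<Rightarrow> (point \<Rightarrow> eps_alg form) \<Rightarrow> eps_alg" where
  "eps_integral intg \<Omega> =
     Abs_eps (\<lambda>T. if finite T then intg (\<lambda>X S. ecoeff (\<Omega> X S) T) else 0)"

definition MHV_amplitude ::
  "((point \<Rightarrow> complex form) \<Rightarrow> complex) \<Rightarrow>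
    nat \<Rightarrow> (nat \<Rightarrow> complex) \<Rightarrow> (nat \<Rightarrow> complex) \<Rightarrow> (nat \<Rightarrow> complex) \<Rightarrow>
    spinor \<Rightarrow> spinor \<Rightarrow> complex" where
  "MHV_amplitude intg N \<omega> z zb \<xi> \<eta> =
     top_coeff (N + 2) (eps_integral intg (MHV_form N \<omega> z zb \<xi> \<eta>))"

end

theory Submission
  imports Defs
begin

text \<open>
  The tetrad has constant determinant, so the four-form reduces to the Poisson bracket of the two
  contracted functions \<open>F\<^sub>I\<close>, \<open>F\<^sub>J\<close>, times \<open>e\<close> to the power \<open>\<i> (F\<^sub>I + F\<^sub>J)\<close>. Put \<open>w i j = [ij]/\<langle>ij\<rangle>\<close>
  and let \<open>Y k\<close> be the sum of the tree terms containing the node \<open>k\<close>. Removing \<open>k\<close> from a tree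
  gives \<open>Y k = \<epsilon>\<^sub>k \<Prod>l. (1 + w k l Y l)\<close>, and every factor above is a polynomial in the \<open>Y k\<close> and
  their Euler derivatives \<open>Z k l\<close>. Differentiating the functional equation yields linear (Ward)
  identities for the top coefficients, which replace the all-minors matrix-tree theorem.

  Momentum conservation says that the weighted Laplacian, with the edges to \<open>I\<close> and \<open>J\<close> on its
  diagonal, annihilates \<open>n a = \<langle>aI\<rangle>\<langle>aJ\<rangle>\<close> and sends \<open>n a z\<^sub>a\<close> to a bracket with a fixed spinor. Hence
  its first minors are \<open>n k n l C\<close>, the second minors contracted with the momentum spinors are
  multiples of \<open>C\<close> as well, and the bracket collapses to \<open>- [\<xi>I][\<eta>J]\<langle>IJ\<rangle>\<^sup>3 C\<close>. Conjugating the
  Laplacian by \<open>n\<close> identifies \<open>C\<close> with the sum over spanning trees of weights \<open>n i w i j n j\<close>,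
  divided by the product of the \<open>(n a)\<^sup>2\<close>.
\<close>

section \<open>Gluing two trees along an edge and cutting a tree at a vertex\<close>

section \<open>Trees\<close>

abbreviation adj :: "nat set set \<Rightarrow> (nat \<times> nat) set" where
  "adj E \<equiv> {(a, b). {a, b} \<in> E}"

lemma adj_sym: "(x, y) \<in> (adj E)\<^sup>* \<Longrightarrow> (y, x) \<in> (adj E)\<^sup>*"
proof -
  have "sym (adj E)" by (auto simp: sym_def insert_commute)
  then show "(x, y) \<in> (adj E)\<^sup>* \<Longrightarrow> (y, x) \<in> (adj E)\<^sup>*"
    by (metis sym_rtrancl symD)
qed

lemma connected_from_root:
  assumes "\<And>x. x \<in> V \<Longrightarrow> (r, x) \<in> (adj E)\<^sup>*"
  shows "connected_graph V E"
  unfolding connected_graph_def using assms adj_sym by (meson rtrancl_trans)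

lemma graph_cycle_mono: "graph_cycle E c \<Longrightarrow> E \<subseteq> E' \<Longrightarrow> graph_cycle E' c"
  by (auto simp: graph_cycle_def)

lemma simple_graph_edge:
  assumes "simple_graph V E" "{a, b} \<in> E"
  shows "a \<in> V" "b \<in> V" "a \<noteq> b"
  using assms by (auto simp: simple_graph_def card_insert_if)

text \<open>If the next vertex already lies on the path built so far, the path is truncated there;
  otherwise it is extended. Simple paths are what closes up to a cycle in
  \<open>is_tree_cut\<close>.\<close>

lemma rtrancl_simple_path:
  assumes "(x, y) \<in> (adj E)\<^sup>*"
  shows "\<exists>xs. xs \<noteq> [] \<and> hd xs = x \<and> last xs = y \<and> distinct xs \<and>
    (\<forall>i. Suc i < length xs \<longrightarrow> {xs ! i, xs ! Suc i} \<in> E)"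
  using assms
proof (induction rule: rtrancl_induct)
  case base
  show ?case by (rule exI[of _ "[x]"]) simp
next
  case (step y z)
  then obtain xs where xs: "xs \<noteq> []" "hd xs = x" "last xs = y" "distinct xs"
    "\<And>i. Suc i < length xs \<Longrightarrow> {xs ! i, xs ! Suc i} \<in> E" by blast
  show ?case
  proof (cases "z \<in> set xs")
    case True
    then obtain j where j: "j < length xs" "xs ! j = z" by (auto simp: in_set_conv_nth)
    show ?thesis
    proof (intro exI[of _ "take (Suc j) xs"] conjI)
      show "last (take (Suc j) xs) = z" using j by (simp add: take_Suc_conv_app_nth)
    qed (use xs j in auto)
  next
    case False
    have "{(xs @ [z]) ! i, (xs @ [z]) ! Suc i} \<in> E" if "Suc i < length (xs @ [z])" for i
    proof (cases "Suc i < length xs")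
      case True
      then show ?thesis using xs(5)[of i] by (simp add: nth_append)
    next
      case False
      then have "Suc i = length xs" using that by simp
      then have "(xs @ [z]) ! i = y" "(xs @ [z]) ! Suc i = z"
        using xs(1,3) by (simp_all add: nth_append last_conv_nth \<open>Suc i = length xs\<close>[symmetric])
      then show ?thesis using step(2) by simp
    qed
    then show ?thesis
      using xs False by (intro exI[of _ "xs @ [z]"]) auto
  qed
qed

text \<open>If the property were always inherited by the cyclic successor, it would spread from
  \<open>i\<close> all the way round to \<open>j\<close>.\<close>

lemma cyclic_crossing:
  fixes P :: "nat \<Rightarrow> bool"
  assumes "i < n" "P i" "j < n" "\<not> P j"
  shows "\<exists>k<n. P k \<and> \<not> P (Suc k mod n)"
proof (rule ccontr)
  assume *: "\<not> ?thesis"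
  have "P ((i + m) mod n)" for m
  proof (induction m)
    case (Suc m)
    then have "P (Suc ((i + m) mod n) mod n)" using * assms(1) by auto
    then show ?case by (simp add: mod_Suc_eq)
  qed (use assms in simp)
  \<comment> \<open>\<open>n - i + j\<close> steps lead from \<open>i\<close> past the end to
    \<open>j\<close>; the summand \<open>n\<close> keeps the subtraction from truncating when
    \<open>j < i\<close>.\<close>
  from this[of "n - i + j"] have "P ((n + j) mod n)"
    using assms(1) by (simp add: algebra_simps)
  then show False using assms by simp
qed

text \<open>A cycle within one side contradicts acyclicity there. A cycle that meets both sides must
  leave \<open>A\<close> and come back, both times along \<open>{k, v}\<close>, the only edge
  between the sides; as its vertices are distinct, it would have length two.\<close>

lemma is_tree_join:
  assumes t1: "is_tree A E1" and t2: "is_tree B E2" and disj: "A \<inter> B = {}"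
    and k: "k \<in> A" and v: "v \<in> B"
  shows "is_tree (A \<union> B) (insert {k, v} (E1 \<union> E2))" (is "is_tree ?V ?E")
proof -
  have s1: "simple_graph A E1" and s2: "simple_graph B E2"
    using t1 t2 by (auto simp: is_tree_def)
  have kv: "k \<noteq> v" using disj k v by auto
  have simple: "simple_graph ?V ?E"
    using s1 s2 k v kv by (auto simp: simple_graph_def)
  have "(k, x) \<in> (adj ?E)\<^sup>*" if "x \<in> ?V" for x
  proof (cases "x \<in> A")
    case True
    then have "(k, x) \<in> (adj E1)\<^sup>*" using t1 k by (auto simp: is_tree_def connected_graph_def)
    then show ?thesis by (rule rtrancl_mono[THEN subsetD, rotated]) auto
  next
    case False
    then have "(v, x) \<in> (adj E2)\<^sup>*"
      using t2 v that by (auto simp: is_tree_def connected_graph_def)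
    then have "(v, x) \<in> (adj ?E)\<^sup>*" by (rule rtrancl_mono[THEN subsetD, rotated]) auto
    then show ?thesis by (rule converse_rtrancl_into_rtrancl[rotated]) simp
  qed
  then have conn: "connected_graph ?V ?E" by (rule connected_from_root)
  have sub1: "e \<subseteq> A" "e \<noteq> {}" if "e \<in> E1" for e
    using that s1 by (auto simp: simple_graph_def)
  have sub2: "e \<subseteq> B" "e \<noteq> {}" if "e \<in> E2" for e
    using that s2 by (auto simp: simple_graph_def)
  have e1: "e \<in> E1" if "e \<in> ?E" "e \<subseteq> A" for e
    using that sub2[of e] disj v by auto
  have e2: "e \<in> E2" if "e \<in> ?E" "e \<inter> A = {}" for e
    using that sub1[of e] k by auto
  have cross: "x = k \<and> y = v" if "{x, y} \<in> ?E" "x \<in> A" "y \<notin> A" for x y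
    using that sub1[of "{x, y}"] sub2[of "{x, y}"] disj k v by (auto simp: doubleton_eq_iff)
  have "\<not> graph_cycle ?E c" for c
  proof
    assume c: "graph_cycle ?E c"
    define n where "n = length c"
    have n: "n \<ge> 3" and d: "distinct c"
      and e: "\<And>i. i < n \<Longrightarrow> {c ! i, c ! (Suc i mod n)} \<in> ?E"
      using c by (auto simp: graph_cycle_def n_def)
    consider "\<forall>i<n. c ! i \<in> A" | "\<forall>i<n. c ! i \<notin> A"
      | "\<exists>i<n. c ! i \<in> A" "\<exists>j<n. c ! j \<notin> A" by blast
    then show False
    proof cases
      case 1
      have "{c ! i, c ! (Suc i mod n)} \<in> E1" if "i < n" for i
        using e[OF that] 1 that n by (intro e1) auto
      then have "graph_cycle E1 c"
        using c by (auto simp: graph_cycle_def n_def)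
      then show False using t1 by (auto simp: is_tree_def)
    next
      case 2
      have "{c ! i, c ! (Suc i mod n)} \<in> E2" if "i < n" for i
        using e[OF that] 2 that n by (intro e2) auto
      then have "graph_cycle E2 c"
        using c by (auto simp: graph_cycle_def n_def)
      then show False using t2 by (auto simp: is_tree_def)
    next
      case 3
      obtain i where i: "i < n" "c ! i \<in> A" "c ! (Suc i mod n) \<notin> A"
        using cyclic_crossing[of _ n "\<lambda>i. c ! i \<in> A"] 3 by blast
      obtain j where j: "j < n" "c ! j \<notin> A" "c ! (Suc j mod n) \<in> A"
        using cyclic_crossing[of _ n "\<lambda>i. c ! i \<notin> A"] 3 by blast
      have ci: "c ! i = k" "c ! (Suc i mod n) = v" using cross[OF e[OF i(1)]] i by auto
      have cj: "c ! (Suc j mod n) = k" "c ! j = v"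
        using cross[of "c ! (Suc j mod n)" "c ! j"] e[OF j(1)] j by (auto simp: insert_commute)
      have n0: "0 < n" using n by simp
      have "Suc i mod n = j" "Suc j mod n = i"
        using ci cj d i(1) j(1) n0 nth_eq_iff_index_eq[OF d] unfolding n_def
        by (metis mod_less_divisor)+
      then have "Suc (Suc i) mod n = i" by (metis mod_Suc_eq)
      then show False using i(1) n
        by (cases "Suc (Suc i) < n") (auto simp: le_mod_geq)
    qed
  qed
  then show ?thesis using simple conn k by (auto simp: is_tree_def)
qed

text \<open>The component of \<open>a\<close> after deletion of the vertex \<open>v\<close>: for
  \<open>a\<close> other than \<open>v\<close>, the part of a tree that hangs on \<open>v\<close> by
  the last edge of the path from \<open>a\<close> to \<open>v\<close>.\<close>

definition branch :: "nat set set \<Rightarrow> nat \<Rightarrow> nat \<Rightarrow> nat set" where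
  "branch E v a = {x. (a, x) \<in> (adj {e\<in>E. v \<notin> e})\<^sup>*}"

text \<open>All data of a join can be read off the joined tree: the side of \<open>a\<close> is its
  branch, the two trees are the edges within the sides, and \<open>k\<close> is the neighbour of
  \<open>v\<close> on the side of \<open>a\<close>. This makes joining injective.\<close>

lemma branch_join:
  assumes t1: "is_tree A E1" and t2: "is_tree B E2" and disj: "A \<inter> B = {}"
    and k: "k \<in> A" and v: "v \<in> B" and a: "a \<in> A"
  defines "E \<equiv> insert {k, v} (E1 \<union> E2)"
  shows "branch E v a = A" "{e\<in>E. e \<subseteq> A} = E1" "{e\<in>E. e \<subseteq> B} = E2"
    "{x\<in>A. {x, v} \<in> E} = {k}"
proof -
  have s1: "simple_graph A E1" and s2: "simple_graph B E2"
    using t1 t2 by (auto simp: is_tree_def)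
  have ne1: "e \<noteq> {}" if "e \<in> E1" for e using that s1 by (auto simp: simple_graph_def)
  have ne2: "e \<noteq> {}" if "e \<in> E2" for e using that s2 by (auto simp: simple_graph_def)
  have sub1: "e \<subseteq> A" if "e \<in> E1" for e using that s1 by (auto simp: simple_graph_def)
  have sub2: "e \<subseteq> B" if "e \<in> E2" for e using that s2 by (auto simp: simple_graph_def)
  show "{e\<in>E. e \<subseteq> A} = E1" "{e\<in>E. e \<subseteq> B} = E2"
    using ne1 ne2 sub1 sub2 disj k v unfolding E_def by blast+
  show "{x\<in>A. {x, v} \<in> E} = {k}"
    using sub1[of "{_, v}"] sub2[of "{_, v}"] disj k v unfolding E_def
    by (auto simp: doubleton_eq_iff)
  show "branch E v a = A"
  proof
    show "branch E v a \<subseteq> A"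
    proof
      fix x assume "x \<in> branch E v a"
      then have "(a, x) \<in> (adj {e\<in>E. v \<notin> e})\<^sup>*" by (simp add: branch_def)
      then show "x \<in> A"
      proof (induction rule: rtrancl_induct)
        case (step y z)
        then show ?case using sub1 sub2 disj unfolding E_def by fastforce
      qed (rule a)
    qed
    show "A \<subseteq> branch E v a"
    proof
      fix x assume "x \<in> A"
      then have "(a, x) \<in> (adj E1)\<^sup>*"
        using t1 a by (auto simp: is_tree_def connected_graph_def)
      moreover have "adj E1 \<subseteq> adj {e\<in>E. v \<notin> e}"
        using sub1 disj v unfolding E_def by auto
      ultimately show "x \<in> branch E v a"
        unfolding branch_def using rtrancl_mono by blast
    qed
  qed
qed

text \<open>Converse of \<open>is_tree_join\<close>. An edge leaving the branch \<open>A\<close> can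
  only end at \<open>v\<close>; connectedness provides one such edge, and a second one would close a
  cycle through \<open>v\<close>.\<close>

lemma is_tree_cut:
  assumes t: "is_tree V E" and av: "a \<in> V" "v \<in> V" "a \<noteq> v"
  defines "A \<equiv> branch E v a"
  shows "a \<in> A" "A \<subseteq> V - {v}"
    "\<exists>k\<in>A. is_tree A {e\<in>E. e \<subseteq> A} \<and> is_tree (V - A) {e\<in>E. e \<subseteq> V - A} \<and>
       E = insert {k, v} ({e\<in>E. e \<subseteq> A} \<union> {e\<in>E. e \<subseteq> V - A})"
proof -
  have s: "simple_graph V E" and conn: "connected_graph V E" and acyc: "\<nexists>c. graph_cycle E c"
    using t by (auto simp: is_tree_def)
  let ?E1 = "{e\<in>E. e \<subseteq> A}" and ?E2 = "{e\<in>E. e \<subseteq> V - A}"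
  show aU: "a \<in> A" by (simp add: A_def branch_def)
  show UV: "A \<subseteq> V - {v}"
  proof
    fix x assume "x \<in> A"
    then have "(a, x) \<in> (adj {e\<in>E. v \<notin> e})\<^sup>*" by (simp add: A_def branch_def)
    then show "x \<in> V - {v}"
      by (induction rule: rtrancl_induct) (use av simple_graph_edge[OF s] in auto)
  qed
  have leave: "y = v" if "{x, y} \<in> E" "x \<in> A" "y \<notin> A" for x y
  proof (rule ccontr)
    assume "y \<noteq> v"
    then have "(x, y) \<in> adj {e\<in>E. v \<notin> e}" using that UV by auto
    then show False using that unfolding A_def branch_def
      by (auto intro: rtrancl_into_rtrancl)
  qed
  have root: "(a, x) \<in> (adj ?E1)\<^sup>*" if "x \<in> A" for x
  proof -
    have "(a, x) \<in> (adj {e\<in>E. v \<notin> e})\<^sup>*" using that by (simp add: A_def branch_def)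
    then show ?thesis
    proof (induction rule: rtrancl_induct)
      case (step y z)
      have "y \<in> A" "z \<in> A"
        using step(1,2) unfolding A_def branch_def by (auto intro: rtrancl_into_rtrancl)
      then show ?case using step by (auto intro: rtrancl_into_rtrancl)
    qed simp
  qed
  have con1: "connected_graph A ?E1" using root by (rule connected_from_root)
  have "\<exists>k\<in>A. {k, v} \<in> E"
  proof (rule ccontr)
    assume *: "\<not> ?thesis"
    have "(a, v) \<in> (adj E)\<^sup>*" using conn av by (auto simp: connected_graph_def)
    then have "v \<in> A"
    proof (induction rule: rtrancl_induct)
      case (step y z)
      then show ?case using leave[of y z] * by auto
    qed (rule aU)
    then show False using UV by auto
  qed
  then obtain k where k: "k \<in> A" "{k, v} \<in> E" by blast
  have uniq: "k' = k" if k': "k' \<in> A" "{k', v} \<in> E" for k'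
  proof (rule ccontr)
    assume "k' \<noteq> k"
    have "(k, k') \<in> (adj ?E1)\<^sup>*" using con1 k k' by (auto simp: connected_graph_def)
    then obtain xs where xs: "xs \<noteq> []" "hd xs = k" "last xs = k'" "distinct xs"
      "\<And>i. Suc i < length xs \<Longrightarrow> {xs ! i, xs ! Suc i} \<in> ?E1"
      using rtrancl_simple_path by blast
    have len: "length xs \<ge> 2"
    proof (rule ccontr)
      assume "\<not> length xs \<ge> 2"
      then have "length xs = 0 \<or> length xs = Suc 0" by linarith
      then obtain x where "xs = [x]" using xs(1) by (auto simp: length_Suc_conv)
      then show False using xs(2,3) \<open>k' \<noteq> k\<close> by simp
    qed
    have inU: "xs ! i \<in> A" if "i < length xs" for i
    proof (cases i)
      case 0
      then show ?thesis using xs(1,2) k(1) by (simp add: hd_conv_nth)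
    next
      case (Suc j)
      then show ?thesis using xs(5)[of j] that by auto
    qed
    \<comment> \<open>The simple path inside \<open>A\<close> between two neighbours of
      \<open>v\<close> closes up at \<open>v\<close>; having different ends, it has at least two
      vertices, so the cycle has at least three.\<close>
    have "graph_cycle E (v # xs)"
      unfolding graph_cycle_def
    proof (intro conjI allI impI)
      show "3 \<le> length (v # xs)" using len by simp
      show "distinct (v # xs)" using xs(4) inU UV by (auto simp: in_set_conv_nth)
      fix i assume i: "i < length (v # xs)"
      show "{(v # xs) ! i, (v # xs) ! (Suc i mod length (v # xs))} \<in> E"
      proof (cases "i = length xs")
        case True
        then show ?thesis using xs(1,3) k'(2)
          by (auto simp: nth_Cons' last_conv_nth)
      next
        case False
        then show ?thesis using i xs(5)[of "i - 1"] xs(1,2) k(2)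
          by (cases i) (auto simp: hd_conv_nth insert_commute)
      qed
    qed
    then show False using acyc by blast
  qed
  have mem: "x \<in> V" "y \<in> V" "x \<noteq> y" if "{x, y} \<in> E" for x y
    using simple_graph_edge[OF s that] by auto
  have split: "E = insert {k, v} (?E1 \<union> ?E2)"
  proof
    show "E \<subseteq> insert {k, v} (?E1 \<union> ?E2)"
    proof
      fix e assume e: "e \<in> E"
      then obtain x y where xy: "e = {x, y}"
        using s unfolding simple_graph_def by (metis card_2_iff)
      have xyE: "{x, y} \<in> E" and yxE: "{y, x} \<in> E" using e xy by (auto simp: insert_commute)
      consider "x \<in> A" "y \<in> A" | "x \<notin> A" "y \<notin> A" | "x \<in> A" "y \<notin> A" | "x \<notin> A" "y \<in> A"
        by blast
      then show "e \<in> insert {k, v} (?E1 \<union> ?E2)"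
      proof cases
        case 3
        then have "y = v" using leave[OF xyE] by simp
        then show ?thesis using uniq[of x] 3 xyE xy by simp
      next
        case 4
        then have "x = v" using leave[OF yxE] by simp
        then show ?thesis using uniq[of y] 4 yxE xy by (simp add: insert_commute)
      qed (use e xy mem[OF xyE] in auto)
    qed
  qed (use k in auto)
  \<comment> \<open>A step from outside \<open>A\<close> into \<open>A\<close> can only start at
    \<open>v\<close>, so a path to \<open>v\<close> stays outside \<open>A\<close> until it has
    reached \<open>v\<close>.\<close>
  have "(x, v) \<in> (adj ?E2)\<^sup>*" if "x \<in> V - A" for x
  proof -
    have "(x, v) \<in> (adj E)\<^sup>*" using conn av that by (auto simp: connected_graph_def)
    then show ?thesis using that
    proof (induction rule: converse_rtrancl_induct)
      case (step x y)
      show ?case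
      proof (cases "y \<in> A")
        case True
        then have "x = v" using leave[of y x] step by (auto simp: insert_commute)
        then show ?thesis by simp
      next
        case False
        have xyE: "{x, y} \<in> E" using step(1) by simp
        have "(y, v) \<in> (adj ?E2)\<^sup>*" using step False mem[OF xyE] by blast
        moreover have "(x, y) \<in> adj ?E2" using step False mem[OF xyE] by auto
        ultimately show ?thesis by (meson converse_rtrancl_into_rtrancl)
      qed
    qed simp
  qed
  then have con2: "connected_graph (V - A) ?E2"
    using adj_sym by (intro connected_from_root[of _ v]) blast
  have "is_tree A ?E1"
    using aU con1 acyc s graph_cycle_mono[of ?E1 _ E]
    by (auto simp: is_tree_def simple_graph_def)
  moreover have "is_tree (V - A) ?E2"
    using av UV con2 acyc s graph_cycle_mono[of ?E2 _ E]
    by (auto simp: is_tree_def simple_graph_def)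
  ultimately show "\<exists>k\<in>A. is_tree A ?E1 \<and> is_tree (V - A) ?E2 \<and>
       E = insert {k, v} (?E1 \<union> ?E2)" using split k by blast
qed

section \<open>Weighted sums over the trees on a vertex set\<close>

lemma finite_trees_on: "finite V \<Longrightarrow> finite {E. is_tree V E}"
  by (rule finite_subset[of _ "Pow (Pow V)"]) (auto simp: is_tree_def simple_graph_def)

definition tree_sum :: "(nat set \<Rightarrow> complex) \<Rightarrow> nat set \<Rightarrow> complex" where
  "tree_sum f V = (\<Sum>E | is_tree V E. \<Prod>e\<in>E. f e)"

lemma is_tree_singleton: "is_tree {v} E \<longleftrightarrow> E = {}"
proof
  assume "is_tree {v} E"
  then have "\<forall>e\<in>E. e \<subseteq> {v} \<and> card e = 2" by (auto simp: is_tree_def simple_graph_def)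
  then show "E = {}" by (metis card_2_iff insert_subset singletonD equals0I)
qed (auto simp: is_tree_def simple_graph_def connected_graph_def graph_cycle_def
    intro!: exI[of _ 0])

lemma tree_sum_singleton [simp]: "tree_sum f {v} = 1"
  by (simp add: tree_sum_def is_tree_singleton)

text \<open>Cut the last edge of the path from \<open>a\<close> to \<open>v\<close>.\<close>

lemma tree_sum_cut:
  assumes fin: "finite V" and av: "a \<in> V" "v \<in> V" "a \<noteq> v"
  shows "tree_sum f V =
    (\<Sum>A | A \<subseteq> V - {v} \<and> a \<in> A. (\<Sum>k\<in>A. f {v, k}) * tree_sum f A * tree_sum f (V - A))"
proof -
  let ?I = "{A. A \<subseteq> V - {v} \<and> a \<in> A}"
  let ?D = "Sigma ?I (\<lambda>A. A \<times> {E. is_tree A E} \<times> {E. is_tree (V - A) E})"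
  define join where "join = (\<lambda>(A :: nat set, k, E1, E2). insert {k, v} (E1 \<union> E2))"
  have finI: "finite ?I" using fin by simp
  have finU: "finite A" if "A \<in> ?I" for A using fin that finite_subset by blast
  have inj: "inj_on join ?D"
  proof (rule inj_onI)
    fix p q assume pq: "p \<in> ?D" "q \<in> ?D" "join p = join q"
    obtain A k E1 E2 B k' E1' E2' where p: "p = (A, k, E1, E2)" and q: "q = (B, k', E1', E2')"
      by (metis prod_cases4)
    have D: "A \<subseteq> V - {v}" "a \<in> A" "k \<in> A" "is_tree A E1" "is_tree (V - A) E2"
      "B \<subseteq> V - {v}" "a \<in> B" "k' \<in> B" "is_tree B E1'" "is_tree (V - B) E2'"
      using pq by (auto simp: p q)
    note b = branch_join[of A E1 "V - A" E2 k v a]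
      and b' = branch_join[of B E1' "V - B" E2' k' v a]
    have d: "A \<inter> (V - A) = {}" "B \<inter> (V - B) = {}" "v \<in> V - A" "v \<in> V - B"
      using D av by auto
    let ?E = "insert {k, v} (E1 \<union> E2)"
    have E: "insert {k', v} (E1' \<union> E2') = ?E" using pq(3) by (simp add: join_def p q)
    have A: "A = B" using b(1) b'(1) D d E by metis
    have "E1 = E1'" "E2 = E2'" "{k} = {k'}"
      using b(2-4) b'(2-4) D d unfolding E A by metis+
    then show "p = q" using A by (simp add: p q)
  qed
  have surj: "join ` ?D = {E. is_tree V E}"
  proof
    show "join ` ?D \<subseteq> {E. is_tree V E}"
    proof clarify
      fix A k E1 E2
      assume D: "A \<subseteq> V - {v}" "a \<in> A" "k \<in> A" "is_tree A E1" "is_tree (V - A) E2"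
      have "A \<union> (V - A) = V" using D by auto
      then show "is_tree V (join (A, k, E1, E2))"
        using is_tree_join[OF D(4,5) _ D(3), of v] D av by (auto simp: join_def)
    qed
    show "{E. is_tree V E} \<subseteq> join ` ?D"
    proof clarify
      fix E assume t: "is_tree V E"
      let ?A = "branch E v a"
      obtain k where "k \<in> ?A" "is_tree ?A {e\<in>E. e \<subseteq> ?A}"
        "is_tree (V - ?A) {e\<in>E. e \<subseteq> V - ?A}"
        "E = join (?A, k, {e\<in>E. e \<subseteq> ?A}, {e\<in>E. e \<subseteq> V - ?A})"
        using is_tree_cut(3)[OF t av] by (auto simp: join_def)
      then show "E \<in> join ` ?D"
        using is_tree_cut(1,2)[OF t av] by (intro image_eqI) auto
    qed
  qed
  have prod: "(\<Prod>e\<in>join (A, k, E1, E2). f e) = f {v, k} * ((\<Prod>e\<in>E1. f e) * (\<Prod>e\<in>E2. f e))"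
    if D: "A \<subseteq> V - {v}" "k \<in> A" "is_tree A E1" "is_tree (V - A) E2" for A k E1 E2
  proof -
    have sub: "\<And>e. e \<in> E1 \<Longrightarrow> e \<subseteq> A" "\<And>e. e \<in> E2 \<Longrightarrow> e \<subseteq> V - A" "\<And>e. e \<in> E1 \<Longrightarrow> e \<noteq> {}"
      using D by (auto simp: is_tree_def simple_graph_def)
    have "finite E1" "finite E2"
      using sub fin D finite_subset[of E1 "Pow V"] finite_subset[of E2 "Pow V"] by blast+
    moreover have "E1 \<inter> E2 = {}" "{k, v} \<notin> E1 \<union> E2" using sub D av by blast+
    ultimately show ?thesis
      by (simp add: join_def prod.union_disjoint insert_commute)
  qed
  have "tree_sum f V = (\<Sum>p\<in>?D. \<Prod>e\<in>join p. f e)"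
    unfolding tree_sum_def surj[symmetric] by (simp add: sum.reindex[OF inj])
  also have "\<dots> = (\<Sum>(A, k, E1, E2)\<in>?D. f {v, k} * ((\<Prod>e\<in>E1. f e) * (\<Prod>e\<in>E2. f e)))"
    by (rule sum.cong) (auto simp: prod)
  also have "\<dots> = (\<Sum>A\<in>?I. \<Sum>(k, E1, E2)\<in>A \<times> {E. is_tree A E} \<times> {E. is_tree (V - A) E}.
      f {v, k} * ((\<Prod>e\<in>E1. f e) * (\<Prod>e\<in>E2. f e)))"
    by (rule sum.Sigma[symmetric]) (use finI finU fin finite_trees_on in auto)
  also have "\<dots> = (\<Sum>A\<in>?I. (\<Sum>k\<in>A. f {v, k}) * tree_sum f A * tree_sum f (V - A))"
    by (rule sum.cong) (auto simp: tree_sum_def sum.cartesian_product[symmetric]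
        sum_distrib_left[symmetric] sum_distrib_right[symmetric] mult.assoc)
  finally show ?thesis .
qed

section \<open>Euler derivations, rescaling and the exponential for parameters that square to
  zero\<close>

section \<open>Calculus in the algebra of commuting parameters\<close>

lemma cst_add: "cst (a + b) = cst a + cst b"
  and cst_diff: "cst (a - b) = cst a - cst b"
  and cst_minus: "cst (- a) = - cst a"
  and cst_mult: "cst (a * b) = cst a * cst b"
  by (rule eps_eqI, simp add: ecoeff_cst ecoeff_cst_mult)+

lemma cst_0 [simp]: "cst 0 = 0" and cst_1 [simp]: "cst 1 = 1"
  by (rule eps_eqI, simp add: ecoeff_cst ecoeff_one)+

lemma cst_sum: "cst (sum f A) = (\<Sum>a\<in>A. cst (f a))"
  by (induction A rule: infinite_finite_induct) (auto simp: cst_add)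

lemma cst_prod: "cst (prod f A) = (\<Prod>a\<in>A. cst (f a))"
  by (induction A rule: infinite_finite_induct) (auto simp: cst_mult)

lemma cst_power: "cst (a ^ n) = cst a ^ n"
  by (induction n) (auto simp: cst_mult)

lemma ecoeff_eps_mult:
  "ecoeff (eps i * x) S = (if finite S \<and> i \<in> S then ecoeff x (S - {i}) else 0)"
proof (cases "finite S")
  case True
  have "ecoeff (eps i * x) S = (\<Sum>T\<in>Pow S. if T = {i} then ecoeff x (S - {i}) else 0)"
    unfolding ecoeff_mult by (rule sum.cong) (auto simp: ecoeff_eps)
  then show ?thesis using True by (simp add: sum.delta)
qed (simp add: ecoeff_infinite)

lemma ecoeff_prod_eps:
  "finite T \<Longrightarrow> ecoeff ((\<Prod>k\<in>T. eps k) * x) S =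
     (if finite S \<and> T \<subseteq> S then ecoeff x (S - T) else 0)"
proof (induction T arbitrary: S rule: finite_induct)
  case empty
  then show ?case by (simp add: ecoeff_infinite)
next
  case (insert i T)
  have "S - {i} - T = S - insert i T" by auto
  then show ?case using insert by (auto simp: mult.assoc ecoeff_eps_mult)
qed

text \<open>The Euler derivation, \<open>eps l\<close> times the partial derivative with respect to
  \<open>eps l\<close>. It acts as the identity on coefficients at sets that contain
  \<open>l\<close>.\<close>

definition theta :: "nat \<Rightarrow> eps_alg \<Rightarrow> eps_alg" where
  "theta l x = Abs_eps (\<lambda>S. if l \<in> S then ecoeff x S else 0)"

lemma ecoeff_theta: "ecoeff (theta l x) S = (if l \<in> S then ecoeff x S else 0)"
  unfolding theta_def by (subst ecoeff_Abs) (auto simp: ecoeff_infinite)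

lemma theta_add: "theta l (x + y) = theta l x + theta l y"
  by (rule eps_eqI) (simp add: ecoeff_theta)

lemma theta_sum: "theta l (sum f A) = (\<Sum>a\<in>A. theta l (f a))"
  by (rule eps_eqI) (simp add: ecoeff_theta ecoeff_sum)

lemma theta_cst_mult: "theta l (cst a * x) = cst a * theta l x"
  by (rule eps_eqI) (simp add: ecoeff_theta ecoeff_cst_mult)

lemma theta_cst [simp]: "theta l (cst a) = 0"
  by (rule eps_eqI) (auto simp: ecoeff_theta ecoeff_cst)

lemma theta_one [simp]: "theta l 1 = 0"
  using theta_cst[of l 1] by simp

lemma theta_eps: "theta l (eps k) = (if l = k then eps k else 0)"
  by (rule eps_eqI) (auto simp: ecoeff_theta ecoeff_eps)

text \<open>Leibniz rule: an index \<open>l\<close> of \<open>S\<close> lies in exactly one of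
  \<open>T\<close> and \<open>S - T\<close>.\<close>

lemma theta_mult: "theta l (x * y) = theta l x * y + x * theta l y"
proof (rule eps_eqI)
  fix S :: "nat set" assume S: "finite S"
  have "ecoeff (theta l x * y + x * theta l y) S =
    (\<Sum>T\<in>Pow S. ecoeff (theta l x) T * ecoeff y (S - T) + ecoeff x T * ecoeff (theta l y) (S - T))"
    by (simp add: ecoeff_mult sum.distrib)
  also have "\<dots> = (\<Sum>T\<in>Pow S. if l \<in> S then ecoeff x T * ecoeff y (S - T) else 0)"
    by (rule sum.cong) (auto simp: ecoeff_theta)
  finally show "ecoeff (theta l (x * y)) S = ecoeff (theta l x * y + x * theta l y) S"
    by (simp add: ecoeff_theta ecoeff_mult)
qed

text \<open>The substitution of \<open>u k\<close> times \<open>eps k\<close> for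
  \<open>eps k\<close>. With plane waves as \<open>u\<close> it carries the dependence of the tree
  terms on the point; with zeros and ones it discards parameters.\<close>

definition rescale :: "(nat \<Rightarrow> complex) \<Rightarrow> eps_alg \<Rightarrow> eps_alg" where
  "rescale u x = Abs_eps (\<lambda>S. prod u S * ecoeff x S)"

lemma ecoeff_rescale: "ecoeff (rescale u x) S = prod u S * ecoeff x S"
  unfolding rescale_def by (subst ecoeff_Abs) (auto simp: ecoeff_infinite)

lemma rescale_add: "rescale u (x + y) = rescale u x + rescale u y"
  and rescale_diff: "rescale u (x - y) = rescale u x - rescale u y"
  by (rule eps_eqI, simp add: ecoeff_rescale algebra_simps)+

lemma rescale_cst [simp]: "rescale u (cst a) = cst a"
  by (rule eps_eqI) (simp add: ecoeff_rescale ecoeff_cst)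

lemma rescale_zero [simp]: "rescale u 0 = 0"
  using rescale_cst[of u 0] by simp

lemma rescale_one [simp]: "rescale u 1 = 1"
  using rescale_cst[of u 1] by simp

lemma rescale_mult: "rescale u (x * y) = rescale u x * rescale u y"
proof (rule eps_eqI)
  fix S :: "nat set" assume S: "finite S"
  have "prod u S = prod u T * prod u (S - T)" if "T \<subseteq> S" for T
    using prod.subset_diff[OF that S] by (simp add: mult.commute)
  then show "ecoeff (rescale u (x * y)) S = ecoeff (rescale u x * rescale u y) S"
    by (auto simp: ecoeff_rescale ecoeff_mult sum_distrib_left mult_ac intro!: sum.cong)
qed

lemma rescale_sum: "rescale u (sum f A) = (\<Sum>a\<in>A. rescale u (f a))"
  by (rule eps_eqI) (simp add: ecoeff_rescale ecoeff_sum sum_distrib_left)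

lemma rescale_prod: "rescale u (prod f A) = (\<Prod>a\<in>A. rescale u (f a))"
  by (induction A rule: infinite_finite_induct) (auto simp: rescale_mult)

lemma eexp_cst: "eexp (cst a) = cst (exp a)"
proof (rule eps_eqI)
  fix S :: "nat set"
  have "(\<lambda>n. a ^ n / fact n) sums exp a"
    using exp_converges[of a] by (simp add: scaleR_conv_of_real field_simps)
  then show "ecoeff (eexp (cst a)) S = ecoeff (cst (exp a)) S"
    by (auto simp: ecoeff_eexp cst_power[symmetric] ecoeff_cst sums_iff)
qed

text \<open>The binomial expansion of a power stops after the term linear in \<open>y\<close>, and
  dividing by the factorial turns the linear terms into the exponential series of \<open>x\<close>
  again, shifted by one.\<close>

lemma eexp_add_square_zero:
  assumes y: "y * y = 0"
  shows "eexp (x + y) = eexp x * (1 + y)"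
proof (rule eps_eqI)
  fix S :: "nat set" assume S: "finite S"
  have pow: "(x + y) ^ Suc n = x ^ Suc n + of_nat (Suc n) * (x ^ n * y)" for n
  proof (induction n)
    case (Suc n)
    have "(x + y) ^ Suc (Suc n) = (x ^ Suc n + of_nat (Suc n) * (x ^ n * y)) * (x + y)"
      using Suc by (simp add: mult.commute)
    also have "\<dots> = x ^ Suc (Suc n) + of_nat (Suc (Suc n)) * (x ^ Suc n * y)
        + of_nat (Suc n) * x ^ n * (y * y)"
      by (simp add: algebra_simps)
    finally show ?case using y by simp
  qed simp
  have of_nat: "ecoeff (of_nat n * z) T = of_nat n * ecoeff z T" for n z T
    by (induction n) (auto simp: algebra_simps)
  let ?a = "\<lambda>n. ecoeff (x ^ n) S / fact n" and ?b = "\<lambda>n. ecoeff (x ^ n * y) S / fact n"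
  have b: "?b sums ecoeff (eexp x * y) S"
  proof -
    have "(\<lambda>n. \<Sum>T\<in>Pow S. ecoeff (x ^ n) T / fact n * ecoeff y (S - T)) sums
        (\<Sum>T\<in>Pow S. ecoeff (eexp x) T * ecoeff y (S - T))"
      by (intro sums_sum sums_mult2) (simp add: ecoeff_eexp summable_sums[OF eexp_summable])
    then show ?thesis by (simp add: ecoeff_mult sum_divide_distrib)
  qed
  have a: "?a sums ecoeff (eexp x) S"
    by (simp add: ecoeff_eexp summable_sums[OF eexp_summable])
  have step: "ecoeff ((x + y) ^ Suc n) S / fact (Suc n) = ?a (Suc n) + ?b n" for n
  proof -
    have "of_nat (Suc n) * ecoeff (x ^ n * y) S / fact (Suc n) = ?b n"
      unfolding fact_Suc of_nat_mult by (simp del: of_nat_Suc)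
    then show ?thesis
      unfolding pow ecoeff_add of_nat by (simp only: add_divide_distrib)
  qed
  \<comment> \<open>The expansion \<open>pow\<close> starts at exponent one, so the term of exponent
    zero is split off here and added back below.\<close>
  have "(\<lambda>n. ?a (Suc n)) sums (ecoeff (eexp x) S - ?a 0)"
    using a by (subst sums_Suc_iff) simp
  from sums_add[OF this b]
  have "(\<lambda>n. ecoeff ((x + y) ^ Suc n) S / fact (Suc n)) sums
      (ecoeff (eexp x) S - ?a 0 + ecoeff (eexp x * y) S)"
    unfolding step .
  then have "(\<lambda>n. ecoeff ((x + y) ^ n) S / fact n) sums
      (ecoeff (eexp x) S - ?a 0 + ecoeff (eexp x * y) S + ecoeff ((x + y) ^ 0) S / fact 0)"
    by (subst (asm) sums_Suc_iff) simp
  then show "ecoeff (eexp (x + y)) S = ecoeff (eexp x * (1 + y)) S"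
    by (simp add: ecoeff_eexp[of "x + y"] sums_iff distrib_left)
qed

lemma eexp_add_sum_square_zero:
  assumes "\<And>k. k \<in> K \<Longrightarrow> y k * y k = 0"
  shows "eexp (x + (\<Sum>k\<in>K. y k)) = eexp x * (\<Prod>k\<in>K. 1 + y k)"
  using assms
proof (induction K rule: infinite_finite_induct)
  case (insert k K)
  have "eexp (x + (\<Sum>k\<in>insert k K. y k)) = eexp ((x + (\<Sum>k\<in>K. y k)) + y k)"
    using insert by (simp add: add_ac)
  also have "\<dots> = eexp x * (\<Prod>k\<in>K. 1 + y k) * (1 + y k)"
    using insert by (subst eexp_add_square_zero) auto
  finally show ?case using insert by (simp add: mult_ac)
qed auto

section \<open>The functional equation of rooted tree series and its derivatives\<close>

section \<open>Generating functions of trees\<close>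

locale tree_weights =
  fixes S :: "nat set" and w :: "nat \<Rightarrow> nat \<Rightarrow> complex"
  assumes fin: "finite S" and w_sym: "w i j = w j i"
begin

definition T :: "nat set \<Rightarrow> complex" where
  "T = tree_sum (\<lambda>e. w (Min e) (Max e))"

definition Y :: "nat \<Rightarrow> eps_alg" where
  "Y k = Abs_eps (\<lambda>R. if R \<subseteq> S \<and> k \<in> R then T R else 0)"

definition Z :: "nat \<Rightarrow> nat \<Rightarrow> eps_alg" where
  "Z k l = theta l (Y k)"

text \<open>The exponential of the sum of all \<open>cst (c k) * Y k\<close>, written as a product
  because \<open>Y k\<close> squares to zero. By the matrix-tree theorem its coefficient at
  \<open>S\<close> is the determinant of the weighted Laplacian with extra diagonal
  \<open>c\<close>.\<close>

definition E :: "(nat \<Rightarrow> complex) \<Rightarrow> eps_alg" where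
  "E c = (\<Prod>k\<in>S. 1 + cst (c k) * Y k)"

text \<open>The logarithmic derivative of \<open>Y k\<close> under \<open>theta l\<close>: by
  \<open>Z_eq\<close>, \<open>Z k l = Y k * V k l\<close> for \<open>k\<close> in \<open>S\<close>,
  although the nilpotent \<open>Y k\<close> cannot be divided by.\<close>

definition V :: "nat \<Rightarrow> nat \<Rightarrow> eps_alg" where
  "V k l = (if k = l then 1 else 0) + (\<Sum>m\<in>S. cst (w k m) * Z m l)"

lemma T_cut:
  assumes "finite R" "a \<in> R" "v \<in> R" "a \<noteq> v"
  shows "T R = (\<Sum>A | A \<subseteq> R - {v} \<and> a \<in> A. (\<Sum>k\<in>A. w v k) * T A * T (R - A))"
proof -
  have "w (Min {v, k}) (Max {v, k}) = w v k" for k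
    using w_sym by (auto simp: min_def max_def)
  then show ?thesis unfolding T_def by (subst tree_sum_cut[OF assms]) simp
qed

lemma T_singleton [simp]: "T {k} = 1"
  by (simp add: T_def)

lemma ecoeff_Y: "ecoeff (Y k) R = (if R \<subseteq> S \<and> k \<in> R then T R else 0)"
  unfolding Y_def using fin by (subst ecoeff_Abs) (auto dest: finite_subset)

lemma ecoeff_Z: "ecoeff (Z k l) R = (if R \<subseteq> S \<and> k \<in> R \<and> l \<in> R then T R else 0)"
  by (simp add: Z_def ecoeff_theta ecoeff_Y)

lemma Z_sym: "Z k l = Z l k"
  by (rule eps_eqI) (auto simp: ecoeff_Z)

lemma Z_diag: "Z k k = Y k"
  by (rule eps_eqI) (auto simp: ecoeff_Z ecoeff_Y)

text \<open>Both sides collect the trees that contain \<open>k\<close>, \<open>l\<close> and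
  \<open>m\<close>.\<close>

lemma theta_Z_sym: "theta k (Z m l) = theta m (Z k l)"
  by (rule eps_eqI) (auto simp: ecoeff_Z ecoeff_theta)

lemma Y_mult_Z [simp]: "Y k * Z k l = 0" and Y_square [simp]: "Y k * Y k = 0"
  by (rule eps_eqI, auto simp: ecoeff_mult ecoeff_Y ecoeff_Z intro!: sum.neutral)+

lemma E_mult: "E c * E d = E (\<lambda>k. c k + d k)"
proof -
  have "(1 + cst (c k) * Y k) * (1 + cst (d k) * Y k) = 1 + cst (c k + d k) * Y k" for k
  proof -
    have "(1 + cst (c k) * Y k) * (1 + cst (d k) * Y k) =
        1 + cst (c k + d k) * Y k + cst (c k * d k) * (Y k * Y k)"
      by (simp add: cst_add cst_mult algebra_simps)
    then show ?thesis by simp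
  qed
  then show ?thesis by (simp add: E_def prod.distrib[symmetric])
qed

lemma E_zero [simp]: "E (\<lambda>k. 0) = 1"
  by (simp add: E_def)

lemma E_prod: "(\<Prod>l\<in>A. E (f l)) = E (\<lambda>k. \<Sum>l\<in>A. f l k)"
  by (induction A rule: infinite_finite_induct) (auto simp: E_mult)

lemma theta_E: "theta l (E c) = (\<Sum>j\<in>S. cst (c j) * Z j l) * E c"
proof -
  have "theta l (\<Prod>k\<in>K. 1 + cst (c k) * Y k) =
      (\<Sum>j\<in>K. cst (c j) * Z j l) * (\<Prod>k\<in>K. 1 + cst (c k) * Y k)" for K
  proof (induction K rule: infinite_finite_induct)
    case (insert k K)
    let ?P = "\<Prod>k\<in>K. 1 + cst (c k) * Y k"
    have "theta l (\<Prod>k\<in>insert k K. 1 + cst (c k) * Y k) = cst (c k) * Z k l * ?P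
        + (1 + cst (c k) * Y k) * ((\<Sum>j\<in>K. cst (c j) * Z j l) * ?P)"
      using insert by (simp add: theta_mult theta_add theta_cst_mult Z_def)
    \<comment> \<open>The derivative of the factor of \<open>k\<close> lacks the factor
      \<open>1 + cst (c k) * Y k\<close> of the full product; it may be supplied because
      \<open>Y k * Z k l = 0\<close>.\<close>
    also have "cst (c k) * Z k l * ?P = cst (c k) * Z k l * ?P
        + cst (c k) * cst (c k) * (Y k * Z k l) * ?P"
      by simp
    finally show ?case using insert by (simp add: algebra_simps del: Y_mult_Z)
  qed auto
  then show ?thesis by (simp add: E_def)
qed

lemma ecoeff_E_empty: "ecoeff (E c) {} = 1"
proof -
  have "ecoeff (\<Prod>k\<in>K. 1 + cst (c k) * Y k) {} = 1" for K
    by (induction K rule: infinite_finite_induct)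
      (auto simp: ecoeff_one ecoeff_mult ecoeff_cst_mult ecoeff_Y)
  then show ?thesis by (simp add: E_def)
qed

text \<open>Deleting \<open>k\<close> from a tree leaves trees that are each joined to
  \<open>k\<close> by one edge. Formally, both sides obey the same recursion, which splits off the
  part \<open>A\<close> containing a chosen \<open>a\<close>: by \<open>theta_E\<close> on the left,
  by \<open>T_cut\<close> on the right.\<close>

lemma ecoeff_E_weights:
  assumes "R \<subseteq> S" "k \<in> S" "k \<notin> R"
  shows "ecoeff (E (w k)) R = T (insert k R)"
proof -
  have "finite R" using assms fin finite_subset by blast
  then show ?thesis using assms
  proof (induction R rule: finite_psubset_induct)
    case (psubset R)
    show ?case
    proof (cases "R = {}")
      case True
      then show ?thesis by (simp add: ecoeff_E_empty)
    next
      case False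
      then obtain a where a: "a \<in> R" by blast
      have finR: "finite R" by fact
      have "ecoeff (E (w k)) R = ecoeff (theta a (E (w k))) R"
        using a by (simp add: ecoeff_theta)
      also have "\<dots> = (\<Sum>A\<in>Pow R. (\<Sum>j\<in>S. w k j * ecoeff (Z j a) A) * ecoeff (E (w k)) (R - A))"
        by (simp only: theta_E ecoeff_mult[of "sum _ _"] ecoeff_sum ecoeff_cst_mult)
      also have "\<dots> = (\<Sum>A | A \<subseteq> R \<and> a \<in> A. (\<Sum>j\<in>A. w k j) * T A * T (insert k (R - A)))"
      proof (rule sum.mono_neutral_cong_right)
        show "finite (Pow R)" using finR by simp
        show "\<forall>A\<in>Pow R - {A. A \<subseteq> R \<and> a \<in> A}.
            (\<Sum>j\<in>S. w k j * ecoeff (Z j a) A) * ecoeff (E (w k)) (R - A) = 0"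
          by (auto simp: ecoeff_Z)
        fix A assume "A \<in> {A. A \<subseteq> R \<and> a \<in> A}"
        then have A: "A \<subseteq> R" "a \<in> A" by auto
        have "(\<Sum>j\<in>S. w k j * ecoeff (Z j a) A) = (\<Sum>j\<in>A. w k j * T A)"
          by (rule sum.mono_neutral_cong_right) (use A psubset.prems fin in \<open>auto simp: ecoeff_Z\<close>)
        moreover have "ecoeff (E (w k)) (R - A) = T (insert k (R - A))"
          using A psubset.prems by (intro psubset.IH) auto
        ultimately show "(\<Sum>j\<in>S. w k j * ecoeff (Z j a) A) * ecoeff (E (w k)) (R - A) =
            (\<Sum>j\<in>A. w k j) * T A * T (insert k (R - A))"
          by (simp add: sum_distrib_right)
      qed auto
      also have "\<dots> = T (insert k R)"
      proof -
        have "insert k R - A = insert k (R - A)" if "A \<subseteq> R" for A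
          using that psubset.prems by auto
        moreover have "insert k R - {k} = R" using psubset.prems by auto
        ultimately show ?thesis
          using finR a psubset.prems
          by (subst T_cut[of "insert k R" a k]) (auto intro!: sum.cong)
      qed
      finally show ?thesis .
    qed
  qed
qed

lemma ecoeff_E_outside: "\<not> R \<subseteq> S \<Longrightarrow> ecoeff (E c) R = 0"
proof -
  have "\<not> R \<subseteq> S \<Longrightarrow> ecoeff (\<Prod>k\<in>K. 1 + cst (c k) * Y k) R = 0" for K
  proof (induction K arbitrary: R rule: infinite_finite_induct)
    case (insert k K)
    have "ecoeff (1 + cst (c k) * Y k) A * ecoeff (\<Prod>k\<in>K. 1 + cst (c k) * Y k) (R - A) = 0"
      if "A \<subseteq> R" for A
    proof (cases "A \<subseteq> S")
      case True
      then have "\<not> R - A \<subseteq> S" using insert.prems by auto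
      then show ?thesis using insert.IH by simp
    qed (auto simp: ecoeff_one ecoeff_cst_mult ecoeff_Y)
    then have "ecoeff ((1 + cst (c k) * Y k) * (\<Prod>k\<in>K. 1 + cst (c k) * Y k)) R = 0"
      unfolding ecoeff_mult[of "1 + _"] by (intro sum.neutral) blast
    then show ?case using insert by simp
  qed (auto simp: ecoeff_one)
  then show "\<not> R \<subseteq> S \<Longrightarrow> ecoeff (E c) R = 0" by (simp add: E_def)
qed

lemma Y_eq: "k \<in> S \<Longrightarrow> Y k = eps k * E (w k)"
proof (rule eps_eqI)
  fix R assume k: "k \<in> S" and R: "finite (R :: nat set)"
  show "ecoeff (Y k) R = ecoeff (eps k * E (w k)) R"
  proof (cases "k \<in> R \<and> R \<subseteq> S")
    case True
    then have "ecoeff (E (w k)) (R - {k}) = T (insert k (R - {k}))"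
      using k by (intro ecoeff_E_weights) auto
    then show ?thesis using True R by (simp add: ecoeff_eps_mult ecoeff_Y insert_absorb)
  next
    case False
    then have "k \<in> R \<Longrightarrow> \<not> R - {k} \<subseteq> S" using k by auto
    then show ?thesis using False by (auto simp: ecoeff_eps_mult ecoeff_Y ecoeff_E_outside)
  qed
qed

lemma Z_eq: "k \<in> S \<Longrightarrow> Z k l = Y k * V k l"
proof -
  assume k: "k \<in> S"
  have "Z k l = theta l (eps k * E (w k))" using k by (simp add: Z_def Y_eq)
  also have "\<dots> = (if l = k then eps k else 0) * E (w k)
      + (eps k * E (w k)) * (\<Sum>m\<in>S. cst (w k m) * Z m l)"
    by (simp add: theta_mult theta_eps theta_E mult_ac)
  finally show ?thesis using k by (auto simp: V_def Y_eq[symmetric] distrib_left)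
qed

lemma sum_w_Z: "(\<Sum>k\<in>S. cst (w m k) * Z k l) = V m l - (if m = l then 1 else 0)"
  by (simp add: V_def)

section \<open>Ward identities of the weighted Laplacian\<close>

text \<open>
  The weighted Laplacian with an extra diagonal \<open>c\<close>, applied to the vector \<open>g\<close>. The coefficients
  at \<open>S\<close> of the \<open>Z m l * E c\<close> are its first minors, those of the antisymmetrized
  \<open>Z m l * Z p q * E c\<close> its second minors, and \<open>ward_wder\<close> plays the role of row
  operations on determinants.
\<close>

definition lap :: "(nat \<Rightarrow> complex) \<Rightarrow> (nat \<Rightarrow> complex) \<Rightarrow> nat \<Rightarrow> complex" where
  "lap c g m = c m * g m + (\<Sum>k\<in>S. w m k * (g m - g k))"

text \<open>The derivation that arises when the edge part of the Laplacian of \<open>g\<close> is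
  contracted with \<open>Z m l\<close> and the Euler derivative falls on the cofactor
  \<open>B\<close>.\<close>

definition wder :: "(nat \<Rightarrow> complex) \<Rightarrow> nat \<Rightarrow> eps_alg \<Rightarrow> eps_alg" where
  "wder g l B = (\<Sum>m\<in>S. \<Sum>k\<in>S. cst (w m k * (g m - g k)) * Z m l * theta k B)"

text \<open>The sum over the trees containing \<open>l\<close>, \<open>p\<close> and
  \<open>q\<close>, each weighted by \<open>g\<close> at the median vertex \<open>k\<close> where
  the paths between the three meet. Its symmetry in \<open>l\<close>, \<open>p\<close>,
  \<open>q\<close> is what later makes these terms cancel.\<close>

definition tri :: "(nat \<Rightarrow> complex) \<Rightarrow> nat \<Rightarrow> nat \<Rightarrow> nat \<Rightarrow> eps_alg" where
  "tri g l p q = (\<Sum>k\<in>S. cst (g k) * Y k * (V k l * V k p * V k q))"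

lemma tri_sym: "tri g l p q = tri g p l q" "tri g l p q = tri g l q p"
  by (simp_all add: tri_def mult_ac)

lemma wder_one [simp]: "wder g l 1 = 0"
  by (simp add: wder_def)

lemma wder_mult: "wder g l (A * B) = wder g l A * B + A * wder g l B"
  by (simp add: wder_def theta_mult distrib_left sum.distrib sum_distrib_left
      sum_distrib_right mult_ac)

text \<open>The part with \<open>g m\<close> keeps the inner sum over \<open>k\<close>; in the part
  with \<open>g k\<close> the symmetry of \<open>w\<close> lets the sum over \<open>m\<close>
  collapse to \<open>V\<close> minus the identity.\<close>

lemma sum_w_Z_bilinear:
  "(\<Sum>m\<in>S. \<Sum>k\<in>S. cst (w m k * (g m - g k)) * Z m l * A k) =
   (\<Sum>m\<in>S. cst (g m) * (Z m l * (\<Sum>k\<in>S. cst (w m k) * A k)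
      - (V m l - (if m = l then 1 else 0)) * A m))"
proof -
  have 1: "(\<Sum>m\<in>S. \<Sum>k\<in>S. cst (w m k * g m) * Z m l * A k) =
      (\<Sum>m\<in>S. cst (g m) * (Z m l * (\<Sum>k\<in>S. cst (w m k) * A k)))"
    by (simp add: cst_mult sum_distrib_left mult_ac)
  have "(\<Sum>m\<in>S. \<Sum>k\<in>S. cst (w m k * g k) * Z m l * A k) =
      (\<Sum>k\<in>S. \<Sum>m\<in>S. cst (w k m * g k) * Z m l * A k)"
    by (subst sum.swap) (simp add: w_sym)
  also have "\<dots> = (\<Sum>k\<in>S. cst (g k) * ((\<Sum>m\<in>S. cst (w k m) * Z m l) * A k))"
    by (simp add: cst_mult sum_distrib_left sum_distrib_right mult_ac)
  finally have 2: "(\<Sum>m\<in>S. \<Sum>k\<in>S. cst (w m k * g k) * Z m l * A k) =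
      (\<Sum>k\<in>S. cst (g k) * ((V k l - (if k = l then 1 else 0)) * A k))"
    by (simp add: sum_w_Z)
  have "(\<Sum>m\<in>S. \<Sum>k\<in>S. cst (w m k * (g m - g k)) * Z m l * A k) =
      (\<Sum>m\<in>S. \<Sum>k\<in>S. cst (w m k * g m) * Z m l * A k)
      - (\<Sum>m\<in>S. \<Sum>k\<in>S. cst (w m k * g k) * Z m l * A k)"
    unfolding sum_subtractf[symmetric] by (simp add: cst_diff left_diff_distrib right_diff_distrib)
  then show ?thesis
    by (simp only: 1 2 right_diff_distrib[of "cst _"] sum_subtractf)
qed

text \<open>By symmetry \<open>theta m (Z p q)\<close> is a derivative of
  \<open>Z m p = Y m * V m p\<close>. In the bilinear form both occurrences of
  \<open>theta q (V m p)\<close> then carry the factor \<open>Y m * V m l\<close> and cancel,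
  leaving \<open>tri\<close> and the diagonal term.\<close>

lemma wder_Z:
  assumes "l \<in> S"
  shows "wder g l (Z p q) = cst (g l) * theta l (Z p q) - tri g l p q"
proof -
  have tZ: "theta m (Z p q) = Y m * (V m p * V m q) + Y m * theta q (V m p)" if "m \<in> S" for m
  proof -
    have "theta m (Z p q) = theta q (Z m p)"
      by (metis Z_sym theta_Z_sym)
    also have "\<dots> = Z m q * V m p + Y m * theta q (V m p)"
      using that by (subst Z_eq) (simp_all add: theta_mult Z_def)
    finally show ?thesis using that by (simp add: Z_eq mult_ac)
  qed
  have tV: "(\<Sum>k\<in>S. cst (w m k) * theta k (Z p q)) = theta q (V m p)" for m
  proof -
    have "theta k (Z p q) = theta q (Z k p)" for k
      by (metis Z_sym theta_Z_sym)
    moreover have "theta q (if m = p then 1 else 0) = 0"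
      using theta_cst[of q 0] by auto
    ultimately show ?thesis by (simp add: V_def theta_add theta_sum theta_cst_mult)
  qed
  have "wder g l (Z p q) = (\<Sum>m\<in>S. cst (g m) * (Z m l * theta q (V m p)
      - (V m l - (if m = l then 1 else 0)) * theta m (Z p q)))"
    unfolding wder_def sum_w_Z_bilinear tV ..
  also have "\<dots> = (\<Sum>m\<in>S. (if m = l then cst (g l) * theta l (Z p q) else 0)
      - cst (g m) * Y m * (V m l * V m p * V m q))"
  proof (rule sum.cong)
    fix m assume m: "m \<in> S"
    show "cst (g m) * (Z m l * theta q (V m p)
        - (V m l - (if m = l then 1 else 0)) * theta m (Z p q)) =
      (if m = l then cst (g l) * theta l (Z p q) else 0)
        - cst (g m) * Y m * (V m l * V m p * V m q)"
      using tZ[OF m] Z_eq[OF m, of l] by (cases "m = l") (simp_all add: algebra_simps)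
  qed simp
  also have "\<dots> = cst (g l) * theta l (Z p q) - tri g l p q"
    using assms fin by (simp add: sum_subtractf tri_def)
  finally show ?thesis .
qed

text \<open>\<open>Z m l * V m j\<close> and \<open>V m l * Z m j\<close> both equal
  \<open>Y m * V m l * V m j\<close>, so only the two diagonal terms survive.\<close>

lemma sum_w_Z_Z:
  assumes "l \<in> S" "j \<in> S"
  shows "(\<Sum>m\<in>S. \<Sum>k\<in>S. cst (w m k * (g m - g k)) * Z m l * Z k j) =
    cst (g l) * Z j l - cst (g j) * Z j l"
proof -
  have "(\<Sum>m\<in>S. \<Sum>k\<in>S. cst (w m k * (g m - g k)) * Z m l * Z k j) =
      (\<Sum>m\<in>S. (if m = l then cst (g l) * Z l j else 0) - (if m = j then cst (g j) * Z j l else 0))"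
    unfolding sum_w_Z_bilinear sum_w_Z
  proof (rule sum.cong)
    fix m assume m: "m \<in> S"
    show "cst (g m) * (Z m l * (V m j - (if m = j then 1 else 0))
        - (V m l - (if m = l then 1 else 0)) * Z m j) =
      (if m = l then cst (g l) * Z l j else 0) - (if m = j then cst (g j) * Z j l else 0)"
      using Z_eq[OF m, of l] Z_eq[OF m, of j] by (auto simp: algebra_simps)
  qed simp
  then show ?thesis using assms fin by (simp add: sum_subtractf Z_sym[of l j])
qed

text \<open>At the full set \<open>S\<close> each \<open>theta k\<close> with \<open>k\<close> in
  \<open>S\<close> acts as the identity. The edge part of the Laplacian may therefore be written
  with derivatives of \<open>Z m l * B * E c\<close> and evaluated by the Leibniz rule.\<close>

lemma ward_wder:
  assumes l: "l \<in> S" and B: "wder g l B = cst (g l) * theta l B - R"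
  shows "(\<Sum>m\<in>S. lap c g m * ecoeff (Z m l * B * E c) S) =
    g l * ecoeff (B * E c) S - ecoeff (R * E c) S"
proof -
  let ?c = "\<lambda>m k. cst (w m k * (g m - g k))"
  let ?D = "\<Sum>j\<in>S. cst (c j) * Z j l"
  have top: "ecoeff (theta k x) S = ecoeff x S" if "k \<in> S" for k x
    using that by (simp add: ecoeff_theta)
  \<comment> \<open>\<open>theta k (Z m l)\<close> is symmetric in \<open>k\<close> and
    \<open>m\<close>, while its weight is antisymmetric.\<close>
  have anti: "(\<Sum>m\<in>S. \<Sum>k\<in>S. ?c m k * theta k (Z m l)) = 0" (is "?s = 0")
  proof -
    have "?s = (\<Sum>m\<in>S. \<Sum>k\<in>S. ?c k m * theta k (Z m l))"
      by (subst sum.swap, intro sum.cong refl, subst theta_Z_sym) (rule refl)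
    also have "\<dots> = - ?s"
    proof -
      have neg: "?c k m * x = - (?c m k * x)" for k m x
      proof -
        have "w k m * (g k - g m) = - (w m k * (g m - g k))"
          by (subst w_sym) (simp add: right_diff_distrib)
        then show ?thesis by (simp only: cst_minus mult_minus_left)
      qed
      show ?thesis
        unfolding sum_negf[symmetric] by (intro sum.cong refl neg)
    qed
    finally have neg: "?s = - ?s" .
    \<comment> \<open>\<open>eps_alg\<close> is only known to be a ring, so \<open>?s = - ?s\<close>
      is resolved in the complex coefficients.\<close>
    have "ecoeff ?s A = ecoeff 0 A" for A
      using arg_cong[OF neg, of "\<lambda>x. ecoeff x A"] by simp
    then show ?thesis by (rule eps_eqI)
  qed
  \<comment> \<open>The contribution of \<open>theta k (E c)\<close>. Its last sum, moved to the
    other side, is the diagonal part of \<open>lap\<close>.\<close>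
  have third: "(\<Sum>m\<in>S. \<Sum>k\<in>S. ?c m k * Z m l * (\<Sum>j\<in>S. cst (c j) * Z j k)) =
      cst (g l) * ?D - (\<Sum>j\<in>S. cst (c j * g j) * Z j l)"
  proof -
    have "(\<Sum>m\<in>S. \<Sum>k\<in>S. ?c m k * Z m l * (\<Sum>j\<in>S. cst (c j) * Z j k)) =
      (\<Sum>m\<in>S. \<Sum>k\<in>S. \<Sum>j\<in>S. cst (c j) * (?c m k * Z m l * Z k j))"
      by (simp add: sum_distrib_left mult_ac Z_sym)
    also have "\<dots> = (\<Sum>m\<in>S. \<Sum>j\<in>S. \<Sum>k\<in>S. cst (c j) * (?c m k * Z m l * Z k j))"
      by (rule sum.cong[OF refl], rule sum.swap)
    also have "\<dots> = (\<Sum>j\<in>S. \<Sum>m\<in>S. \<Sum>k\<in>S. cst (c j) * (?c m k * Z m l * Z k j))"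
      by (rule sum.swap)
    also have "\<dots> = (\<Sum>j\<in>S. cst (c j) * (cst (g l) * Z j l - cst (g j) * Z j l))"
      by (intro sum.cong refl) (simp only: sum_distrib_left[symmetric] sum_w_Z_Z[OF l])
    finally show ?thesis
      by (simp add: right_diff_distrib sum_subtractf sum_distrib_left cst_mult mult_ac)
  qed
  have "(\<Sum>m\<in>S. \<Sum>k\<in>S. w m k * (g m - g k) * ecoeff (Z m l * B * E c) S) =
      (\<Sum>m\<in>S. \<Sum>k\<in>S. ecoeff (?c m k * theta k (Z m l * B * E c)) S)"
    by (simp add: ecoeff_cst_mult top)
  also have "\<dots> = ecoeff (\<Sum>m\<in>S. \<Sum>k\<in>S. ?c m k * theta k (Z m l * B * E c)) S"
    by (simp add: ecoeff_sum)
  also have "(\<Sum>m\<in>S. \<Sum>k\<in>S. ?c m k * theta k (Z m l * B * E c)) =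
      (\<Sum>m\<in>S. \<Sum>k\<in>S. ?c m k * theta k (Z m l)) * (B * E c)
      + wder g l B * E c
      + (\<Sum>m\<in>S. \<Sum>k\<in>S. ?c m k * Z m l * (\<Sum>j\<in>S. cst (c j) * Z j k)) * (B * E c)"
    unfolding wder_def sum_distrib_right sum.distrib[symmetric]
    by (intro sum.cong refl) (simp add: theta_mult theta_E sum_distrib_left sum_distrib_right
        distrib_left distrib_right mult_ac)
  also have "\<dots> = cst (g l) * (theta l B * E c + B * (?D * E c)) - R * E c
      - (\<Sum>j\<in>S. cst (c j * g j) * Z j l) * (B * E c)"
    unfolding anti third B by (simp add: algebra_simps)
  also have "theta l B * E c + B * (?D * E c) = theta l (B * E c)"
    by (simp add: theta_mult theta_E)
  finally have main: "(\<Sum>m\<in>S. \<Sum>k\<in>S. w m k * (g m - g k) * ecoeff (Z m l * B * E c) S) =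
      g l * ecoeff (B * E c) S - ecoeff (R * E c) S
      - (\<Sum>m\<in>S. c m * g m * ecoeff (Z m l * B * E c) S)"
    using l by (simp add: ecoeff_cst_mult top sum_distrib_right ecoeff_sum mult.assoc)
  have "(\<Sum>m\<in>S. lap c g m * ecoeff (Z m l * B * E c) S) =
      (\<Sum>m\<in>S. c m * g m * ecoeff (Z m l * B * E c) S)
      + (\<Sum>m\<in>S. \<Sum>k\<in>S. w m k * (g m - g k) * ecoeff (Z m l * B * E c) S)"
    by (simp add: lap_def distrib_right sum.distrib sum_distrib_right)
  then show ?thesis unfolding main by simp
qed

lemma ward1:
  assumes "l \<in> S"
  shows "(\<Sum>m\<in>S. lap c g m * ecoeff (Z m l * E c) S) = g l * ecoeff (E c) S"
  using ward_wder[OF assms, of g 1 0 c] by simp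

lemma ward2:
  assumes "l \<in> S"
  shows "(\<Sum>m\<in>S. lap c g m * ecoeff (Z m l * Z p q * E c) S) =
    g l * ecoeff (Z p q * E c) S - ecoeff (tri g l p q * E c) S"
  by (rule ward_wder[OF assms wder_Z[OF assms]])

lemma ward3:
  assumes "l \<in> S"
  shows "(\<Sum>m\<in>S. lap c g m * ecoeff (Z m l * (Z p q * Z p' q') * E c) S) =
    g l * ecoeff (Z p q * Z p' q' * E c) S
    - (ecoeff (tri g l p q * Z p' q' * E c) S + ecoeff (Z p q * tri g l p' q' * E c) S)"
proof -
  have "wder g l (Z p q * Z p' q') = cst (g l) * theta l (Z p q * Z p' q')
      - (tri g l p q * Z p' q' + Z p q * tri g l p' q')"
    using assms by (simp add: wder_mult wder_Z theta_mult algebra_simps)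
  from ward_wder[OF assms this] show ?thesis by (simp add: distrib_right)
qed

text \<open>In determinant terms: a matrix with a nonzero null vector is singular.\<close>

lemma ecoeff_E_eq_0:
  assumes "l \<in> S" "n l \<noteq> 0" "\<And>m. m \<in> S \<Longrightarrow> lap c n m = 0"
  shows "ecoeff (E c) S = 0"
  using ward1[of l c n] assms by simp

text \<open>The expansion of a determinant under a change \<open>e\<close> of its diagonal into
  principal minors. Here \<open>A\<close> is the set of roots marked by \<open>e\<close>; deleting
  them turns their edges into diagonal entries of the remaining vertices.\<close>

lemma ecoeff_E_add:
  assumes "R \<subseteq> S"
  shows "ecoeff (E (\<lambda>k. c k + e k)) R =
    (\<Sum>A\<in>Pow R. (\<Prod>k\<in>A. e k) * ecoeff (E (\<lambda>k. c k + (\<Sum>l\<in>A. w l k))) (R - A))"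
proof -
  have finR: "finite R" using assms fin finite_subset by blast
  have expand: "(\<Prod>k\<in>A. cst (e k) * Y k) * E c =
      cst (\<Prod>k\<in>A. e k) * ((\<Prod>k\<in>A. eps k) * E (\<lambda>k. c k + (\<Sum>l\<in>A. w l k)))" if "A \<subseteq> S" for A
  proof -
    have "(\<Prod>k\<in>A. cst (e k) * Y k) = (\<Prod>k\<in>A. cst (e k) * (eps k * E (w k)))"
      using that by (intro prod.cong) (auto simp: Y_eq)
    also have "\<dots> = cst (\<Prod>k\<in>A. e k) * ((\<Prod>k\<in>A. eps k) * E (\<lambda>k. \<Sum>l\<in>A. w l k))"
      by (simp add: prod.distrib cst_prod E_prod)
    finally show ?thesis by (simp add: mult.assoc E_mult add.commute)
  qed
  have "E (\<lambda>k. c k + e k) = (\<Prod>k\<in>S. cst (e k) * Y k + 1) * E c"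
    by (simp add: E_mult[symmetric] E_def mult.commute add.commute)
  also have "(\<Prod>k\<in>S. cst (e k) * Y k + 1) = (\<Sum>A\<in>Pow S. \<Prod>k\<in>A. cst (e k) * Y k)"
    using fin by (simp add: prod_add)
  finally have "E (\<lambda>k. c k + e k) = (\<Sum>A\<in>Pow S. cst (\<Prod>k\<in>A. e k)
      * ((\<Prod>k\<in>A. eps k) * E (\<lambda>k. c k + (\<Sum>l\<in>A. w l k))))"
    by (simp add: sum_distrib_right expand)
  then have "ecoeff (E (\<lambda>k. c k + e k)) R = (\<Sum>A\<in>Pow S. (\<Prod>k\<in>A. e k)
      * (if A \<subseteq> R then ecoeff (E (\<lambda>k. c k + (\<Sum>l\<in>A. w l k))) (R - A) else 0))"
    using finR finite_subset[OF _ fin]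
    by (auto simp: ecoeff_sum ecoeff_cst_mult ecoeff_prod_eps intro!: sum.cong)
  also have "\<dots> = (\<Sum>A\<in>Pow R. (\<Prod>k\<in>A. e k) * ecoeff (E (\<lambda>k. c k + (\<Sum>l\<in>A. w l k))) (R - A))"
    using assms fin by (intro sum.mono_neutral_cong_right) auto
  finally show ?thesis .
qed

end

section \<open>Restriction to subsets and diagonal conjugation of the Laplacian\<close>

section \<open>Change of weights\<close>

context tree_weights
begin

text \<open>Setting the parameters outside \<open>R\<close> to zero leaves the tree series of the
  smaller vertex set.\<close>

lemma rescale_Y:
  assumes "R \<subseteq> S"
  shows "rescale (\<lambda>k. if k \<in> R then 1 else 0) (Y k) = tree_weights.Y R w k"
proof (rule eps_eqI)
  interpret R: tree_weights R w
    using assms fin finite_subset w_sym by unfold_locales auto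
  fix A :: "nat set" assume A: "finite A"
  have "(\<Prod>k\<in>A. if k \<in> R then 1 else 0 :: complex) = (if A \<subseteq> R then 1 else 0)"
  proof (cases "A \<subseteq> R")
    case True
    then show ?thesis by (auto intro!: prod.neutral)
  next
    case False
    then show ?thesis using A by (auto simp: prod_zero_iff)
  qed
  then show "ecoeff (rescale (\<lambda>k. if k \<in> R then 1 else 0) (Y k)) A = ecoeff (R.Y k) A"
    using assms by (auto simp: ecoeff_rescale ecoeff_Y R.ecoeff_Y T_def R.T_def)
qed

lemma ecoeff_E_restrict:
  assumes "R \<subseteq> S"
  shows "ecoeff (E c) R = ecoeff (tree_weights.E R w c) R"
proof -
  interpret R: tree_weights R w
    using assms fin finite_subset w_sym by unfold_locales auto
  let ?r = "rescale (\<lambda>k. if k \<in> R then 1 else 0)"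
  have "R.Y k = 0" if "k \<notin> R" for k
    using that by (intro eps_eqI) (auto simp: R.ecoeff_Y)
  then have "?r (E c) = R.E c"
    using assms fin unfolding E_def R.E_def
    by (auto simp: rescale_prod rescale_add rescale_mult rescale_Y
        intro!: prod.mono_neutral_right)
  then have "ecoeff (R.E c) R = ecoeff (?r (E c)) R" by simp
  then show ?thesis by (simp add: ecoeff_rescale)
qed

end

text \<open>
  By the matrix-tree theorem both coefficients are determinants of weighted Laplacians
  \<open>M\<close> and \<open>D M D\<close> with \<open>D\<close> diagonal. In the induction, the diagonal is split so that the first
  part has the null vector \<open>n\<close>.
\<close>

lemma ecoeff_E_gauge:
  assumes "tree_weights S w" and "tree_weights S w'"
    and "\<And>i j. w' i j = n i * w i j * n j" and "\<And>i. i \<in> S \<Longrightarrow> n i \<noteq> 0"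
    and "\<And>i. i \<in> S \<Longrightarrow>
      c' i + (\<Sum>m\<in>S. w' i m) = (n i)\<^sup>2 * (c i + (\<Sum>m\<in>S. w i m))"
  shows "ecoeff (tree_weights.E S w' c') S =
    (\<Prod>k\<in>S. (n k)\<^sup>2) * ecoeff (tree_weights.E S w c) S"
proof -
  have "finite S" using assms(1) by (simp add: tree_weights_def)
  then show ?thesis using assms
  proof (induction S arbitrary: c c' rule: finite_psubset_induct)
    case (psubset S)
    interpret tree_weights S w by fact
    interpret P: tree_weights S w' by fact
    note w' = psubset.prems(3) and n = psubset.prems(4) and cc' = psubset.prems(5)
    show ?case
    proof (cases "S = {}")
      case True
      then show ?thesis using ecoeff_E_empty P.ecoeff_E_empty by simp
    next
      case False
      then obtain l where l: "l \<in> S" by blast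
      \<comment> \<open>\<open>c0\<close> is the diagonal for which \<open>n\<close> is a null
        vector; conjugation takes it to the zero diagonal for \<open>w'\<close>. Hence
        \<open>c\<close> and \<open>c'\<close> deviate from these two by \<open>e\<close> and by the
        square of \<open>n\<close> times \<open>e\<close>.\<close>
      define c0 where "c0 i = (\<Sum>m\<in>S. w i m * n m) / n i - (\<Sum>m\<in>S. w i m)" for i
      define e where "e i = c i - c0 i" for i
      have row: "(\<Sum>m\<in>S. w' i m) = n i * (\<Sum>m\<in>S. w i m * n m)" for i
        by (simp add: w' sum_distrib_left mult_ac)
      have c': "c' i = (n i)\<^sup>2 * e i" if "i \<in> S" for i
      proof -
        have "(n i)\<^sup>2 * ((\<Sum>m\<in>S. w i m * n m) / n i) = n i * (\<Sum>m\<in>S. w i m * n m)"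
          using n[OF that] by (simp add: power2_eq_square)
        then have "(n i)\<^sup>2 * e i =
            (n i)\<^sup>2 * (c i + (\<Sum>m\<in>S. w i m)) - n i * (\<Sum>m\<in>S. w i m * n m)"
          by (simp only: e_def c0_def right_diff_distrib distrib_left) simp
        then show ?thesis using cc'[OF that] unfolding row by (metis add_diff_cancel_right')
      qed
      have null: "lap c0 n m = 0" if "m \<in> S" for m
        using n[OF that]
        by (simp add: lap_def c0_def right_diff_distrib sum_subtractf
            left_diff_distrib sum_distrib_right[symmetric])
      \<comment> \<open>As both reference diagonals are degenerate, the term of the empty set
        vanishes on either side, and the other terms concern proper subsets, where the induction
        hypothesis applies.\<close>
      have Ezero: "ecoeff (E c0) S = 0"
        by (rule ecoeff_E_eq_0[of l n]) (use l n null in auto)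
      have PEzero: "ecoeff (P.E (\<lambda>k. 0)) S = 0"
        using False by (simp add: ecoeff_one)
      have "ecoeff (P.E c') S = ecoeff (P.E (\<lambda>k. 0 + (n k)\<^sup>2 * e k)) S"
        using c' by (simp add: P.E_def)
      also have "\<dots> = (\<Sum>A\<in>Pow S. (\<Prod>k\<in>A. (n k)\<^sup>2 * e k) *
          ecoeff (P.E (\<lambda>k. 0 + (\<Sum>l\<in>A. w' l k))) (S - A))"
        by (rule P.ecoeff_E_add) simp
      also have "\<dots> = (\<Sum>A\<in>Pow S. (\<Prod>k\<in>S. (n k)\<^sup>2) * ((\<Prod>k\<in>A. e k) *
          ecoeff (E (\<lambda>k. c0 k + (\<Sum>l\<in>A. w l k))) (S - A)))"
      proof (rule sum.cong)
        fix A assume "A \<in> Pow S"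
        then have A: "A \<subseteq> S" by simp
        show "(\<Prod>k\<in>A. (n k)\<^sup>2 * e k) * ecoeff (P.E (\<lambda>k. 0 + (\<Sum>l\<in>A. w' l k))) (S - A) =
          (\<Prod>k\<in>S. (n k)\<^sup>2) * ((\<Prod>k\<in>A. e k) *
          ecoeff (E (\<lambda>k. c0 k + (\<Sum>l\<in>A. w l k))) (S - A))"
        proof (cases "A = {}")
          case True
          then show ?thesis using Ezero PEzero by simp
        next
          case nonempty: False
          have tw: "tree_weights (S - A) w" "tree_weights (S - A) w'"
            using fin w_sym P.w_sym by unfold_locales auto
          have split: "(\<Sum>l\<in>A. f l) + (\<Sum>m\<in>S - A. f m) = sum f S" for f :: "nat \<Rightarrow> complex"
            using sum.subset_diff[OF A fin, of f] by (simp add: add.commute)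
          have "ecoeff (tree_weights.E (S - A) w' (\<lambda>k. 0 + (\<Sum>l\<in>A. w' l k))) (S - A) =
            (\<Prod>k\<in>S - A. (n k)\<^sup>2) *
            ecoeff (tree_weights.E (S - A) w (\<lambda>k. c0 k + (\<Sum>l\<in>A. w l k))) (S - A)"
          proof (rule psubset.IH[OF _ tw])
            show "S - A \<subset> S" using A nonempty by auto
            \<comment> \<open>The edges between \<open>S - A\<close> and \<open>A\<close> have moved
              into the diagonal, so both sides are made of full row sums over
              \<open>S\<close>.\<close>
            show "0 + (\<Sum>l\<in>A. w' l i) + (\<Sum>m\<in>S - A. w' i m) =
              (n i)\<^sup>2 * (c0 i + (\<Sum>l\<in>A. w l i) + (\<Sum>m\<in>S - A. w i m))" if "i \<in> S - A" for i
            proof -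
              have "0 + (\<Sum>l\<in>A. w' l i) + (\<Sum>m\<in>S - A. w' i m) = (\<Sum>m\<in>S. w' i m)"
                using split[of "w' i"] by (simp add: P.w_sym[of _ i])
              moreover have "c0 i + (\<Sum>l\<in>A. w l i) + (\<Sum>m\<in>S - A. w i m) =
                  c0 i + (\<Sum>m\<in>S. w i m)"
                using split[of "w i"] by (simp add: w_sym[of _ i] add.assoc)
              moreover have "(n i)\<^sup>2 * (c0 i + (\<Sum>m\<in>S. w i m)) =
                  n i * (\<Sum>m\<in>S. w i m * n m)"
                using n[of i] that by (simp add: c0_def power2_eq_square)
              ultimately show ?thesis unfolding row by (simp only:)
            qed
          qed (use n w' in auto)
          moreover have "(\<Prod>k\<in>S. (n k)\<^sup>2) = (\<Prod>k\<in>S - A. (n k)\<^sup>2) * (\<Prod>k\<in>A. (n k)\<^sup>2)"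
            by (rule prod.subset_diff[OF A fin])
          ultimately show ?thesis
            by (simp add: ecoeff_E_restrict P.ecoeff_E_restrict prod.distrib mult_ac)
        qed
      qed simp
      also have "\<dots> = (\<Prod>k\<in>S. (n k)\<^sup>2) * ecoeff (E (\<lambda>k. c0 k + e k)) S"
        by (subst ecoeff_E_add[OF order_refl]) (simp only: sum_distrib_left)
      finally show ?thesis by (simp add: e_def)
    qed
  qed
qed

section \<open>First and second minors in the presence of a null vector\<close>

section \<open>Minors of a degenerate Laplacian\<close>

locale null_vector = tree_weights +
  fixes c n :: "nat \<Rightarrow> complex"
  assumes n_nonzero: "k \<in> S \<Longrightarrow> n k \<noteq> 0"
    and lap_n: "m \<in> S \<Longrightarrow> lap c n m = 0"
begin

text \<open>The common constant in the first minors, which are \<open>n k * n l\<close> times it,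
  given as a tree sum for the conjugated weights.\<close>

definition cofactor :: complex where
  "cofactor = tree_sum (\<lambda>e. n (Min e) * w (Min e) (Max e) * n (Max e)) S / (\<Prod>k\<in>S. (n k)\<^sup>2)"

text \<open>Since \<open>Z k k = Y k\<close>, this is a principal minor on \<open>S - {k}\<close>.
  The null vector equation supplies the row sums required by \<open>ecoeff_E_gauge\<close>; after
  conjugation the minor is the sum over the trees on \<open>S\<close>, with \<open>k\<close> as
  root.\<close>

lemma minor_diag:
  assumes k: "k \<in> S"
  shows "ecoeff (Z k k * E c) S = n k * n k * cofactor"
proof -
  define w' where "w' i j = n i * w i j * n j" for i j
  interpret P: tree_weights S w'
    using fin by unfold_locales (auto simp: w'_def w_sym mult_ac)
  let ?R = "S - {k}"
  have S: "S = insert k ?R" using k by auto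
  have split: "sum f S = f k + sum f ?R" for f :: "nat \<Rightarrow> complex"
    using fin k by (rule sum.remove)
  have "ecoeff (Z k k * E c) S = ecoeff (E (\<lambda>j. w k j + c j)) ?R"
    using k fin by (simp add: Z_diag Y_eq mult.assoc E_mult ecoeff_eps_mult)
  moreover have "P.T S = ecoeff (P.E (w' k)) ?R"
    using k P.ecoeff_E_weights[of ?R k] by (simp add: insert_absorb)
  moreover have "ecoeff (P.E (w' k)) ?R = (\<Prod>k\<in>?R. (n k)\<^sup>2) * ecoeff (E (\<lambda>j. w k j + c j)) ?R"
  proof -
    have "ecoeff (tree_weights.E ?R w' (w' k)) ?R =
      (\<Prod>k\<in>?R. (n k)\<^sup>2) * ecoeff (tree_weights.E ?R w (\<lambda>j. w k j + c j)) ?R"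
    proof (rule ecoeff_E_gauge)
      show "tree_weights ?R w" "tree_weights ?R w'"
        using fin w_sym P.w_sym by unfold_locales auto
      fix i assume i: "i \<in> ?R"
      have "n i * (c i + (\<Sum>m\<in>S. w i m)) - (\<Sum>m\<in>S. w i m * n m) = lap c n i"
        by (simp add: lap_def algebra_simps sum_subtractf sum_distrib_left)
      then have "(\<Sum>m\<in>S. w i m * n m) = n i * (c i + (\<Sum>m\<in>S. w i m))"
        using lap_n[of i] i by simp
      then have "(\<Sum>m\<in>S. w' i m) = (n i)\<^sup>2 * (c i + (\<Sum>m\<in>S. w i m))"
        by (simp add: w'_def power2_eq_square mult.assoc sum_distrib_left[symmetric])
      then show "w' k i + (\<Sum>m\<in>?R. w' i m) = (n i)\<^sup>2 * (w k i + c i + (\<Sum>m\<in>?R. w i m))"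
        using w_sym[of k i] P.w_sym[of k i] by (simp add: split algebra_simps)
    qed (use n_nonzero in \<open>auto simp: w'_def\<close>)
    then show ?thesis by (simp add: ecoeff_E_restrict P.ecoeff_E_restrict)
  qed
  moreover have "cofactor = P.T S / ((n k)\<^sup>2 * (\<Prod>k\<in>?R. (n k)\<^sup>2))"
    using prod.remove[OF fin k, of "\<lambda>k. (n k)\<^sup>2"] by (simp add: cofactor_def P.T_def w'_def)
  moreover have "(\<Prod>k\<in>?R. (n k)\<^sup>2) \<noteq> 0" "n k \<noteq> 0"
    using fin n_nonzero k by auto
  ultimately show ?thesis by (simp add: power2_eq_square)
qed

text \<open>For a null vector \<open>ward2\<close> expresses \<open>n l\<close> times the
  coefficient of \<open>Z p q * E c\<close> by \<open>tri n l p q\<close>, which is symmetric in the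
  three indices. This trades an off-diagonal minor for a diagonal one.\<close>

lemma minor:
  assumes "k \<in> S" "l \<in> S"
  shows "ecoeff (Z k l * E c) S = n k * n l * cofactor"
proof -
  have "n l * ecoeff (Z k k * E c) S = ecoeff (tri n l k k * E c) S"
    "n k * ecoeff (Z l k * E c) S = ecoeff (tri n k l k * E c) S"
    using ward2[of l c n k k] ward2[of k c n l k] assms by (simp_all add: lap_n)
  then have "n k * ecoeff (Z l k * E c) S = n l * ecoeff (Z k k * E c) S"
    by (simp add: tri_sym(1))
  then have "n k * ecoeff (Z k l * E c) S = n k * (n k * n l * cofactor)"
    unfolding minor_diag[OF assms(1)] Z_sym[of l k] by (simp add: mult_ac)
  then show ?thesis using n_nonzero[OF assms(1)] by simp
qed

lemma ecoeff_E_top: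
  assumes "S \<noteq> {}"
  shows "ecoeff (E c) S = 0"
proof -
  obtain l where "l \<in> S" using assms by blast
  then show ?thesis using ecoeff_E_eq_0[of l n] n_nonzero lap_n by blast
qed

text \<open>
  Antisymmetrizing \<open>ward3\<close> for the null vector over \<open>l, p, q\<close> removes the \<open>tri\<close> terms.
\<close>

lemma second_minor:
  fixes \<alpha> \<beta> g :: "nat \<Rightarrow> complex"
  assumes k: "k \<in> S" "k' \<in> S"
    and g: "\<And>m. m \<in> S \<Longrightarrow>
      lap c g m = \<alpha> m * (\<Sum>l\<in>S. \<beta> l * n l) - \<beta> m * (\<Sum>l\<in>S. \<alpha> l * n l)"
  shows "(\<Sum>p\<in>S. \<Sum>q\<in>S. (\<alpha> p * \<beta> q - \<beta> p * \<alpha> q) * ecoeff (Z k p * Z k' q * E c) S) =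
    cofactor * (g k * n k' - g k' * n k)"
proof -
  define br where "br p q = \<alpha> p * \<beta> q - \<beta> p * \<alpha> q" for p q
  define X where "X p q = ecoeff (Z k p * Z k' q * E c) S" for p q
  define a where "a l p q = ecoeff (tri n l k p * Z k' q * E c) S" for l p q
  define b where "b l p q = ecoeff (Z k p * tri n l k' q * E c) S" for l p q
  have br: "br q p = - br p q" for p q by (simp add: br_def)
  have sym_sum: "(\<Sum>p\<in>S. \<Sum>q\<in>S. br p q * f p q) = 0"
    if "\<And>p q. f p q = f q p" for f
  proof -
    have "(\<Sum>p\<in>S. \<Sum>q\<in>S. br p q * f p q) = (\<Sum>p\<in>S. \<Sum>q\<in>S. br q p * f q p)"
      by (rule sum.swap)
    also have "\<dots> = - (\<Sum>p\<in>S. \<Sum>q\<in>S. br p q * f p q)"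
      unfolding sum_negf[symmetric] by (intro sum.cong refl) (metis br that mult_minus_left)
    finally show ?thesis by simp
  qed
  have a_sym: "a l p q = a p l q" and b_sym: "b l p q = b q p l" for l p q
    unfolding a_def b_def by (simp_all add: tri_sym)
  have X: "n l * X p q = a l p q + b l p q" if "l \<in> S" for l p q
    using ward3[OF that, of c n k p k' q] by (simp add: lap_n X_def a_def b_def)
  obtain l where l: "l \<in> S" using k by blast
  \<comment> \<open>Contracting the antisymmetric \<open>br\<close> with \<open>n\<close> produces
    the Laplacian of \<open>g\<close>, so that \<open>ward2\<close> for \<open>g\<close> becomes
    applicable.\<close>
  have brQ: "(\<Sum>p\<in>S. br p q * n p) = - lap c g q" if "q \<in> S" for q
    unfolding g[OF that] br_def by (simp add: algebra_simps sum_subtractf sum_distrib_left)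
  have brQ': "(\<Sum>q\<in>S. br p q * n q) = lap c g p" if "p \<in> S" for p
    unfolding g[OF that] br_def by (simp add: algebra_simps sum_subtractf sum_distrib_left)
  have "n l * (\<Sum>p\<in>S. \<Sum>q\<in>S. br p q * X p q) = (\<Sum>p\<in>S. \<Sum>q\<in>S. br p q * (n p * X l q))
      + (\<Sum>p\<in>S. \<Sum>q\<in>S. br p q * (n q * X p l))
      - (\<Sum>p\<in>S. \<Sum>q\<in>S. br p q * b p l q) - (\<Sum>p\<in>S. \<Sum>q\<in>S. br p q * a q p l)"
    unfolding sum_distrib_left sum.distrib[symmetric] sum_subtractf[symmetric]
  proof (intro sum.cong refl)
    fix p q assume "p \<in> S" "q \<in> S"
    \<comment> \<open>Three instances of the null vector identity. The leftover
      \<open>b p l q\<close> and \<open>a q p l\<close> are symmetric in \<open>p\<close> and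
      \<open>q\<close> and vanish against \<open>br\<close>.\<close>
    then have "n l * X p q = n p * X l q + n q * X p l - b p l q - a q p l"
      using X[OF l, of p q] X[of p l q] X[of q p l] a_sym[of p l q] b_sym[of q p l] by simp
    then show "n l * (br p q * X p q) = br p q * (n p * X l q) + br p q * (n q * X p l)
        - br p q * b p l q - br p q * a q p l"
      by (metis mult.left_commute right_diff_distrib distrib_left)
  qed
  also have "(\<Sum>p\<in>S. \<Sum>q\<in>S. br p q * b p l q) = 0"
    by (rule sym_sum) (rule b_sym)
  also have "(\<Sum>p\<in>S. \<Sum>q\<in>S. br p q * a q p l) = 0"
    by (rule sym_sum) (rule a_sym)
  also have "(\<Sum>p\<in>S. \<Sum>q\<in>S. br p q * (n p * X l q)) = - (\<Sum>q\<in>S. lap c g q * X l q)"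
    by (subst sum.swap) (simp add: mult.assoc[symmetric] sum_distrib_right[symmetric] brQ sum_negf)
  also have "(\<Sum>p\<in>S. \<Sum>q\<in>S. br p q * (n q * X p l)) = (\<Sum>p\<in>S. lap c g p * X p l)"
    by (simp add: mult.assoc[symmetric] sum_distrib_right[symmetric] brQ')
  also have "(\<Sum>q\<in>S. lap c g q * X l q) =
      g k' * ecoeff (Z k l * E c) S - ecoeff (tri g k' k l * E c) S"
    using ward2[OF k(2), of c g k l] by (simp add: X_def Z_sym[of k'] mult_ac)
  also have "(\<Sum>p\<in>S. lap c g p * X p l) =
      g k * ecoeff (Z k' l * E c) S - ecoeff (tri g k k' l * E c) S"
    using ward2[OF k(1), of c g k' l] by (simp add: X_def Z_sym[of k] mult_ac)
  \<comment> \<open>The two remaining \<open>tri\<close> terms coincide and cancel in the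
    difference.\<close>
  also have "tri g k' k l = tri g k k' l" by (rule tri_sym)
  finally have "n l * (\<Sum>p\<in>S. \<Sum>q\<in>S. br p q * X p q) =
      n l * (cofactor * (g k * n k' - g k' * n k))"
    unfolding minor[OF k(1) l] minor[OF k(2) l] by (simp add: algebra_simps)
  then show ?thesis using n_nonzero[OF l] by (simp add: br_def X_def)
qed

end

context null_vector
begin

text \<open>Expansion by the number of \<open>mark\<close> factors: none gives the determinant,
  which vanishes; one gives first minors; two, antisymmetrized, give the second minors.\<close>

lemma bracket_top:
  fixes a b \<alpha> \<beta> g :: "nat \<Rightarrow> complex" and x1 x2 y1 y2 :: complex
  assumes S: "S \<noteq> {}"
    and g: "\<And>m. m \<in> S \<Longrightarrow>
      lap c g m = \<alpha> m * (\<Sum>l\<in>S. \<beta> l * n l) - \<beta> m * (\<Sum>l\<in>S. \<alpha> l * n l)"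
  defines "pair f h \<equiv> \<Sum>k\<in>S. f k * h k"
    and "mark f h \<equiv> \<Sum>k\<in>S. \<Sum>l\<in>S. cst (f k * h l) * Z k l"
  shows "ecoeff (((cst x1 + mark a \<alpha>) * (cst y2 + mark b \<beta>)
      - (cst x2 + mark a \<beta>) * (cst y1 + mark b \<alpha>)) * E c) S =
    cofactor * (pair b n * (x1 * pair \<beta> n - x2 * pair \<alpha> n)
      + pair a n * (y2 * pair \<alpha> n - y1 * pair \<beta> n)
      + pair a g * pair b n - pair b g * pair a n)"
proof -
  have one: "ecoeff (mark f h * E c) S = pair f n * pair h n * cofactor" for f h
  proof -
    have "ecoeff (mark f h * E c) S = (\<Sum>k\<in>S. \<Sum>l\<in>S. f k * h l * ecoeff (Z k l * E c) S)"
      by (simp add: mark_def sum_distrib_right ecoeff_sum mult.assoc ecoeff_cst_mult)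
    also have "\<dots> = (\<Sum>k\<in>S. \<Sum>l\<in>S. (f k * n k) * (h l * n l) * cofactor)"
      by (intro sum.cong refl) (simp add: minor)
    finally show ?thesis
      unfolding pair_def by (simp only: sum_distrib_right[symmetric] sum_product[symmetric])
  qed
  have two: "ecoeff ((mark a \<alpha> * mark b \<beta> - mark a \<beta> * mark b \<alpha>) * E c) S =
      cofactor * (pair a g * pair b n - pair b g * pair a n)"
  proof -
    have mm: "mark a f * mark b h = (\<Sum>k\<in>S. \<Sum>k'\<in>S. \<Sum>p\<in>S. \<Sum>q\<in>S.
        cst (a k * b k' * (f p * h q)) * (Z k p * Z k' q))" for f h
    proof -
      have "mark a f * mark b h = (\<Sum>k\<in>S. \<Sum>k'\<in>S. (\<Sum>p\<in>S. cst (a k * f p) * Z k p) *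
          (\<Sum>q\<in>S. cst (b k' * h q) * Z k' q))"
        unfolding mark_def sum_product ..
      also have "\<dots> = (\<Sum>k\<in>S. \<Sum>k'\<in>S. \<Sum>p\<in>S. \<Sum>q\<in>S.
          cst (a k * b k' * (f p * h q)) * (Z k p * Z k' q))"
        unfolding sum_product by (intro sum.cong refl) (simp add: cst_mult mult_ac)
      finally show ?thesis .
    qed
    have "ecoeff ((mark a \<alpha> * mark b \<beta> - mark a \<beta> * mark b \<alpha>) * E c) S =
      (\<Sum>k\<in>S. \<Sum>k'\<in>S. \<Sum>p\<in>S. \<Sum>q\<in>S. a k * b k' * (\<alpha> p * \<beta> q - \<beta> p * \<alpha> q) *
          ecoeff (Z k p * Z k' q * E c) S)"
      unfolding mm sum_subtractf[symmetric] sum_distrib_right ecoeff_sum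
      by (intro sum.cong refl)
        (simp add: left_diff_distrib right_diff_distrib mult.assoc ecoeff_cst_mult)
    also have "\<dots> = (\<Sum>k\<in>S. \<Sum>k'\<in>S. a k * b k' * (\<Sum>p\<in>S. \<Sum>q\<in>S.
        (\<alpha> p * \<beta> q - \<beta> p * \<alpha> q) * ecoeff (Z k p * Z k' q * E c) S))"
      by (simp add: sum_distrib_left mult.assoc)
    also have "\<dots> = (\<Sum>k\<in>S. \<Sum>k'\<in>S. a k * b k' * (cofactor * (g k * n k' - g k' * n k)))"
      by (intro sum.cong refl) (simp add: second_minor[OF _ _ g])
    also have "\<dots> = cofactor * ((\<Sum>k\<in>S. \<Sum>k'\<in>S. (a k * g k) * (b k' * n k'))
        - (\<Sum>k\<in>S. \<Sum>k'\<in>S. (a k * n k) * (b k' * g k')))"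
      by (simp add: sum_distrib_left sum_subtractf[symmetric] algebra_simps)
    finally show ?thesis by (simp add: pair_def sum_product[symmetric] mult.commute)
  qed
  have "((cst x1 + mark a \<alpha>) * (cst y2 + mark b \<beta>)
      - (cst x2 + mark a \<beta>) * (cst y1 + mark b \<alpha>)) * E c =
    cst (x1 * y2 - x2 * y1) * E c
      + (cst x1 * (mark b \<beta> * E c) - cst x2 * (mark b \<alpha> * E c))
      + (cst y2 * (mark a \<alpha> * E c) - cst y1 * (mark a \<beta> * E c))
      + (mark a \<alpha> * mark b \<beta> - mark a \<beta> * mark b \<alpha>) * E c"
    by (simp add: cst_diff cst_mult algebra_simps)
  then show ?thesis
    using ecoeff_E_top[OF S]
    by (simp only: ecoeff_add ecoeff_diff ecoeff_cst_mult one two) (simp add: algebra_simps)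
qed

end

section \<open>The Laplacian on the support of momentum conservation\<close>

section \<open>Momentum conservation\<close>

definition wt :: "(nat \<Rightarrow> complex) \<Rightarrow> (nat \<Rightarrow> complex) \<Rightarrow> (nat \<Rightarrow> complex) \<Rightarrow> nat \<Rightarrow> nat \<Rightarrow> complex"
  where "wt \<omega> z zb i j = sq \<omega> zb i j / ang z i j"

lemma wt_sym: "wt \<omega> z zb i j = wt \<omega> z zb j i"
  using edge_weight_pair[of \<omega> z zb i j] edge_weight_pair[of \<omega> z zb j i]
  by (simp add: wt_def insert_commute)

locale scattering =
  fixes N :: nat and \<omega> z zb :: "nat \<Rightarrow> complex"
  assumes N: "N \<ge> 1" and inj_z: "inj_on z {1..N + 2}"
begin

abbreviation "I \<equiv> N + 1"
abbreviation "J \<equiv> N + 2"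
abbreviation "w \<equiv> wt \<omega> z zb"
abbreviation "kt \<equiv> kapt \<omega> zb"

sublocale tree_weights "{1..N}" w
  by unfold_locales (auto simp: wt_sym)

abbreviation "roots k \<equiv> w I k + w J k"

definition mark :: "(nat \<Rightarrow> complex) \<Rightarrow> (nat \<Rightarrow> complex) \<Rightarrow> eps_alg" where
  "mark f h = (\<Sum>k=1..N. \<Sum>l=1..N. cst (f k * h l) * Z k l)"

text \<open>
  The contraction of \<open>\<xi>\<close> with the components of \<open>H\<close>, up to the rescaling of the parameters
  \<open>\<epsilon>\<^sub>k\<close> by plane waves.
\<close>

definition dF :: "nat \<Rightarrow> spinor \<Rightarrow> 2 \<Rightarrow> eps_alg" where
  "dF L \<xi> A = cst (\<xi> A) + mark (\<lambda>k. sqs \<xi> (kt k) / ang z L k) (\<lambda>l. kt l A)"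

text \<open>Up to sign, the Poisson bracket of the two contracted functions times both exponentials,
  \<open>E (w I) * E (w J) = E roots\<close>, with the plane waves stripped off.\<close>

definition reduced :: "spinor \<Rightarrow> spinor \<Rightarrow> complex" where
  "reduced \<xi> \<eta> =
     ecoeff ((dF I \<xi> 1 * dF J \<eta> 2 - dF I \<xi> 2 * dF J \<eta> 1) * E roots) {1..N}"

lemma z_neq: "i \<in> {1..N + 2} \<Longrightarrow> j \<in> {1..N + 2} \<Longrightarrow> i \<noteq> j \<Longrightarrow> z i \<noteq> z j"
  using inj_z by (auto dest: inj_onD)

lemma sum_all: "(\<Sum>i=1..N + 2. f i) = (\<Sum>i=1..N. f i) + f I + (f J :: complex)"
  by simp

text \<open>As \<open>f\<close> vanishes at \<open>I\<close> and \<open>J\<close>, the diagonal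
  entries are the terms of \<open>I\<close> and \<open>J\<close> in a sum over all particles. The
  divided difference \<open>h\<close> cancels the denominators.\<close>

lemma lap_eq_sum_all:
  assumes m: "m \<in> {1..N}" and f: "f I = 0" "f J = 0"
    and h: "\<And>k. f m - f k = (z m - z k) * h k"
  shows "lap roots f m = (\<Sum>k=1..N + 2. sq \<omega> zb m k * h k)"
proof -
  have "w m k * (f m - f k) = sq \<omega> zb m k * h k" if "k \<in> {1..N + 2}" for k
  proof (cases "k = m")
    case False
    then show ?thesis using z_neq[of m k] m that by (simp add: h wt_def ang_def)
  qed (simp add: sq_def)
  then have "(\<Sum>k=1..N + 2. sq \<omega> zb m k * h k) = (\<Sum>k=1..N + 2. w m k * (f m - f k))"
    by (intro sum.cong) simp_all
  then show ?thesis
    unfolding sum_all lap_def f by (simp add: wt_sym[of _ _ _ m] algebra_simps)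
qed

context
  assumes kt0: "\<And>A. (\<Sum>i=1..N + 2. kt i A) = 0"
    and kt1: "\<And>A. (\<Sum>i=1..N + 2. z i * kt i A) = 0"
begin

abbreviation "n a \<equiv> ang z a I * ang z a J"

text \<open>Momentum conservation kills the moments of degree zero and one in
  \<open>z\<close>.\<close>

lemma sum_sqs_quadratic:
  "(\<Sum>k=1..N + 2. sqs \<xi> (kt k) * (a + b * z k + d * (z k)\<^sup>2)) =
    d * (\<Sum>k=1..N + 2. sqs \<xi> (kt k) * (z k)\<^sup>2)"
proof -
  have "(\<Sum>k=1..N + 2. sqs \<xi> (kt k) * (a + b * z k + d * (z k)\<^sup>2)) =
    a * (\<xi> 1 * (\<Sum>k=1..N + 2. kt k 2) - \<xi> 2 * (\<Sum>k=1..N + 2. kt k 1))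
    + b * (\<xi> 1 * (\<Sum>k=1..N + 2. z k * kt k 2) - \<xi> 2 * (\<Sum>k=1..N + 2. z k * kt k 1))
    + d * (\<Sum>k=1..N + 2. sqs \<xi> (kt k) * (z k)\<^sup>2)"
    unfolding sum_distrib_left sum_subtractf[symmetric] sum.distrib[symmetric]
    by (intro sum.cong refl) (simp add: sqs_def algebra_simps)
  then show ?thesis by (simp only: kt0 kt1) simp
qed

text \<open>\<open>n\<close> is a monic quadratic polynomial in \<open>z\<close> with roots at
  \<open>I\<close> and \<open>J\<close>: the sum extends to all particles, and only the leading term
  survives.\<close>

lemma sum_kt_n: "(\<Sum>l=1..N. kt l A * n l) = (\<Sum>l=1..N + 2. kt l A * (z l)\<^sup>2)"
proof -
  have "(\<Sum>l=1..N. kt l A * n l) = (\<Sum>l=1..N + 2. kt l A * n l)"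
    unfolding sum_all by (simp add: ang_def)
  also have "\<dots> = (\<Sum>l=1..N + 2. kt l A * (z l)\<^sup>2) - (z I + z J) * (\<Sum>l=1..N + 2. z l * kt l A)
      + z I * z J * (\<Sum>l=1..N + 2. kt l A)"
    unfolding sum_distrib_left sum_subtractf[symmetric] sum.distrib[symmetric]
    by (intro sum.cong refl) (simp add: ang_def power2_eq_square algebra_simps)
  finally show ?thesis by (simp only: kt0 kt1) simp
qed

lemma sqs_sum_kt_n:
  "(\<Sum>k=1..N + 2. sqs \<xi> (kt k) * (z k)\<^sup>2) =
    \<xi> 1 * (\<Sum>l=1..N. kt l 2 * n l) - \<xi> 2 * (\<Sum>l=1..N. kt l 1 * n l)"
  unfolding sum_kt_n sum_distrib_left sum_subtractf[symmetric]
  by (intro sum.cong refl) (simp add: sqs_def algebra_simps)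

text \<open>The divided difference of the quadratic \<open>n\<close> has degree one in
  \<open>z k\<close>, so its moment vanishes.\<close>

lemma lap_n:
  assumes m: "m \<in> {1..N}"
  shows "lap roots n m = 0"
proof -
  have "lap roots n m = (\<Sum>k=1..N + 2. sq \<omega> zb m k * (z m + z k - z I - z J))"
    by (rule lap_eq_sum_all[OF m]) (simp_all add: ang_def algebra_simps)
  also have "\<dots> =
      (\<Sum>k=1..N + 2. sqs (kt m) (kt k) * ((z m - z I - z J) + 1 * z k + 0 * (z k)\<^sup>2))"
    by (intro sum.cong refl) (simp add: sq_kapt)
  finally show ?thesis unfolding sum_sqs_quadratic by simp
qed

text \<open>The divided difference of the cubic \<open>n a * z a\<close> is quadratic in
  \<open>z k\<close> with leading coefficient one.\<close>

lemma lap_n_z: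
  assumes m: "m \<in> {1..N}"
  shows "lap roots (\<lambda>a. n a * z a) m =
    kt m 1 * (\<Sum>l=1..N. kt l 2 * n l) - kt m 2 * (\<Sum>l=1..N. kt l 1 * n l)"
proof -
  have "lap roots (\<lambda>a. n a * z a) m = (\<Sum>k=1..N + 2. sq \<omega> zb m k *
      ((z m)\<^sup>2 + z m * z k + (z k)\<^sup>2 - (z I + z J) * (z m + z k) + z I * z J))"
    by (rule lap_eq_sum_all[OF m]) (simp_all add: ang_def power2_eq_square algebra_simps)
  also have "\<dots> = (\<Sum>k=1..N + 2. sqs (kt m) (kt k) *
      (((z m)\<^sup>2 - (z I + z J) * z m + z I * z J) + (z m - z I - z J) * z k + 1 * (z k)\<^sup>2))"
    by (intro sum.cong refl) (simp add: sq_kapt algebra_simps)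
  finally show ?thesis unfolding sum_sqs_quadratic sqs_sum_kt_n by simp
qed

text \<open>\<open>ang z L k\<close> divides \<open>n k\<close> and leaves
  \<open>- (z k - z L')\<close>. In the sum over all particles the term of \<open>L'\<close>
  vanishes, that of \<open>L\<close> is moved across, and the total follows from
  \<open>sum_sqs_quadratic\<close>.\<close>

lemma root_sums:
  assumes L: "L = I \<and> L' = J \<or> L = J \<and> L' = I"
  shows "(\<Sum>k=1..N. sqs \<xi> (kt k) / ang z L k * n k) = sqs \<xi> (kt L) * ang z L L'"
    and "(\<Sum>k=1..N. sqs \<xi> (kt k) / ang z L k * (n k * z k)) =
      sqs \<xi> (kt L) * ang z L L' * z L - (\<Sum>k=1..N + 2. sqs \<xi> (kt k) * (z k)\<^sup>2)"
proof -
  have cancel: "sqs \<xi> (kt k) / ang z L k * (n k * x) = - (sqs \<xi> (kt k) * (z k - z L') * x)"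
    if "k \<in> {1..N}" for k x
  proof -
    have "z k \<noteq> z L" using z_neq[of k L] L that by auto
    moreover have "n k = (z k - z L) * (z k - z L')" using L by (auto simp: ang_def mult.commute)
    ultimately show ?thesis by (simp add: ang_def divide_simps) (simp add: algebra_simps)
  qed
  have all: "(\<Sum>k=1..N + 2. f k) = (\<Sum>k=1..N. f k) + f L + f L'" for f :: "nat \<Rightarrow> complex"
    using L unfolding sum_all by auto
  have "(\<Sum>k=1..N + 2. sqs \<xi> (kt k) * (z k - z L')) =
      (\<Sum>k=1..N + 2. sqs \<xi> (kt k) * (- z L' + 1 * z k + 0 * (z k)\<^sup>2))"
    by (intro sum.cong refl) simp
  then have "(\<Sum>k=1..N + 2. sqs \<xi> (kt k) * (z k - z L')) = 0"
    unfolding sum_sqs_quadratic by simp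
  then have "(\<Sum>k=1..N. sqs \<xi> (kt k) * (z k - z L')) = - (sqs \<xi> (kt L) * (z L - z L'))"
    unfolding all by (simp add: eq_neg_iff_add_eq_0)
  moreover have "(\<Sum>k=1..N. sqs \<xi> (kt k) / ang z L k * n k) =
      - (\<Sum>k=1..N. sqs \<xi> (kt k) * (z k - z L'))"
    unfolding sum_negf[symmetric] by (intro sum.cong refl) (use cancel[of _ 1] in simp)
  ultimately show "(\<Sum>k=1..N. sqs \<xi> (kt k) / ang z L k * n k) = sqs \<xi> (kt L) * ang z L L'"
    by (simp add: ang_def)
  have "(\<Sum>k=1..N + 2. sqs \<xi> (kt k) * (z k - z L') * z k) =
      (\<Sum>k=1..N + 2. sqs \<xi> (kt k) * (0 + (- z L') * z k + 1 * (z k)\<^sup>2))"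
    by (intro sum.cong refl) (simp add: power2_eq_square algebra_simps)
  then have "(\<Sum>k=1..N + 2. sqs \<xi> (kt k) * (z k - z L') * z k) =
      (\<Sum>k=1..N + 2. sqs \<xi> (kt k) * (z k)\<^sup>2)"
    unfolding sum_sqs_quadratic by simp
  then have "(\<Sum>k=1..N. sqs \<xi> (kt k) * (z k - z L') * z k) =
      (\<Sum>k=1..N + 2. sqs \<xi> (kt k) * (z k)\<^sup>2) - sqs \<xi> (kt L) * (z L - z L') * z L"
    unfolding all[of "\<lambda>k. sqs \<xi> (kt k) * (z k - z L') * z k"] by (simp add: algebra_simps)
  moreover have "(\<Sum>k=1..N. sqs \<xi> (kt k) / ang z L k * (n k * z k)) =
      - (\<Sum>k=1..N. sqs \<xi> (kt k) * (z k - z L') * z k)"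
    unfolding sum_negf[symmetric] by (intro sum.cong refl) (rule cancel)
  ultimately show "(\<Sum>k=1..N. sqs \<xi> (kt k) / ang z L k * (n k * z k)) =
      sqs \<xi> (kt L) * ang z L L' * z L - (\<Sum>k=1..N + 2. sqs \<xi> (kt k) * (z k)\<^sup>2)"
    by (simp add: ang_def)
qed

lemma reduced_eq:
  "reduced \<xi> \<eta> = - (sqs \<xi> (kt I) * sqs \<eta> (kt J) * ang z I J ^ 3
     * (tree_sum (\<lambda>e. n (Min e) * w (Min e) (Max e) * n (Max e)) {1..N} / (\<Prod>k=1..N. (n k)\<^sup>2)))"
proof -
  interpret K: null_vector "{1..N}" w roots n
  proof unfold_locales
    show "n k \<noteq> 0" if "k \<in> {1..N}" for k
      using that z_neq[of k I] z_neq[of k J] by (simp add: ang_def)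
  qed (rule lap_n)
  let ?Q1 = "\<Sum>l=1..N. kt l 1 * n l" and ?Q2 = "\<Sum>l=1..N. kt l 2 * n l"
  have "reduced \<xi> \<eta> = K.cofactor *
     (sqs \<eta> (kt J) * ang z J I * (\<xi> 1 * ?Q2 - \<xi> 2 * ?Q1)
      + sqs \<xi> (kt I) * ang z I J * (\<eta> 2 * ?Q1 - \<eta> 1 * ?Q2)
      + (sqs \<xi> (kt I) * ang z I J * z I - (\<xi> 1 * ?Q2 - \<xi> 2 * ?Q1)) * (sqs \<eta> (kt J) * ang z J I)
      - (sqs \<eta> (kt J) * ang z J I * z J - (\<eta> 1 * ?Q2 - \<eta> 2 * ?Q1)) * (sqs \<xi> (kt I) * ang z I J))"
    unfolding reduced_def dF_def mark_def
    using N by (subst K.bracket_top[OF _ lap_n_z])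
      (simp_all only: root_sums[of I J] root_sums[of J I] sqs_sum_kt_n simp_thms, simp)
  \<comment> \<open>The terms in \<open>?Q1\<close> and \<open>?Q2\<close> cancel; what remains is
    proportional to \<open>z I - z J\<close>, which supplies the third power.\<close>
  also have "\<dots> = - (sqs \<xi> (kt I) * sqs \<eta> (kt J) * ang z I J ^ 3 * K.cofactor)"
    by (simp add: ang_def power3_eq_cube algebra_simps)
  finally show ?thesis unfolding K.cofactor_def .
qed

end

end

section \<open>Exterior products on the four coordinates\<close>

section \<open>Wedge products of one-forms\<close>

definition one_form :: "'a::comm_ring_1 form \<Rightarrow> bool" where
  "one_form a \<longleftrightarrow> (\<forall>S. (\<forall>c. S \<noteq> {c}) \<longrightarrow> a S = 0)"

lemma one_form_dx [simp]: "one_form (dx c)"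
  by (simp add: one_form_def dx_def)

lemma one_form_scale: "one_form a \<Longrightarrow> one_form (\<lambda>S. k * a S)"
  and one_form_add: "one_form a \<Longrightarrow> one_form b \<Longrightarrow> one_form (\<lambda>S. a S + b S)"
  by (auto simp: one_form_def)

lemma one_form_sum: "(\<And>i. i \<in> A \<Longrightarrow> one_form (f i)) \<Longrightarrow> one_form (\<lambda>S. \<Sum>i\<in>A. f i S)"
  by (auto simp: one_form_def intro!: sum.neutral)

lemma wedge_add_left: "((\<lambda>R. a R + b R) \<and>\<^sub>w d) S = (a \<and>\<^sub>w d) S + (b \<and>\<^sub>w d) S"
  and wedge_add_right: "(d \<and>\<^sub>w (\<lambda>R. a R + b R)) S = (d \<and>\<^sub>w a) S + (d \<and>\<^sub>w b) S"
  and wedge_scale_left: "((\<lambda>R. k * a R) \<and>\<^sub>w d) S = k * (a \<and>\<^sub>w d) S"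
  and wedge_scale_right: "(a \<and>\<^sub>w (\<lambda>R. k * d R)) S = k * (a \<and>\<^sub>w d) S"
  by (simp_all add: wedge_def sum.distrib[symmetric] sum_distrib_left algebra_simps)

lemma wedge_zero_right: "(d \<and>\<^sub>w (\<lambda>R. 0)) S = 0"
  by (simp add: wedge_def)

lemma wedge_minus_left: "((\<lambda>R. - a R) \<and>\<^sub>w d) S = - (a \<and>\<^sub>w d) S"
  using wedge_scale_left[of "-1" a d S] by simp

lemma wedge_sum_left: "((\<lambda>R. \<Sum>i\<in>A. f i R) \<and>\<^sub>w d) S = (\<Sum>i\<in>A. (f i \<and>\<^sub>w d) S)"
  unfolding wedge_def sum_distrib_left sum_distrib_right by (rule sum.swap)

text \<open>Only the sets \<open>T\<close> that omit a single element of \<open>S\<close>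
  contribute. The sign is restated as a product over \<open>S\<close>, which simplification can
  evaluate on explicit sets.\<close>

lemma wedge_one_form:
  assumes "one_form b"
  shows "(a \<and>\<^sub>w b) S =
    (\<Sum>c\<in>S. (\<Prod>d\<in>S. if coord_index c < coord_index d then -1 else 1) * a (S - {c}) * b {c})"
proof -
  have sign: "(-1) ^ card {(c', d). c' \<in> S - {c} \<and> d \<in> S - (S - {c}) \<and> coord_index d < coord_index c'}
      = (\<Prod>d\<in>S. if coord_index c < coord_index d then -1 else 1 :: 'a)" if "c \<in> S" for c
  proof -
    have "{(c', d). c' \<in> S - {c} \<and> d \<in> S - (S - {c}) \<and> coord_index d < coord_index c'} =
        {c' \<in> S. coord_index c < coord_index c'} \<times> {c}"
      using that by auto
    moreover have "(\<Prod>d\<in>S. if coord_index c < coord_index d then -1 else 1 :: 'a) =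
        (-1) ^ card {c' \<in> S. coord_index c < coord_index c'}"
      by (subst prod.inter_filter[symmetric]) simp_all
    ultimately show ?thesis by (simp add: card_cartesian_product)
  qed
  let ?f = "\<lambda>T. (-1) ^ card {(c, d). c \<in> T \<and> d \<in> S - T \<and> coord_index d < coord_index c}
       * a T * b (S - T)"
  have "(a \<and>\<^sub>w b) S = sum ?f ((\<lambda>c. S - {c}) ` S)"
    unfolding wedge_def
  proof (rule sum.mono_neutral_right)
    show "\<forall>T\<in>Pow S - (\<lambda>c. S - {c}) ` S. ?f T = 0"
    proof
      fix T assume T: "T \<in> Pow S - (\<lambda>c. S - {c}) ` S"
      have "S - T \<noteq> {c}" for c
      proof
        assume "S - T = {c}"
        then have "T = S - {c}" "c \<in> S" using T by auto
        then show False using T by blast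
      qed
      then show "?f T = 0" using assms by (simp add: one_form_def)
    qed
  qed auto
  also have "\<dots> = (\<Sum>c\<in>S. ?f (S - {c}))"
    by (rule sum.reindex_cong[of "\<lambda>c. S - {c}"]) (auto simp: inj_on_def)
  also have "\<dots> = (\<Sum>c\<in>S. (\<Prod>d\<in>S. if coord_index c < coord_index d then -1 else 1)
      * a (S - {c}) * b {c})"
  proof (rule sum.cong)
    fix c assume c: "c \<in> S"
    have "S - (S - {c}) = {c}" using c by auto
    then show "?f (S - {c}) = (\<Prod>d\<in>S. if coord_index c < coord_index d then -1 else 1)
      * a (S - {c}) * b {c}"
      using sign[OF c] by (simp only:)
  qed simp
  finally show ?thesis .
qed

lemma wedge_one_form_support:
  assumes "one_form b" and a: "\<And>S. card S \<noteq> m \<Longrightarrow> a S = 0" and "card S \<noteq> Suc m"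
  shows "(a \<and>\<^sub>w b) S = 0"
  unfolding wedge_one_form[OF assms(1)]
proof (rule sum.neutral, rule)
  fix c assume "c \<in> S"
  then have "card S = Suc (card (S - {c}))" by (intro card.remove) simp_all
  then have "card (S - {c}) \<noteq> m" using assms(3) by linarith
  then show "(\<Prod>d\<in>S. if coord_index c < coord_index d then -1 else 1) * a (S - {c}) * b {c} = 0"
    using a by simp
qed

lemma one_form_support: "one_form a \<Longrightarrow> card S \<noteq> 1 \<Longrightarrow> a S = 0"
  unfolding one_form_def by (drule spec[of _ S]) auto

lemma wedge4_support:
  assumes "one_form a" "one_form b" "one_form d" "one_form e" "S \<noteq> UNIV"
  shows "(a \<and>\<^sub>w b \<and>\<^sub>w d \<and>\<^sub>w e) S = 0"
proof (rule wedge_one_form_support[of _ 3])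
  have "card S < card (UNIV :: coord set)" using assms(5) by (intro psubset_card_mono) auto
  then show "card S \<noteq> Suc 3" by (simp add: UNIV_coord)
  show "(a \<and>\<^sub>w b \<and>\<^sub>w d) S = 0" if "card S \<noteq> 3" for S
  proof (rule wedge_one_form_support[of _ 2])
    show "(a \<and>\<^sub>w b) S = 0" if "card S \<noteq> 2" for S
      by (rule wedge_one_form_support[of _ 1]) (use assms one_form_support that in auto)
  qed (use assms that in auto)
qed (use assms in auto)

text \<open>Laplace expansion of a determinant of size four by minors of size two.\<close>

lemma wedge4_UNIV:
  assumes "one_form a" "one_form b" "one_form d" "one_form e"
  defines "m2 c c' \<equiv> a {c} * b {c'} - a {c'} * b {c}"
    and "n2 c c' \<equiv> d {c} * e {c'} - d {c'} * e {c}"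
  shows "(a \<and>\<^sub>w b \<and>\<^sub>w d \<and>\<^sub>w e) UNIV =
    m2 U Ubar * n2 W Wbar - m2 U W * n2 Ubar Wbar + m2 U Wbar * n2 Ubar W
    + m2 Ubar W * n2 U Wbar - m2 Ubar Wbar * n2 U W + m2 W Wbar * n2 U Ubar"
  unfolding UNIV_coord m2_def n2_def
  by (simp add: wedge_one_form assms insert_Diff_if algebra_simps)

lemma dvol_eq: "dvol S = (if S = UNIV then 4 * \<i> else 0)"
  by (simp add: dvol_def wedge4_support wedge4_UNIV dx_def)

section \<open>Contraction of the background two-form with the negative helicity one-forms\<close>

section \<open>The MHV four-form\<close>

lemma one_form_tetrad [simp]: "one_form (tetrad f A A' X)"
  by (simp add: one_form_def tetrad_def dx_def)

text \<open>
  The second derivatives of the potential drop out of the four-form: the tetrad has constant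
  determinant.
\<close>

lemma tetrad_four_form:
  fixes p q \<kappa> \<mu> :: "2 \<Rightarrow> eps_alg" and f :: "point \<Rightarrow> eps_alg" and X :: point
  assumes \<kappa>: "\<kappa> 2 = 1" and \<mu>: "\<mu> 2 = 1"
  defines "a \<equiv> \<lambda>A' R. \<Sum>C\<in>UNIV. \<kappa> C * tetrad f C A' X R"
    and "b \<equiv> \<lambda>A' R. \<Sum>C\<in>UNIV. \<mu> C * tetrad f C A' X R"
  shows "(\<Sum>A\<in>UNIV. \<Sum>B\<in>UNIV. \<kappa> A * \<mu> B * (Sigma0 f A B X
      \<and>\<^sub>w (\<lambda>R. \<Sum>A'\<in>UNIV. p A' * a A' R) \<and>\<^sub>w (\<lambda>R. \<Sum>A'\<in>UNIV. q A' * b A' R)) S) =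
    (if S = UNIV then 16 * ((\<kappa> 1 - \<mu> 1) * (\<kappa> 1 - \<mu> 1)) * (p 1 * q 2 - p 2 * q 1) else 0)"
proof -
  let ?h = "\<lambda>R. \<Sum>A'\<in>UNIV. p A' * a A' R" and ?k = "\<lambda>R. \<Sum>A'\<in>UNIV. q A' * b A' R"
  have one_a: "one_form (a A')" and one_b: "one_form (b A')" for A'
    unfolding a_def b_def by (intro one_form_sum one_form_scale one_form_tetrad)+
  have one_h: "one_form ?h" and one_k: "one_form ?k"
    by (intro one_form_sum one_form_scale one_a one_b)+
  \<comment> \<open>Lowering the dotted index gives the two terms their opposite signs.\<close>
  have Sig: "(\<Sum>A\<in>UNIV. \<Sum>B\<in>UNIV. \<kappa> A * \<mu> B * Sigma0 f A B X R) =
      - (a 1 \<and>\<^sub>w b 2) R + (a 2 \<and>\<^sub>w b 1) R" for R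
    by (simp add: a_def b_def Sigma0_def sum_2 wedge_add_left wedge_add_right wedge_scale_left
        wedge_scale_right wedge_scale_right[of _ "-1", simplified] wedge_zero_right eps_down_def
        algebra_simps)
  have "(\<Sum>A\<in>UNIV. \<Sum>B\<in>UNIV. \<kappa> A * \<mu> B * (Sigma0 f A B X \<and>\<^sub>w ?h \<and>\<^sub>w ?k) S) =
      ((\<lambda>R. \<Sum>A\<in>UNIV. \<Sum>B\<in>UNIV. \<kappa> A * \<mu> B * Sigma0 f A B X R) \<and>\<^sub>w ?h \<and>\<^sub>w ?k) S"
  proof -
    have "((\<lambda>R. \<Sum>A\<in>UNIV. \<Sum>B\<in>UNIV. \<kappa> A * \<mu> B * Sigma0 f A B X R) \<and>\<^sub>w ?h) =
      (\<lambda>R. \<Sum>A\<in>UNIV. \<Sum>B\<in>UNIV. \<kappa> A * \<mu> B * (Sigma0 f A B X \<and>\<^sub>w ?h) R)"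
      by (rule ext) (simp only: wedge_sum_left wedge_scale_left)
    then show ?thesis by (simp only: wedge_sum_left wedge_scale_left)
  qed
  also have "\<dots> = - (a 1 \<and>\<^sub>w b 2 \<and>\<^sub>w ?h \<and>\<^sub>w ?k) S + (a 2 \<and>\<^sub>w b 1 \<and>\<^sub>w ?h \<and>\<^sub>w ?k) S"
  proof -
    have "((\<lambda>R. - (a 1 \<and>\<^sub>w b 2) R + (a 2 \<and>\<^sub>w b 1) R) \<and>\<^sub>w ?h) =
      (\<lambda>R. - (a 1 \<and>\<^sub>w b 2 \<and>\<^sub>w ?h) R + (a 2 \<and>\<^sub>w b 1 \<and>\<^sub>w ?h) R)"
      by (rule ext) (simp only: wedge_add_left wedge_minus_left)
    then show ?thesis unfolding Sig by (simp only: wedge_add_left wedge_minus_left)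
  qed
  also have "\<dots> = (if S = UNIV
      then 16 * ((\<kappa> 1 - \<mu> 1) * (\<kappa> 1 - \<mu> 1)) * (p 1 * q 2 - p 2 * q 1) else 0)"
  proof (cases "S = UNIV")
    case True
    define r where "r = pd U (pd W f) X"
    define s where "s = pd U (pd U f) X"
    define t where "t = pd W (pd W f) X"
    have a1: "a 1 {U} = 0" "a 1 {Ubar} = 2 * (\<kappa> 1 - r)" "a 1 {W} = 2" "a 1 {Wbar} = - 2 * s"
      and a2: "a 2 {U} = 2" "a 2 {Ubar} = 2 * t" "a 2 {W} = 0" "a 2 {Wbar} = 2 * (\<kappa> 1 + r)"
      and b1: "b 1 {U} = 0" "b 1 {Ubar} = 2 * (\<mu> 1 - r)" "b 1 {W} = 2" "b 1 {Wbar} = - 2 * s"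
      and b2: "b 2 {U} = 2" "b 2 {Ubar} = 2 * t" "b 2 {W} = 0" "b 2 {Wbar} = 2 * (\<mu> 1 + r)"
      by (simp_all add: a_def b_def sum_2 tetrad_def dx_def \<kappa> \<mu> r_def s_def t_def
          algebra_simps)
    show ?thesis
      unfolding True wedge4_UNIV[OF one_a one_b one_h one_k]
      by (simp add: sum_2 a1 a2 b1 b2) (simp add: algebra_simps)
  qed (simp add: wedge4_support one_a one_b one_h one_k)
  finally show ?thesis .
qed

section \<open>Background, exponentials and derivatives expressed by \<open>Y\<close>,
  \<open>Z\<close> and \<open>E\<close>\<close>

section \<open>The fields in terms of tree generating functions\<close>

context scattering
begin

declare One_nat_def [simp del]

definition wave :: "point \<Rightarrow> nat \<Rightarrow> complex" where
  "wave X k = exp (\<i> * pairing (mom \<omega> z zb k) X)"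

lemma ecoeff_phi_tree:
  assumes "finite P"
  shows "ecoeff (phi_tree \<omega> z zb (P, F) X) R =
    (if R = P then (\<Prod>e\<in>F. edge_weight \<omega> z zb e) * prod (wave X) P else 0)"
proof -
  have "phi_tree \<omega> z zb (P, F) X =
      cst ((\<Prod>e\<in>F. edge_weight \<omega> z zb e) * prod (wave X) P) * (\<Prod>k\<in>P. eps k)"
    by (simp add: phi_tree_def seed_def prod.distrib cst_prod cst_mult wave_def mult_ac)
  moreover have "ecoeff (\<Prod>k\<in>P. eps k) R = (if R = P then 1 else 0)"
    using assms ecoeff_prod_eps[OF assms, of 1 R] by (auto simp: ecoeff_one)
  ultimately show ?thesis by (simp add: ecoeff_cst_mult)
qed

text \<open>Grouping by the vertex set \<open>R\<close>, the trees on \<open>R\<close> add up to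
  \<open>T R\<close>, a choice of the node \<open>k\<close> in \<open>R\<close> is recorded by
  \<open>Y k\<close>, and the plane waves of the nodes form the factor introduced by
  \<open>rescale\<close>.\<close>

lemma sum_phi_tree:
  "(\<Sum>(t, k)\<in>Sigma (trees N) fst. cst (f k) * phi_tree \<omega> z zb t X) =
    rescale (wave X) (\<Sum>k=1..N. cst (f k) * Y k)"
proof (rule eps_eqI)
  fix R :: "nat set" assume R: "finite R"
  have fin_trees: "finite (trees N)"
    by (rule finite_subset[of _ "Pow {1..N} \<times> Pow (Pow {1..N})"])
      (auto simp: trees_def is_tree_def simple_graph_def)
  have finP: "finite (fst t)" if "t \<in> trees N" for t
  proof -
    have "fst t \<subseteq> {1..N}" using that by (auto simp: trees_def)
    then show ?thesis by (rule finite_subset) simp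
  qed
  have wt: "edge_weight \<omega> z zb = (\<lambda>e. w (Min e) (Max e))"
    by (simp add: fun_eq_iff edge_weight_def wt_def)
  have "ecoeff (\<Sum>(t, k)\<in>Sigma (trees N) fst. cst (f k) * phi_tree \<omega> z zb t X) R =
      (\<Sum>t\<in>trees N. \<Sum>k\<in>fst t. f k * ecoeff (phi_tree \<omega> z zb t X) R)"
    using fin_trees finP
    by (simp add: ecoeff_sum case_prod_unfold ecoeff_cst_mult sum.Sigma)
  also have "\<dots> = (\<Sum>t\<in>trees N. if fst t = R
      then (\<Sum>k\<in>R. f k) * (\<Prod>e\<in>snd t. edge_weight \<omega> z zb e) * prod (wave X) R else 0)"
  proof (rule sum.cong)
    fix t assume t: "t \<in> trees N"
    obtain P F where PF: "t = (P, F)" by (cases t)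
    show "(\<Sum>k\<in>fst t. f k * ecoeff (phi_tree \<omega> z zb t X) R) = (if fst t = R
      then (\<Sum>k\<in>R. f k) * (\<Prod>e\<in>snd t. edge_weight \<omega> z zb e) * prod (wave X) R else 0)"
      using finP[OF t] unfolding PF
      by (auto simp: ecoeff_phi_tree sum_distrib_right mult.assoc)
  qed simp
  also have "\<dots> = (\<Sum>t\<in>{t \<in> trees N. fst t = R}.
      (\<Sum>k\<in>R. f k) * (\<Prod>e\<in>snd t. edge_weight \<omega> z zb e) * prod (wave X) R)"
    using fin_trees by (simp add: sum.inter_filter)
  also have "\<dots> = (\<Sum>F\<in>{F. R \<subseteq> {1..N} \<and> is_tree R F}.
      (\<Sum>k\<in>R. f k) * (\<Prod>e\<in>F. edge_weight \<omega> z zb e) * prod (wave X) R)"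
    by (rule sum.reindex_bij_witness[of _ "\<lambda>F. (R, F)" snd]) (auto simp: trees_def)
  also have "\<dots> = (if R \<subseteq> {1..N} then (\<Sum>k\<in>R. f k) * T R * prod (wave X) R else 0)"
    by (simp add: T_def tree_sum_def wt sum_distrib_left sum_distrib_right)
  also have "\<dots> = ecoeff (rescale (wave X) (\<Sum>k=1..N. cst (f k) * Y k)) R"
  proof (cases "R \<subseteq> {1..N}")
    case True
    have "(\<Sum>k=1..N. f k * ecoeff (Y k) R) = (\<Sum>k\<in>R. f k * T R)"
      by (rule sum.mono_neutral_cong_right) (use True in \<open>auto simp: ecoeff_Y\<close>)
    then show ?thesis
      using True
      by (simp add: ecoeff_rescale ecoeff_sum ecoeff_cst_mult sum_distrib_left
          sum_distrib_right mult_ac)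
  next
    case False
    then have "ecoeff (Y k) R = 0" for k by (simp add: ecoeff_Y)
    then show ?thesis using False by (auto simp: ecoeff_rescale ecoeff_sum ecoeff_cst_mult)
  qed
  finally show "ecoeff (\<Sum>(t, k)\<in>Sigma (trees N) fst. cst (f k) * phi_tree \<omega> z zb t X) R =
      ecoeff (rescale (wave X) (\<Sum>k=1..N. cst (f k) * Y k)) R" .
qed

lemma F_contr_rescale:
  "F_contr N \<omega> z zb L \<xi> X =
     cst (\<xi> 1 * (X W - z L * X Ubar) + \<xi> 2 * (X U - z L * X Wbar))
     - cst \<i> * rescale (wave X) (\<Sum>k=1..N. cst (sqs \<xi> (kt k) / ang z L k) * Y k)"
  unfolding F_contr_def sum_phi_tree ..

lemma prod_wave: "finite R \<Longrightarrow> prod (wave X) R = exp (\<i> * (\<Sum>k\<in>R. pairing (mom \<omega> z zb k) X))"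
  by (simp add: wave_def exp_sum sum_distrib_left)

lemma pairing_upd: "pairing P (X(c := t)) = pairing P X + P c * (t - X c)"
  by (cases c) (simp_all add: pairing_def UNIV_coord algebra_simps)

text \<open>The coefficient at \<open>R\<close> depends on the point through a plane wave with the
  total momentum of \<open>R\<close>, whose components along \<open>W\<close> and \<open>U\<close>
  are sums of \<open>kt l A'\<close>. The imaginary unit so produced combines with that in front of
  the tree sum.\<close>

lemma pd_F_contr:
  "pd (if A' = 1 then W else U) (F_contr N \<omega> z zb L \<xi>) X = rescale (wave X) (dF L \<xi> A')"
proof (rule eps_eqI)
  fix R :: "nat set" assume R: "finite R"
  define c where "c = (if A' = (1::2) then W else U)"
  let ?G = "\<Sum>k=1..N. cst (sqs \<xi> (kt k) / ang z L k) * Y k"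
  let ?lin = "\<lambda>X. \<xi> 1 * (X W - z L * X Ubar) + \<xi> 2 * (X U - z L * X Wbar)"
  have A': "A' = 1 \<or> A' = 2" using UNIV_2 by auto
  have mom_c: "mom \<omega> z zb l c = kt l A'" for l
    using A' by (auto simp: c_def kapt_def)
  have lin: "?lin (X(c := t)) = ?lin X + \<xi> A' * (t - X c)" for t
    using A' by (auto simp: c_def algebra_simps)
  let ?p = "\<Sum>k\<in>R. pairing (mom \<omega> z zb k) X" and ?D = "\<Sum>k\<in>R. kt k A'"
  have pd: "prod (wave (X(c := t))) R = exp (\<i> * (?p + ?D * (t - X c)))" for t
    using R by (simp add: prod_wave pairing_upd mom_c sum.distrib sum_distrib_right)
  have F: "ecoeff (F_contr N \<omega> z zb L \<xi> (X(c := t))) R =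
      (if R = {} then ?lin X + \<xi> A' * (t - X c) else 0)
      - \<i> * (exp (\<i> * (?p + ?D * (t - X c))) * ecoeff ?G R)" for t
    unfolding F_contr_rescale ecoeff_diff ecoeff_cst ecoeff_cst_mult ecoeff_rescale lin pd ..
  have "((\<lambda>t. ecoeff (F_contr N \<omega> z zb L \<xi> (X(c := t))) R) has_field_derivative
      (if R = {} then \<xi> A' else 0) - \<i> * (exp (\<i> * ?p) * (\<i> * ?D) * ecoeff ?G R)) (at (X c))"
  proof -
    have "((\<lambda>t. exp (\<i> * (?p + ?D * (t - X c)))) has_field_derivative
        exp (\<i> * ?p) * (\<i> * ?D)) (at (X c))"
      by (auto intro!: derivative_eq_intros)
    moreover have "((\<lambda>t. if R = {} then ?lin X + \<xi> A' * (t - X c) else 0) has_field_derivative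
        (if R = {} then \<xi> A' else 0)) (at (X c))"
      by (cases "R = {}") (auto intro!: derivative_eq_intros)
    ultimately show ?thesis
      unfolding F by (intro DERIV_diff DERIV_cmult DERIV_cmult_right)
  qed
  moreover have "\<i> * (exp (\<i> * ?p) * (\<i> * ?D) * ecoeff ?G R) =
      - (exp (\<i> * ?p) * ?D * ecoeff ?G R)"
  proof -
    have "\<i> * (x * (\<i> * d) * y) = (\<i> * \<i>) * (x * d * y)" for x d y
      by (simp only: mult_ac)
    then show ?thesis by simp
  qed
  ultimately have "ecoeff (pd c (F_contr N \<omega> z zb L \<xi>) X) R =
      (if R = {} then \<xi> A' else 0) + exp (\<i> * ?p) * ?D * ecoeff ?G R"
    by (simp only: ecoeff_pd DERIV_imp_deriv diff_minus_eq_add)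
  \<comment> \<open>Summing over \<open>l\<close> in \<open>R\<close> marks a second node of the
    tree, which turns \<open>Y k\<close> into \<open>Z k l\<close>.\<close>
  also have "?D * ecoeff ?G R =
      ecoeff (mark (\<lambda>k. sqs \<xi> (kt k) / ang z L k) (\<lambda>l. kt l A')) R"
  proof (cases "R \<subseteq> {1..N}")
    case True
    have Z: "(\<Sum>l=1..N. a * kt l A' * ecoeff (Z k l) R) = (\<Sum>l\<in>R. a * kt l A' * ecoeff (Y k) R)"
      for a k
      by (rule sum.mono_neutral_cong_right) (use True in \<open>auto simp: ecoeff_Z ecoeff_Y\<close>)
    show ?thesis
      unfolding mark_def ecoeff_sum ecoeff_cst_mult Z sum_distrib_left sum_distrib_right
      by (simp add: mult_ac)
  next
    case False
    then show ?thesis by (simp add: mark_def ecoeff_sum ecoeff_cst_mult ecoeff_Z ecoeff_Y)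
  qed
  then have "exp (\<i> * ?p) * ?D * ecoeff ?G R = prod (wave X) R *
      ecoeff (mark (\<lambda>k. sqs \<xi> (kt k) / ang z L k) (\<lambda>l. kt l A')) R"
    by (simp add: prod_wave[OF R] mult.assoc)
  finally show "ecoeff (pd (if A' = 1 then W else U) (F_contr N \<omega> z zb L \<xi>) X) R =
      ecoeff (rescale (wave X) (dF L \<xi> A')) R"
    unfolding c_def by (simp add: dF_def ecoeff_rescale ecoeff_cst)
qed

lemma sum_H_neg:
  "(\<Sum>C'\<in>UNIV. cst (\<xi> C') * H_neg N \<omega> z zb L A' C' X) = rescale (wave X) (dF L \<xi> A')"
proof -
  let ?b = "\<lambda>C' B'. if B' = C' then 1 else 0 :: complex"
  have H: "H_neg N \<omega> z zb L A' C' X = rescale (wave X) (dF L (?b C') A')" for C'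
    unfolding H_neg_def F_comp_def pd_F_contr ..
  have A': "A' = 1 \<or> A' = 2" using UNIV_2 by auto
  have marks: "cst x * (cst (a / d * h) * y) + cst x' * (cst (a' / d * h) * y) =
      cst ((x * a + x' * a') / d * h) * y" for x x' a a' d h y
    by (simp only: mult.assoc[symmetric] cst_mult[symmetric] distrib_right[symmetric]
        cst_add[symmetric]) (simp add: add_divide_distrib)
  have "cst (\<xi> 1) * dF L (?b 1) A' + cst (\<xi> 2) * dF L (?b 2) A' =
      cst (\<xi> 1 * ?b 1 A' + \<xi> 2 * ?b 2 A') +
      (cst (\<xi> 1) * mark (\<lambda>k. sqs (?b 1) (kt k) / ang z L k) (\<lambda>l. kt l A')
       + cst (\<xi> 2) * mark (\<lambda>k. sqs (?b 2) (kt k) / ang z L k) (\<lambda>l. kt l A'))"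
    unfolding dF_def cst_add cst_mult distrib_left by (simp only: add_ac)
  also have "\<dots> = cst (\<xi> 1 * ?b 1 A' + \<xi> 2 * ?b 2 A') +
      (\<Sum>k=1..N. \<Sum>l=1..N. cst ((\<xi> 1 * sqs (?b 1) (kt k) + \<xi> 2 * sqs (?b 2) (kt k))
        / ang z L k * kt l A') * Z k l)"
    unfolding mark_def sum_distrib_left sum.distrib[symmetric] marks ..
  also have "\<dots> = dF L \<xi> A'"
  proof -
    have "\<xi> 1 * sqs (?b 1) (kt k) + \<xi> 2 * sqs (?b 2) (kt k) = sqs \<xi> (kt k)" for k
      by (simp add: sqs_def)
    moreover have "\<xi> 1 * ?b 1 A' + \<xi> 2 * ?b 2 A' = \<xi> A'" using A' by (auto)
    ultimately show ?thesis by (simp only: dF_def mark_def)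
  qed
  finally have eq: "dF L \<xi> A' = cst (\<xi> 1) * dF L (?b 1) A' + cst (\<xi> 2) * dF L (?b 2) A'"
    by (rule sym)
  show ?thesis
    unfolding H sum_2 by (subst eq) (simp only: rescale_add rescale_mult rescale_cst)
qed

text \<open>With \<open>kt L\<close> as the contracting spinor the linear part is the phase of
  \<open>L\<close> and the coefficient of \<open>Y k\<close> becomes the edge weight
  \<open>w L k\<close>; the exponential of these square-zero terms is the product
  \<open>E (w L)\<close>.\<close>

lemma eexp_F_neg:
  "eexp (cst \<i> * F_neg N \<omega> z zb L X) = cst (wave X L) * rescale (wave X) (E (w L))"
proof -
  have lin: "kt L 1 * (X W - z L * X Ubar) + kt L 2 * (X U - z L * X Wbar) =
      pairing (mom \<omega> z zb L) X"
    by (simp add: pairing_mom kapt_def algebra_simps)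
  have F: "cst \<i> * F_neg N \<omega> z zb L X =
      cst (\<i> * pairing (mom \<omega> z zb L) X) + (\<Sum>k=1..N. rescale (wave X) (cst (w L k) * Y k))"
  proof -
    have ii: "cst \<i> * (cst \<i> * x) = - x" for x
      by (simp add: mult.assoc[symmetric] cst_mult[symmetric] cst_minus)
    show ?thesis
      unfolding F_neg_def F_contr_eq[symmetric] F_contr_rescale lin
      unfolding right_diff_distrib ii
      by (simp add: cst_mult rescale_sum wt_def sq_kapt)
  qed
  have "eexp (cst \<i> * F_neg N \<omega> z zb L X) =
      cst (wave X L) * (\<Prod>k=1..N. 1 + rescale (wave X) (cst (w L k) * Y k))"
    unfolding F
  proof (subst eexp_add_sum_square_zero)
    show "rescale (wave X) (cst (w L k) * Y k) * rescale (wave X) (cst (w L k) * Y k) = 0" for k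
    proof -
      have "(cst (w L k) * Y k) * (cst (w L k) * Y k) = cst (w L k) * cst (w L k) * (Y k * Y k)"
        by (simp only: mult_ac)
      also have "\<dots> = 0" by simp
      finally show ?thesis by (simp only: rescale_mult[symmetric] rescale_zero)
    qed
  qed (simp add: eexp_cst wave_def)
  then show ?thesis by (simp only: E_def rescale_prod rescale_add rescale_one)
qed

definition amp :: "nat \<Rightarrow> spinor \<Rightarrow> point \<Rightarrow> eps_alg" where
  "amp L \<xi> X = eps L * (cst (- \<i> / (2 * sqs \<xi> (kt L)) * wave X L) * rescale (wave X) (E (w L)))"

definition hform :: "nat \<Rightarrow> spinor \<Rightarrow> point \<Rightarrow> eps_alg form" where
  "hform L \<xi> X = (\<lambda>S. \<Sum>A'\<in>UNIV. rescale (wave X) (dF L \<xi> A') *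
     (\<Sum>C\<in>UNIV. cst (kap z L C) * tetrad (phi N \<omega> z zb) C A' X S))"

lemma gam_eq:
  "gam N \<omega> z zb L \<xi> A B X = (\<lambda>S. cst (kap z L A) * cst (kap z L B) * amp L \<xi> X * hform L \<xi> X S)"
proof
  fix S
  have "(\<Sum>C\<in>UNIV. \<Sum>A'\<in>UNIV. \<Sum>C'\<in>UNIV.
      cst (kap z L C * \<xi> C') * H_neg N \<omega> z zb L A' C' X * tetrad (phi N \<omega> z zb) C A' X S) =
    (\<Sum>C\<in>UNIV. \<Sum>A'\<in>UNIV. cst (kap z L C) * ((\<Sum>C'\<in>UNIV. cst (\<xi> C') * H_neg N \<omega> z zb L A' C' X)
      * tetrad (phi N \<omega> z zb) C A' X S))"
    by (simp add: cst_mult sum_distrib_left sum_distrib_right mult_ac)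
  also have "\<dots> = hform L \<xi> X S"
    unfolding sum_H_neg hform_def sum_distrib_left
    by (subst sum.swap) (simp only: mult_ac)
  finally show "gam N \<omega> z zb L \<xi> A B X S =
      cst (kap z L A) * cst (kap z L B) * amp L \<xi> X * hform L \<xi> X S"
    unfolding gam_def amp_def eexp_F_neg
    by (simp only: cst_mult divide_inverse mult_ac mult_1)
qed

text \<open>One power of \<open>ang z I J\<close> comes from the index contracted between the two
  connections, two more from \<open>tetrad_four_form\<close>.\<close>

lemma MHV_form_eq:
  "MHV_form N \<omega> z zb \<xi> \<eta> X S = (if S = UNIV then
     amp I \<xi> X * amp J \<eta> X * cst (- 16 * ang z I J ^ 3) * rescale (wave X)
       (dF I \<xi> 1 * dF J \<eta> 2 - dF I \<xi> 2 * dF J \<eta> 1) else 0)"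
proof -
  let ?k = "\<lambda>L A. cst (kap z L A)" and ?Sig = "\<lambda>A B. Sigma0 (phi N \<omega> z zb) A B X"
  let ?K = "amp I \<xi> X * amp J \<eta> X * cst (z J - z I)"
  have eps: "(\<lambda>R. \<Sum>D\<in>UNIV. eps_up C D * gam N \<omega> z zb J \<eta> D B X R) =
      (\<lambda>R. (\<Sum>D\<in>UNIV. eps_up C D * ?k J D) * ?k J B * amp J \<eta> X * hform J \<eta> X R)" for C B
    unfolding gam_eq sum_distrib_right by (simp only: mult_ac)
  have contr: "(\<Sum>C\<in>UNIV. ?k I C * (\<Sum>D\<in>UNIV. eps_up C D * ?k J D)) = cst (z J - z I)"
    by (simp add: sum_2 eps_up_def kap_def cst_minus cst_diff)
  have "MHV_form N \<omega> z zb \<xi> \<eta> X S = (\<Sum>A\<in>UNIV. \<Sum>B\<in>UNIV. \<Sum>C\<in>UNIV.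
      ?k I C * (\<Sum>D\<in>UNIV. eps_up C D * ?k J D) * (amp I \<xi> X * amp J \<eta> X *
      (?k I A * ?k J B * (?Sig A B \<and>\<^sub>w hform I \<xi> X \<and>\<^sub>w hform J \<eta> X) S)))"
    unfolding MHV_form_def eps unfolding gam_eq wedge_scale_right
  proof (intro sum.cong refl, goal_cases)
    case (1 A B C)
    let ?c = "?k I A * ?k I C * amp I \<xi> X"
    have "(?Sig A B \<and>\<^sub>w (\<lambda>S. ?c * hform I \<xi> X S)) = (\<lambda>R. ?c * (?Sig A B \<and>\<^sub>w hform I \<xi> X) R)"
      by (rule ext) (rule wedge_scale_right)
    then show ?case
      by (simp only: wedge_scale_left mult_ac)
  qed
  also have "\<dots> = (\<Sum>A\<in>UNIV. \<Sum>B\<in>UNIV. cst (z J - z I) * (amp I \<xi> X * amp J \<eta> X *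
      (?k I A * ?k J B * (?Sig A B \<and>\<^sub>w hform I \<xi> X \<and>\<^sub>w hform J \<eta> X) S)))"
    by (simp only: sum_distrib_right[symmetric] contr)
  also have "\<dots> = ?K * (\<Sum>A\<in>UNIV. \<Sum>B\<in>UNIV.
      ?k I A * ?k J B * (?Sig A B \<and>\<^sub>w hform I \<xi> X \<and>\<^sub>w hform J \<eta> X) S)"
    unfolding sum_distrib_left by (simp only: mult_ac)
  also have "(\<Sum>A\<in>UNIV. \<Sum>B\<in>UNIV.
      ?k I A * ?k J B * (?Sig A B \<and>\<^sub>w hform I \<xi> X \<and>\<^sub>w hform J \<eta> X) S) =
    (if S = UNIV then 16 * ((?k I 1 - ?k J 1) * (?k I 1 - ?k J 1)) *
      (rescale (wave X) (dF I \<xi> 1) * rescale (wave X) (dF J \<eta> 2)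
       - rescale (wave X) (dF I \<xi> 2) * rescale (wave X) (dF J \<eta> 1)) else 0)"
    unfolding hform_def by (rule tetrad_four_form) (simp_all add: kap_def)
  also have "(?k I 1 - ?k J 1) * (?k I 1 - ?k J 1) = cst (ang z I J ^ 2)"
    by (simp add: kap_def ang_def cst_diff[symmetric] cst_mult[symmetric] power2_eq_square
        algebra_simps)
  also have "16 = cst 16"
    using cst_sum[of "\<lambda>_. 1" "{..<16::nat}"] by simp
  finally have *: "MHV_form N \<omega> z zb \<xi> \<eta> X S = ?K * (if S = UNIV
      then cst 16 * cst (ang z I J ^ 2) * (rescale (wave X) (dF I \<xi> 1) * rescale (wave X) (dF J \<eta> 2)
       - rescale (wave X) (dF I \<xi> 2) * rescale (wave X) (dF J \<eta> 1)) else 0)" .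
  have "cst (- 16 * ang z I J ^ 3) = cst (z J - z I) * (cst 16 * cst (ang z I J ^ 2))"
    unfolding cst_mult[symmetric] by (simp add: ang_def power3_eq_cube power2_eq_square)
      (simp add: algebra_simps)
  then show ?thesis
    unfolding * by (cases "S = UNIV") (simp_all only: if_True if_False rescale_mult rescale_diff
        mult_ac mult_zero_left mult_zero_right simp_thms)
qed

lemma top_coeff_MHV_form:
  assumes "sqs \<xi> (kt I) \<noteq> 0" "sqs \<eta> (kt J) \<noteq> 0"
  shows "top_coeff (N + 2) (MHV_form N \<omega> z zb \<xi> \<eta> X S) =
    \<i> * (- (ang z I J ^ 3 * reduced \<xi> \<eta> / (sqs \<xi> (kt I) * sqs \<eta> (kt J))))
      * exp (\<i> * (\<Sum>i=1..N + 2. pairing (mom \<omega> z zb i) X)) * dvol S"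
proof (cases "S = UNIV")
  case True
  let ?D = "dF I \<xi> 1 * dF J \<eta> 2 - dF I \<xi> 2 * dF J \<eta> 1"
  let ?c = "(- \<i> / (2 * sqs \<xi> (kt I)) * wave X I) * (- \<i> / (2 * sqs \<eta> (kt J)) * wave X J)
      * (- 16 * ang z I J ^ 3)"
  have "MHV_form N \<omega> z zb \<xi> \<eta> X S =
      eps I * (eps J * (cst ?c * rescale (wave X) (?D * E roots)))"
    unfolding MHV_form_eq amp_def E_mult[symmetric] rescale_mult cst_mult using True
    by (simp only: if_True simp_thms mult_ac)
  then have "top_coeff (N + 2) (MHV_form N \<omega> z zb \<xi> \<eta> X S) =
      ecoeff (cst ?c * rescale (wave X) (?D * E roots)) ({1..N + 2} - {I} - {J})"
    by (simp add: top_coeff_def ecoeff_eps_mult)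
  also have "{1..N + 2} - {I} - {J} = {1..N}" by auto
  also have "ecoeff (cst ?c * rescale (wave X) (?D * E roots)) {1..N} =
      ?c * (prod (wave X) {1..N} * reduced \<xi> \<eta>)"
    by (simp only: ecoeff_cst_mult ecoeff_rescale reduced_def)
  \<comment> \<open>The numerical factors agree: the square of \<open>- \<i> / 2\<close> times
    \<open>- 16\<close> is \<open>4\<close>, which is \<open>\<i> * (- 1) * (4 * \<i>)\<close>, the
    last factor being the value of \<open>dvol\<close>.\<close>
  also have "\<dots> = \<i> * (- (ang z I J ^ 3 * reduced \<xi> \<eta> / (sqs \<xi> (kt I) * sqs \<eta> (kt J))))
      * (prod (wave X) {1..N} * wave X I * wave X J) * (4 * \<i>)"
    using assms by (simp add: field_simps)
  also have "prod (wave X) {1..N} * wave X I * wave X J = prod (wave X) {1..N + 2}"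
  proof -
    have "{1..N + 2} = insert I (insert J {1..N})" by auto
    then show ?thesis by (simp add: mult_ac)
  qed
  finally show ?thesis using True by (simp only: prod_wave[OF finite_atLeastAtMost] dvol_eq if_True simp_thms)
next
  case False
  then show ?thesis by (simp add: MHV_form_eq dvol_eq top_coeff_def)
qed

end

section \<open>Vertex degrees and assembly of the formula\<close>

section \<open>The NSVW formula\<close>

text \<open>Double counting of incidences: each edge contributes \<open>f\<close> once at either
  end.\<close>

lemma prod_deg:
  assumes E: "simple_graph V E" and V: "finite V"
  shows "(\<Prod>a\<in>V. f a ^ deg E a) = (\<Prod>e\<in>E. f (Min e) * f (Max e) :: 'a::comm_monoid_mult)"
proof -
  have finE: "finite E"
    using E V by (intro finite_subset[of E "Pow V"]) (auto simp: simple_graph_def)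
  have "(\<Prod>a\<in>V. f a ^ deg E a) = (\<Prod>a\<in>V. \<Prod>e\<in>E. if a \<in> e then f a else 1)"
    using finE by (simp add: deg_def prod.inter_filter[symmetric])
  also have "\<dots> = (\<Prod>e\<in>E. \<Prod>a\<in>V. if a \<in> e then f a else 1)"
    by (rule prod.swap)
  also have "\<dots> = (\<Prod>e\<in>E. f (Min e) * f (Max e))"
  proof (rule prod.cong)
    fix e assume e: "e \<in> E"
    then have "e \<subseteq> V" "card e = 2" using E by (auto simp: simple_graph_def)
    then obtain x y where xy: "e = {x, y}" "x \<noteq> y" by (auto simp: card_2_iff)
    have "(\<Prod>a\<in>V. if a \<in> e then f a else 1) = (\<Prod>a\<in>{a\<in>V. a \<in> e}. f a)"
      using V by (simp add: prod.inter_filter)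
    also have "{a\<in>V. a \<in> e} = e" using \<open>e \<subseteq> V\<close> by auto
    finally show "(\<Prod>a\<in>V. if a \<in> e then f a else 1) = f (Min e) * f (Max e)"
      using xy by (auto simp: min_def max_def mult.commute)
  qed simp
  finally show ?thesis .
qed

text \<open>The end factors of the edges collect to powers of \<open>f\<close> by degree, and the
  denominator lowers each exponent by two. The exponent is negative at leaves, whence
  \<open>powi\<close>.\<close>

lemma (in scattering) tree_sum_deg:
  assumes f: "\<And>a. a \<in> {1..N} \<Longrightarrow> f a \<noteq> (0 :: complex)"
  shows "tree_sum (\<lambda>e. f (Min e) * w (Min e) (Max e) * f (Max e)) {1..N} / (\<Prod>k=1..N. (f k)\<^sup>2) =
    (\<Sum>F\<in>max_trees N. (\<Prod>e\<in>F. edge_weight \<omega> z zb e) * (\<Prod>a=1..N. f a powi (int (deg F a) - 2)))"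
  unfolding tree_sum_def max_trees_def sum_divide_distrib
proof (rule sum.cong)
  fix F assume "F \<in> {F. is_tree {1..N} F}"
  then have F: "simple_graph {1..N} F" by (simp add: is_tree_def)
  have ew: "edge_weight \<omega> z zb e = w (Min e) (Max e)" for e
    by (simp add: edge_weight_def wt_def)
  have "(\<Prod>a=1..N. f a powi (int (deg F a) - 2)) = (\<Prod>a=1..N. f a ^ deg F a / (f a)\<^sup>2)"
    by (intro prod.cong refl) (use f in \<open>simp add: power_int_diff\<close>)
  also have "\<dots> = (\<Prod>e\<in>F. f (Min e) * f (Max e)) / (\<Prod>k=1..N. (f k)\<^sup>2)"
    by (simp only: prod_dividef prod_deg[OF F finite_atLeastAtMost])
  finally show "(\<Prod>e\<in>F. f (Min e) * w (Min e) (Max e) * f (Max e)) / (\<Prod>k=1..N. (f k)\<^sup>2) =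
      (\<Prod>e\<in>F. edge_weight \<omega> z zb e) * (\<Prod>a=1..N. f a powi (int (deg F a) - 2))"
    by (simp only: ew prod.distrib divide_inverse mult_ac)
qed simp

theorem mainTheorem2:
  fixes N I J :: nat
    and \<omega> z zb :: "nat \<Rightarrow> complex"
    and \<xi> \<eta> :: spinor
    and intg :: "(point \<Rightarrow> complex form) \<Rightarrow> complex"
    and \<delta> :: "(coord \<Rightarrow> complex) \<Rightarrow> complex"
  assumes "N \<ge> 1" and "I = N + 1" and "J = N + 2"
    and "\<forall>i\<in>{1..N + 2}. \<omega> i \<noteq> 0"
    and "inj_on z {1..N + 2}"
    and "sqs \<xi> (kapt \<omega> zb I) \<noteq> 0"
    and "sqs \<eta> (kapt \<omega> zb J) \<noteq> 0"
    and "plane_wave_rule intg \<delta>"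
  shows "(\<forall>X S. top_coeff (N + 2) (MHV_form N \<omega> z zb \<xi> \<eta> X S)
            = \<i> * stripped_MHV N \<omega> z zb \<xi> \<eta>
                * exp (\<i> * (\<Sum>i=1..N + 2. pairing (mom \<omega> z zb i) X)) * dvol S) \<and>
         MHV_amplitude intg N \<omega> z zb \<xi> \<eta>
            = \<i> * (2 * of_real pi) ^ 4 * \<delta> (\<lambda>c. \<Sum>i=1..N + 2. mom \<omega> z zb i c)
                * stripped_MHV N \<omega> z zb \<xi> \<eta> \<and>
         ((\<forall>c. (\<Sum>i=1..N + 2. mom \<omega> z zb i c) = 0) \<longrightarrow>
            stripped_MHV N \<omega> z zb \<xi> \<eta>
              = ang z I J ^ 6 *
                (\<Sum>E\<in>max_trees N.
                   (\<Prod>e\<in>E. edge_weight \<omega> z zb e) *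
                   (\<Prod>a=1..N. (ang z a I * ang z a J) powi (int (deg E a) - 2))))"
proof -
  interpret scattering N \<omega> z zb
    using assms by unfold_locales auto
  define M where "M = - (ang z I J ^ 3 * reduced \<xi> \<eta> / (sqs \<xi> (kt I) * sqs \<eta> (kt J)))"
  have sqs: "sqs \<xi> (kt (N + 1)) \<noteq> 0" "sqs \<eta> (kt (N + 2)) \<noteq> 0"
    using assms by simp_all
  have pair_total: "pairing (total_mom (N + 2) \<omega> z zb) X = (\<Sum>i=1..N + 2. pairing (mom \<omega> z zb i) X)"
    for X
    unfolding pairing_def total_mom_def sum_distrib_right by (rule sum.swap)
  have top: "top_coeff (N + 2) (MHV_form N \<omega> z zb \<xi> \<eta> X S) =
      \<i> * M * exp (\<i> * pairing (total_mom (N + 2) \<omega> z zb) X) * dvol S" for X S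
    unfolding pair_total M_def assms(2,3) by (rule top_coeff_MHV_form[OF sqs])
  \<comment> \<open>Evaluation at the origin on the top form, where the phase is one and
    \<open>dvol\<close> is nonzero, determines the constant.\<close>
  have M: "stripped_MHV N \<omega> z zb \<xi> \<eta> = M"
    unfolding stripped_MHV_def
  proof (rule the_equality)
    fix M' assume "\<forall>X S. top_coeff (N + 2) (MHV_form N \<omega> z zb \<xi> \<eta> X S) =
      \<i> * M' * exp (\<i> * pairing (total_mom (N + 2) \<omega> z zb) X) * dvol S"
    then have "\<i> * M' * exp (\<i> * pairing (total_mom (N + 2) \<omega> z zb) (\<lambda>_. 0)) * dvol UNIV =
        \<i> * M * exp (\<i> * pairing (total_mom (N + 2) \<omega> z zb) (\<lambda>_. 0)) * dvol UNIV"
      using top by metis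
    then show "M' = M" by (simp add: dvol_eq)
  qed (use top in blast)
  have "MHV_amplitude intg N \<omega> z zb \<xi> \<eta> =
      intg (\<lambda>X S. top_coeff (N + 2) (MHV_form N \<omega> z zb \<xi> \<eta> X S))"
    unfolding MHV_amplitude_def top_coeff_def eps_integral_def by (subst ecoeff_Abs) simp_all
  also have "\<dots> = \<i> * M * ((2 * of_real pi) ^ 4 * \<delta> (total_mom (N + 2) \<omega> z zb))"
    using assms(8) unfolding top plane_wave_rule_def by blast
  also have "total_mom (N + 2) \<omega> z zb = (\<lambda>c. \<Sum>i=1..N + 2. mom \<omega> z zb i c)"
    by (rule ext) (rule total_mom_def)
  finally have amplitude: "MHV_amplitude intg N \<omega> z zb \<xi> \<eta> =
      \<i> * (2 * of_real pi) ^ 4 * \<delta> (\<lambda>c. \<Sum>i=1..N + 2. mom \<omega> z zb i c) * M"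
    by (simp only: mult_ac)
  have formula: "M = ang z I J ^ 6 * (\<Sum>F\<in>max_trees N. (\<Prod>e\<in>F. edge_weight \<omega> z zb e) *
      (\<Prod>a=1..N. (ang z a I * ang z a J) powi (int (deg F a) - 2)))"
    if cons: "\<forall>c. (\<Sum>i=1..N + 2. mom \<omega> z zb i c) = 0"
  proof -
    have sums: "(\<Sum>i=1..N + 2. \<omega> i) = 0" "(\<Sum>i=1..N + 2. \<omega> i * z i) = 0"
      "(\<Sum>i=1..N + 2. \<omega> i * zb i) = 0" "(\<Sum>i=1..N + 2. \<omega> i * z i * zb i) = 0"
      using cons total_mom_eq_0_iff[of "N + 2" \<omega> z zb] unfolding total_mom_def by blast+
    \<comment> \<open>Momentum conservation in spinor form: the four components of the total
      momentum are, up to sign, the sums in \<open>kt0\<close> and \<open>kt1\<close>.\<close>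
    have kt0: "(\<Sum>i=1..N + 2. kt i A) = 0" for A
    proof (cases "A = 1")
      case True
      have "(\<Sum>i=1..N + 2. kt i A) = - (\<Sum>i=1..N + 2. \<omega> i * zb i)"
        unfolding sum_negf[symmetric] by (intro sum.cong refl) (simp add: kapt_def True)
      then show ?thesis by (simp only: sums minus_zero)
    next
      case False
      have "(\<Sum>i=1..N + 2. kt i A) = (\<Sum>i=1..N + 2. \<omega> i)"
        by (intro sum.cong refl) (simp add: kapt_def False)
      then show ?thesis by (simp only: sums minus_zero)
    qed
    have kt1: "(\<Sum>i=1..N + 2. z i * kt i A) = 0" for A
    proof (cases "A = 1")
      case True
      have "(\<Sum>i=1..N + 2. z i * kt i A) = - (\<Sum>i=1..N + 2. \<omega> i * z i * zb i)"
        unfolding sum_negf[symmetric] by (intro sum.cong refl) (simp add: kapt_def True)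
      then show ?thesis by (simp only: sums minus_zero)
    next
      case False
      have "(\<Sum>i=1..N + 2. z i * kt i A) = (\<Sum>i=1..N + 2. \<omega> i * z i)"
        by (intro sum.cong refl) (simp add: kapt_def False)
      then show ?thesis by (simp only: sums minus_zero)
    qed
    have n: "ang z a (N + 1) * ang z a (N + 2) \<noteq> 0" if "a \<in> {1..N}" for a
      using that z_neq[of a "N + 1"] z_neq[of a "N + 2"] by (simp add: ang_def)
    let ?s = "\<Sum>F\<in>max_trees N. (\<Prod>e\<in>F. edge_weight \<omega> z zb e) *
      (\<Prod>a=1..N. (ang z a (N + 1) * ang z a (N + 2)) powi (int (deg F a) - 2))"
    have "reduced \<xi> \<eta> = - (sqs \<xi> (kt (N + 1)) * sqs \<eta> (kt (N + 2)) * ang z (N + 1) (N + 2) ^ 3 * ?s)"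
      using reduced_eq[OF kt0 kt1, of \<xi> \<eta>]
        tree_sum_deg[of "\<lambda>a. ang z a (N + 1) * ang z a (N + 2)", OF n] by (simp only:)
    \<comment> \<open>One cube of \<open>ang z I J\<close> stems from the four-form, the other from
      \<open>reduced_eq\<close>; the brackets with the reference spinors cancel.\<close>
    then show ?thesis
      using sqs unfolding M_def assms(2,3) by (simp add: power_add[symmetric])
  qed
  show ?thesis
    using top amplitude formula unfolding M pair_total by blast
qed

end
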